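(* Let $\mathfrak g$ be a simple simply-laced Lie algebra of rank $r$. For all $\boldsymbol\ell\in\mathbb Z_+^r$ and all finitely supported $\mathbf n=(n_{\alpha,i})_{\alpha\in I_r,i\ge1}$ with entries in $\mathbb Z_+$ and $n_{\alpha,i}=0$ for $i>k$, $$M_{\boldsymbol\ell,\mathbf n}(q^{-1})=t^{\sum_{\alpha,\beta,i}n_{\alpha,i}\lambda_{\alpha,\beta}+\frac12\left(\sum_\alpha\ell_\alpha\lambda_{\alpha,\alpha}+\mathbf n\cdot(\lambda\otimes A)\mathbf n\right)}\;\mathrm{CT}_{\widehat{\mathbf Q}_1}\,\rho\Big(\prod_{i=1}^k\prod_{\alpha=1}^r\widehat Q_{\alpha,i}^{\,n_{\alpha,i}}\prod_{\beta=1}^rz_\beta^{\ell_\beta+1}\Big),$$ where $$z_\beta=\lim_{k\to\infty}\widehat Q_{\beta,k}\widehat Q_{\beta,k+1}^{-1}=\widehat Q_{\beta,0}\widehat Q_{\beta,1}^{-1}\prod_{k=1}^\infty\Big(1-\prod_{\alpha=1}^r\widehat Q_{\alpha,k}^{-C_{\alpha,\beta}}\Big)^{-1}.$$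
   Context: $\mathbb Z_+=\{0,1,2,\dots\}$, $I_r=\{1,\dots,r\}$; $C$ is the Cartan matrix of $\mathfrak g$, $\delta=\det C$, $\lambda=\delta C^{-1}$, $A_{i,j}=\min(i,j)$, $q=t^{-\delta}$. For $a\in\mathbb Z_+$, $b\in\mathbb Z$, $\left[\begin{matrix}a+b\\ a\end{matrix}\right]_q$ is the coefficient of $x^a$ in $\prod_{i=0}^{b}(1-q^ix)^{-1}$ if $b\ge0$, and in $\prod_{i=0}^{-b-1}(1-q^{i+b+1}x)$ if $b<0$. Graded multiplicities: for $K\ge1$, with indices $\alpha\in I_r$, $1\le i\le K$, put $\mathbf p=(I\otimes A)\mathbf n-(C\otimes A)\mathbf m$, $q_{\alpha,0}=\ell_\alpha-p_{\alpha,K}$, $Q(\mathbf m,\mathbf n)=-\frac12\mathbf m\cdot(\mathbf p+(I\otimes A)\mathbf n)$ and $$M^{(K)}_{\boldsymbol\ell;\mathbf n}(q^{-1})=\sum_{\substack{m_{\alpha,i}\in\mathbb Z_+\\ q_{\alpha,0}=0;\ p_{\alpha,i}\ge0}}q^{Q(\mathbf m,\mathbf n)}\prod_{\alpha=1}^r\prod_{i=1}^K\left[\begin{matrix}m_{\alpha,i}+p_{\alpha,i}\\ m_{\alpha,i}\end{matrix}\right]_q.$$ $M_{\boldsymbol\ell,\mathbf n}(q^{-1})$ is the value of $M^{(K)}_{\boldsymbol\ell;\mathbf n}(q^{-1})$ for $K$ sufficiently large with respect to $\mathbf n$ (where it does not depend on $K$). Quantum $Q$-system: $\widehat Q_{\alpha,0},\widehat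 Q_{\alpha,1}$ ($\alpha\in I_r$) are invertible variables with $\widehat Q_{\alpha,n}\widehat Q_{\beta,m}=t^{\lambda_{\alpha,\beta}(m-n)}\widehat Q_{\beta,m}\widehat Q_{\alpha,n}$ for $m,n\in\{0,1\}$, and $\widehat Q_{\alpha,n}$, $n\in\mathbb Z$, are defined by $$t^{\lambda_{\alpha,\alpha}}\widehat Q_{\alpha,n+1}\widehat Q_{\alpha,n-1}=\widehat Q_{\alpha,n}^2-\prod_{\beta\ne\alpha}\widehat Q_{\beta,n}^{-C_{\alpha,\beta}};$$ they are Laurent polynomials in the $\widehat Q_{\alpha,0},\widehat Q_{\alpha,1}$. Inverses and infinite products are expanded as formal Laurent series in the $\widehat Q_{\alpha,1}^{-1}$ with coefficients Laurent polynomials in the $\widehat Q_{\alpha,0}$; concretely, as finite sums of Laurent monomials times formal power series in the elements $x_\beta=\prod_{\alpha}\widehat Q_{\alpha,1}^{-C_{\alpha,\beta}}$, $\beta\in I_r$. Products of non-commuting factors are ordered with indices increasing from left to right (in a double product $\prod_i\prod_\alpha$, first by $i$, then by $\alpha$). For such a series written in normal-ordered form $f=\sum f_{a_1,\dots,a_r;b_1,\dots,b_r}\prod_\alpha\widehat Q_{\alpha,0}^{a_\alpha}\prod_\beta\widehat Q_{\beta,1}^{b_\beta}$: the evaluation $f|_{\widehat{\mathbf Q}_0=1}$ is $\sum f_{a;b}\prod_\beta\widehat Q_{\beta,1}^{b_\beta}$; the constant term $\mathrm{CT}_{\widehat{\mathbf Q}_1}$ keeps only the terms with all $b_\beta=0$;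 and $$\rho(f)=\Big(\prod_{\beta=1}^r\widehat Q_{\beta,1}\widehat Q_{\beta,0}^{-1}\cdot f\Big)\Big|_{\widehat{\mathbf Q}_0=1}.$$ *)

theory Defs
  imports
    "HOL-Analysis.Determinants"
    "HOL-Algebra.Ring"
    "HOL-Library.Poly_Mapping"
    "HOL-Computational_Algebra.Formal_Power_Series"
begin

text \<open>
  A Lie algebra enters only through its Cartan matrix.  The Cartan matrices of the simple Lie
  algebras of rank \<open>r\<close> are the indecomposable Cartan matrices of finite type of size \<open>r\<close>.  The index
  set \<open>{1, \<dots>, r}\<close> is rendered by a finite linearly ordered type \<open>'r\<close>; the order is needed because
  products of non-commuting factors are ordered.
\<close>

type_synonym 'r ivector = "(int, 'r) vec"
type_synonym 'r imatrix = "('r ivector, 'r) vec"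

definition finite_type_cartan_matrix :: "('r::finite) imatrix \<Rightarrow> bool" where
  "finite_type_cartan_matrix C \<longleftrightarrow>
     (\<forall>\<alpha>. C $ \<alpha> $ \<alpha> = 2) \<and>
     (\<forall>\<alpha> \<beta>. \<alpha> \<noteq> \<beta> \<longrightarrow> C $ \<alpha> $ \<beta> \<le> 0) \<and>
     (\<forall>\<alpha> \<beta>. C $ \<alpha> $ \<beta> = 0 \<longrightarrow> C $ \<beta> $ \<alpha> = 0) \<and>
     (\<exists>d :: 'r \<Rightarrow> rat.
        (\<forall>\<alpha>. 0 < d \<alpha>) \<and>
        (\<forall>\<alpha> \<beta>. d \<alpha> * of_int (C $ \<alpha> $ \<beta>) = d \<beta> * of_int (C $ \<beta> $ \<alpha>)) \<and>
        (\<forall>v :: 'r \<Rightarrow> rat. (\<exists>\<alpha>. v \<alpha> \<noteq> 0) \<longrightarrow>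
           0 < (\<Sum>\<alpha>\<in>UNIV. \<Sum>\<beta>\<in>UNIV. v \<alpha> * (d \<alpha> * of_int (C $ \<alpha> $ \<beta>)) * v \<beta>)))"

definition indecomposable_matrix :: "('r::finite) imatrix \<Rightarrow> bool" where
  "indecomposable_matrix C \<longleftrightarrow>
     (\<forall>S. S \<noteq> {} \<and> S \<noteq> UNIV \<longrightarrow> (\<exists>\<alpha>\<in>S. \<exists>\<beta>\<in>- S. C $ \<alpha> $ \<beta> \<noteq> 0))"

definition simply_laced_matrix :: "('r::finite) imatrix \<Rightarrow> bool" where
  "simply_laced_matrix C \<longleftrightarrow> (\<forall>\<alpha> \<beta>. \<alpha> \<noteq> \<beta> \<longrightarrow> C $ \<alpha> $ \<beta> \<in> {0, -1})"

definition simple_simply_laced_cartan_matrix :: "('r::finite) imatrix \<Rightarrow> bool" where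
  "simple_simply_laced_cartan_matrix C \<longleftrightarrow>
     finite_type_cartan_matrix C \<and> indecomposable_matrix C \<and> simply_laced_matrix C"

definition lam :: "('r::finite) imatrix \<Rightarrow> rat^'r^'r" where
  "lam C = (\<chi> \<alpha> \<beta>. of_int (det C) * matrix_inv (\<chi> \<gamma> \<epsilon>. of_int (C $ \<gamma> $ \<epsilon>)) $ \<alpha> $ \<beta>)"

text \<open>
  The group ring of the rational numbers over the integers: Laurent polynomials in \<open>t\<close> with
  integer coefficients, where fractional exponents of \<open>t\<close> are allowed.
\<close>

type_synonym scalar = "rat \<Rightarrow>\<^sub>0 int"

definition tpow :: "rat \<Rightarrow> scalar" where
  "tpow e = Poly_Mapping.single e 1"

text \<open>Powers of \<open>q = t\<close> to the power \<open>- det C\<close>.\<close>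

definition qpow :: "('r::finite) imatrix \<Rightarrow> rat \<Rightarrow> scalar" where
  "qpow C e = tpow (- of_int (det C) * e)"

text \<open>
  The case \<open>b < 0\<close> does not occur in \<open>MK\<close> below, where \<open>b\<close> is restricted to be nonnegative.  The right
  inverse is the geometric series, the scalars having no \<open>inverse\<close> operation.
\<close>

definition qbinom :: "('r::finite) imatrix \<Rightarrow> nat \<Rightarrow> int \<Rightarrow> scalar" where
  "qbinom C a b = fps_nth
     (if 0 \<le> b
      then \<Prod>i\<in>{0..b}. fps_right_inverse (1 - fps_const (qpow C (of_int i)) * fps_X) 1
      else \<Prod>i\<in>{0..- b - 1}. (1 - fps_const (qpow C (of_int (i + b + 1))) * fps_X)) a"

text \<open>
  Vectors indexed by \<open>(\<alpha>, i)\<close> with \<open>1 \<le> i \<le> K\<close> are functions of which only the values at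
  \<open>i \<in> {1..K}\<close> matter.
\<close>

definition pvec :: "('r::finite) imatrix \<Rightarrow> nat \<Rightarrow> ('r \<Rightarrow> nat \<Rightarrow> nat) \<Rightarrow> ('r \<Rightarrow> nat \<Rightarrow> nat) \<Rightarrow> 'r \<Rightarrow> nat \<Rightarrow> int" where
  "pvec C K m n \<alpha> i =
     (\<Sum>j\<in>{1..K}. int (min i j) * int (n \<alpha> j))
     - (\<Sum>\<beta>\<in>UNIV. \<Sum>j\<in>{1..K}. C $ \<alpha> $ \<beta> * int (min i j) * int (m \<beta> j))"

definition Qform :: "('r::finite) imatrix \<Rightarrow> nat \<Rightarrow> ('r \<Rightarrow> nat \<Rightarrow> nat) \<Rightarrow> ('r \<Rightarrow> nat \<Rightarrow> nat) \<Rightarrow> rat" where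
  "Qform C K m n = - (1 / 2) * of_int
     (\<Sum>\<alpha>\<in>UNIV. \<Sum>i\<in>{1..K}.
        int (m \<alpha> i) * (pvec C K m n \<alpha> i + (\<Sum>j\<in>{1..K}. int (min i j) * int (n \<alpha> j))))"

text \<open>
  Requiring \<open>m\<close> to vanish outside the index range makes each vector occur exactly once.
\<close>

definition Msupp :: "('r::finite) imatrix \<Rightarrow> nat \<Rightarrow> ('r \<Rightarrow> nat) \<Rightarrow> ('r \<Rightarrow> nat \<Rightarrow> nat) \<Rightarrow> ('r \<Rightarrow> nat \<Rightarrow> nat) set" where
  "Msupp C K l n =
     {m. (\<forall>\<alpha> i. i \<notin> {1..K} \<longrightarrow> m \<alpha> i = 0) \<and>
         (\<forall>\<alpha>. int (l \<alpha>) - pvec C K m n \<alpha> K = 0) \<and>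
         (\<forall>\<alpha>. \<forall>i\<in>{1..K}. 0 \<le> pvec C K m n \<alpha> i)}"

definition MK :: "('r::finite) imatrix \<Rightarrow> nat \<Rightarrow> ('r \<Rightarrow> nat) \<Rightarrow> ('r \<Rightarrow> nat \<Rightarrow> nat) \<Rightarrow> scalar" where
  "MK C K l n =
     (\<Sum>m\<in>Msupp C K l n.
        qpow C (Qform C K m n) *
        (\<Prod>\<alpha>\<in>UNIV. \<Prod>i\<in>{1..K}. qbinom C (m \<alpha> i) (pvec C K m n \<alpha> i)))"

definition Mmult :: "('r::finite) imatrix \<Rightarrow> ('r \<Rightarrow> nat) \<Rightarrow> ('r \<Rightarrow> nat \<Rightarrow> nat) \<Rightarrow> scalar" where
  "Mmult C l n = (THE v. \<forall>\<^sub>F K in sequentially. MK C K l n = v)"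

text \<open>
  \<open>f a b\<close> is the coefficient in \<open>f\<close> of the normally ordered monomial with exponent vector \<open>a\<close> for the
  variables \<open>Q\<^sub>\<alpha>\<^sub>,\<^sub>0\<close> and exponent vector \<open>b\<close> for the variables \<open>Q\<^sub>\<alpha>\<^sub>,\<^sub>1\<close>.
\<close>

type_synonym 'r qseries = "'r ivector \<Rightarrow> 'r ivector \<Rightarrow> scalar"

definition qmono :: "scalar \<Rightarrow> 'r ivector \<Rightarrow> 'r ivector \<Rightarrow> 'r qseries" where
  "qmono c a b = (\<lambda>a' b'. if a' = a \<and> b' = b then c else 0)"

text \<open>
  Finite sums of Laurent monomials times formal power series in the \<open>x\<^sub>\<beta>\<close>, the coefficients of which are
  Laurent polynomials in the \<open>Q\<^sub>\<alpha>\<^sub>,\<^sub>0\<close>.  The exponent vector of \<open>\<Prod>\<^sub>\<beta> x\<^sub>\<beta>\<^bsup>c \<beta>\<^esup>\<close> is \<open>- C c\<close>.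
\<close>

definition qcarrier :: "('r::finite) imatrix \<Rightarrow> 'r qseries set" where
  "qcarrier C =
     {f. (\<forall>b. finite {a. f a b \<noteq> 0}) \<and>
         (\<exists>D. finite D \<and>
            (\<forall>a b. f a b \<noteq> 0 \<longrightarrow> (\<exists>d\<in>D. \<exists>c. (\<forall>\<beta>. 0 \<le> c $ \<beta>) \<and> b = d - C *v c)))}"

text \<open>
  The exponent of \<open>t\<close> arises from moving the \<open>Q\<^sub>\<alpha>\<^sub>,\<^sub>1\<close> of the left factor past the \<open>Q\<^sub>\<beta>\<^sub>,\<^sub>0\<close> of the right
  factor; each such exchange contributes \<open>- \<lambda>\<^sub>\<alpha>\<^sub>,\<^sub>\<beta>\<close>.
\<close>

definition twist :: "('r::finite) imatrix \<Rightarrow> 'r ivector \<Rightarrow> 'r ivector \<Rightarrow> rat" where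
  "twist C b a = - (\<Sum>\<alpha>\<in>UNIV. \<Sum>\<beta>\<in>UNIV. of_int (b $ \<alpha>) * lam C $ \<alpha> $ \<beta> * of_int (a $ \<beta>))"

definition qmult :: "('r::finite) imatrix \<Rightarrow> 'r qseries \<Rightarrow> 'r qseries \<Rightarrow> 'r qseries" where
  "qmult C f g = (\<lambda>a b.
     \<Sum>(a', b')\<in>{(a', b'). f a' b' \<noteq> 0 \<and> g (a - a') (b - b') \<noteq> 0}.
       f a' b' * g (a - a') (b - b') * tpow (twist C b' (a - a')))"

definition qring :: "('r::finite) imatrix \<Rightarrow> 'r qseries ring" where
  "qring C =
     \<lparr>carrier = qcarrier C, monoid.mult = qmult C, one = qmono 1 0 0,
      zero = (\<lambda>a b. 0), add = (\<lambda>f g a b. f a b + g a b)\<rparr>"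

lemma qmult_qmono:
  "qmult C (qmono c a b) (qmono c' a' b') = qmono (c * c' * tpow (twist C b a')) (a + a') (b + b')"
proof (intro ext)
  fix x y
  show "qmult C (qmono c a b) (qmono c' a' b') x y =
        qmono (c * c' * tpow (twist C b a')) (a + a') (b + b') x y"
  proof (cases "x = a + a' \<and> y = b + b' \<and> c \<noteq> 0 \<and> c' \<noteq> 0")
    case True
    then have "{(u, v). qmono c a b u v \<noteq> 0 \<and> qmono c' a' b' (x - u) (y - v) \<noteq> 0} = {(a, b)}"
      by (auto simp: qmono_def split: if_splits)
    with True show ?thesis by (simp add: qmult_def qmono_def)
  next
    case False
    then have "{(u, v). qmono c a b u v \<noteq> 0 \<and> qmono c' a' b' (x - u) (y - v) \<noteq> 0} = {}"
      by (auto simp: qmono_def algebra_simps split: if_splits)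
    moreover from False have "qmono (c * c' * tpow (twist C b a')) (a + a') (b + b') x y = 0"
      by (auto simp: qmono_def)
    ultimately show ?thesis by (simp only: qmult_def sum.empty)
  qed
qed

definition oprod :: "('b, 'm) monoid_scheme \<Rightarrow> ('i::linorder \<Rightarrow> 'b) \<Rightarrow> 'i set \<Rightarrow> 'b" where
  "oprod R f S = foldr (\<lambda>i x. f i \<otimes>\<^bsub>R\<^esub> x) (sorted_list_of_set S) \<one>\<^bsub>R\<^esub>"

text \<open>
  Limits for the topology of formal series: the coefficient of each monomial in the \<open>Q\<^sub>\<alpha>\<^sub>,\<^sub>1\<close>, a Laurent
  polynomial in the \<open>Q\<^sub>\<alpha>\<^sub>,\<^sub>0\<close>, is eventually constant.
\<close>

definition has_qlim :: "('r::finite) imatrix \<Rightarrow> (nat \<Rightarrow> 'r qseries) \<Rightarrow> 'r qseries \<Rightarrow> bool" where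
  "has_qlim C F f \<longleftrightarrow>
     f \<in> carrier (qring C) \<and> (\<forall>b. \<forall>\<^sub>F k in sequentially. \<forall>a. F k a b = f a b)"

definition has_qprod :: "('r::finite) imatrix \<Rightarrow> (nat \<Rightarrow> 'r qseries) \<Rightarrow> 'r qseries \<Rightarrow> bool" where
  "has_qprod C F P \<longleftrightarrow> has_qlim C (\<lambda>N. oprod (qring C) F {1..N}) P"

definition Qgen0 :: "'r::finite \<Rightarrow> 'r qseries" where
  "Qgen0 \<alpha> = qmono 1 (axis \<alpha> 1) 0"

definition Qgen1 :: "'r::finite \<Rightarrow> 'r qseries" where
  "Qgen1 \<alpha> = qmono 1 0 (axis \<alpha> 1)"

lemma Qgen_commute:
  fixes C :: "('r::finite) imatrix"
  shows "qmult C (Qgen1 \<alpha>) (Qgen0 \<beta>) =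
     qmult C (qmono (tpow (- lam C $ \<alpha> $ \<beta>)) 0 0) (qmult C (Qgen0 \<beta>) (Qgen1 \<alpha>))"
proof -
  have ax: "(of_int (axis \<gamma> 1 $ \<delta> :: int) :: rat) = (if \<delta> = \<gamma> then 1 else 0)" for \<gamma> \<delta> :: 'r
    by (simp add: axis_def)
  have "(\<Sum>\<gamma>\<in>UNIV. \<Sum>\<delta>\<in>UNIV. of_int (axis \<alpha> 1 $ \<gamma> :: int) * lam C $ \<gamma> $ \<delta> * of_int (axis \<beta> 1 $ \<delta> :: int))
        = lam C $ \<alpha> $ \<beta>"
    by (simp add: ax if_distrib[where f = "\<lambda>x. x * _"] if_distrib[where f = "\<lambda>x. _ * x"] cong: if_cong)
  then have "twist C (axis \<alpha> 1) (axis \<beta> 1) = - lam C $ \<alpha> $ \<beta>"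
    by (simp add: twist_def)
  moreover have "twist C 0 a = 0" "twist C b 0 = 0" for a b
    by (simp_all add: twist_def)
  moreover have "tpow 0 = 1"
    by (simp add: tpow_def)
  ultimately show ?thesis
    by (simp add: Qgen0_def Qgen1_def qmult_qmono)
qed

text \<open>The right-hand side of the quantum Q-system relation, for \<open>Q\<close> the family of the \<open>Q\<^sub>\<alpha>\<^sub>,\<^sub>n\<close> with fixed \<open>n\<close>.\<close>

definition Qrhs :: "('r::{finite,linorder}) imatrix \<Rightarrow> ('r \<Rightarrow> 'r qseries) \<Rightarrow> 'r \<Rightarrow> 'r qseries" where
  "Qrhs C Q \<alpha> =
     Q \<alpha> [^]\<^bsub>qring C\<^esub> (2::nat)
     \<ominus>\<^bsub>qring C\<^esub> oprod (qring C) (\<lambda>\<beta>. Q \<beta> [^]\<^bsub>qring C\<^esub> (- C $ \<alpha> $ \<beta>)) (UNIV - {\<alpha>})"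

text \<open>
  \<open>Qup C n \<alpha>\<close> is \<open>Q\<^sub>\<alpha>\<^sub>,\<^sub>n\<close>, by solving the relation for the term with the larger index;
  \<open>Qdown C n \<alpha>\<close> is \<open>Q\<^sub>\<alpha>\<^sub>,\<^sub>1\<^sub>-\<^sub>n\<close>, by solving it for the term with the smaller index.
\<close>

fun Qup :: "('r::{finite,linorder}) imatrix \<Rightarrow> nat \<Rightarrow> 'r \<Rightarrow> 'r qseries" where
  "Qup C 0 = Qgen0"
| "Qup C (Suc 0) = Qgen1"
| "Qup C (Suc (Suc n)) = (\<lambda>\<alpha>. THE X. X \<in> carrier (qring C) \<and>
     qmono (tpow (lam C $ \<alpha> $ \<alpha>)) 0 0 \<otimes>\<^bsub>qring C\<^esub> (X \<otimes>\<^bsub>qring C\<^esub> Qup C n \<alpha>) = Qrhs C (Qup C (Suc n)) \<alpha>)"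

fun Qdown :: "('r::{finite,linorder}) imatrix \<Rightarrow> nat \<Rightarrow> 'r \<Rightarrow> 'r qseries" where
  "Qdown C 0 = Qgen1"
| "Qdown C (Suc 0) = Qgen0"
| "Qdown C (Suc (Suc n)) = (\<lambda>\<alpha>. THE X. X \<in> carrier (qring C) \<and>
     qmono (tpow (lam C $ \<alpha> $ \<alpha>)) 0 0 \<otimes>\<^bsub>qring C\<^esub> (Qdown C n \<alpha> \<otimes>\<^bsub>qring C\<^esub> X) = Qrhs C (Qdown C (Suc n)) \<alpha>)"

definition Qhat :: "('r::{finite,linorder}) imatrix \<Rightarrow> 'r \<Rightarrow> int \<Rightarrow> 'r qseries" where
  "Qhat C \<alpha> n = (if 0 \<le> n then Qup C (nat n) \<alpha> else Qdown C (nat (1 - n)) \<alpha>)"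

definition zratio :: "('r::{finite,linorder}) imatrix \<Rightarrow> 'r \<Rightarrow> nat \<Rightarrow> 'r qseries" where
  "zratio C \<beta> k = Qhat C \<beta> (int k) \<otimes>\<^bsub>qring C\<^esub> inv\<^bsub>qring C\<^esub> (Qhat C \<beta> (int k + 1))"

definition zser :: "('r::{finite,linorder}) imatrix \<Rightarrow> 'r \<Rightarrow> 'r qseries" where
  "zser C \<beta> = (THE f. has_qlim C (zratio C \<beta>) f)"

definition zfactor :: "('r::{finite,linorder}) imatrix \<Rightarrow> 'r \<Rightarrow> nat \<Rightarrow> 'r qseries" where
  "zfactor C \<beta> k = inv\<^bsub>qring C\<^esub> (\<one>\<^bsub>qring C\<^esub> \<ominus>\<^bsub>qring C\<^esub>
     oprod (qring C) (\<lambda>\<alpha>. Qhat C \<alpha> (int k) [^]\<^bsub>qring C\<^esub> (- C $ \<alpha> $ \<beta>)) UNIV)"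

definition eval0 :: "'r qseries \<Rightarrow> ('r ivector \<Rightarrow> scalar)" where
  "eval0 f = (\<lambda>b. \<Sum>a\<in>{a. f a b \<noteq> 0}. f a b)"

definition CT :: "(('r::finite) ivector \<Rightarrow> scalar) \<Rightarrow> scalar" where
  "CT g = g 0"

definition rho :: "('r::{finite,linorder}) imatrix \<Rightarrow> 'r qseries \<Rightarrow> ('r ivector \<Rightarrow> scalar)" where
  "rho C f = eval0
     (oprod (qring C) (\<lambda>\<beta>. Qhat C \<beta> 1 \<otimes>\<^bsub>qring C\<^esub> inv\<^bsub>qring C\<^esub> (Qhat C \<beta> 0)) UNIV \<otimes>\<^bsub>qring C\<^esub> f)"

end

theory Submission
  imports Defs
begin

text \<open>
  Write \<open>Q\<^sub>n\<^bsup>a\<^esup>\<close> for the product of the \<open>Q\<^sub>\<alpha>\<^sub>,\<^sub>n\<close> to the powers \<open>a\<^sub>\<alpha>\<close>.  The relation of the Q-system reads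
  \<open>Q\<^sub>\<alpha>\<^sub>,\<^sub>n\<^sub>+\<^sub>2 = (1 - X) u\<close>, where \<open>X\<close> and \<open>u\<close> are Laurent monomials in the \<open>Q\<^sub>n\<close> and \<open>Q\<^sub>n\<^sub>+\<^sub>1\<close> with \<open>u X = q\<^sup>-\<^sup>1 X u\<close>.
  By the q-binomial theorem, a negative power of \<open>Q\<^sub>n\<^sub>+\<^sub>2\<close> is therefore a series of monomials of the two
  preceding levels whose coefficients are q-binomial coefficients.  Applied repeatedly to
  \<open>CT \<rho> (Q\<^sub>1\<^bsup>n\<^sub>1\<^esup> \<dots> Q\<^sub>K\<^bsup>n\<^sub>K\<^esup> (Q\<^sub>K Q\<^sub>K\<^sub>+\<^sub>1\<^sup>-\<^sup>1)\<^bsup>l+1\<^esup>)\<close>, this produces the sum over \<open>m\<close> that defines the multiplicity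
  at level \<open>K\<close>, the exponents of \<open>Q\<^sub>i\<close> and \<open>Q\<^sub>i\<^sub>+\<^sub>1\<close> reached on the way being \<open>p\<^sub>i\<^sub>+\<^sub>1 + 1\<close> and \<open>- (p\<^sub>i + 1)\<close>.

  The terms with some \<open>p\<^sub>\<alpha>\<^sub>,\<^sub>i < 0\<close> contribute nothing: there \<open>Q\<^sub>\<alpha>\<^sub>,\<^sub>i\<^sub>+\<^sub>1\<close> occurs to a nonnegative power only, and
  right multiplication by every \<open>Q\<^sub>\<alpha>\<^sub>,\<^sub>n\<close>, and by every \<open>Q\<^sub>\<beta>\<^sub>,\<^sub>n\<^sup>\<plusminus>\<^sup>1\<close> with \<open>\<beta> \<noteq> \<alpha>\<close>, preserves the series which after
  evaluation at \<open>Q\<^sub>0 = 1\<close> have positive exponents of \<open>Q\<^sub>\<alpha>\<^sub>,\<^sub>1\<close> only.  The prefactor in \<open>\<rho>\<close> is such a series, so that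
  the constant term is 0.  That \<open>Q\<^sub>\<alpha>\<^sub>,\<^sub>n\<close> has this property is the polynomiality of the solutions of the
  Q-system under \<open>Q\<^sub>0 = 1\<close>; it follows by induction, since \<open>Q\<^sub>\<alpha>\<^sub>,\<^sub>n\<^sub>+\<^sub>3\<close> can be written without the inverse of
  \<open>Q\<^sub>\<alpha>\<^sub>,\<^sub>n\<^sub>+\<^sub>1\<close> as soon as the variables with \<open>\<beta> \<noteq> \<alpha>\<close> may be inverted.
\<close>

subsection \<open>Twisted series\<close>

text \<open>Evaluation at level 0 is not multiplicative, so polynomiality cannot be obtained by
  substituting into the relation. What survives is one-sided: in normal order level 0 stands on the
  left, and the evaluation of \<open>f * g\<close> depends on \<open>f\<close> only through the
  evaluation of \<open>f\<close>. Hence positivity is stated as stability under right multiplication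
  (\<open>keeps\<close>), and divisions are carried out from the right. The vanishing argument is
  applied before each expansion, because the series of the q-binomial theorem represents negative
  powers only. The shift by one in the exponents comes from the prefactor of \<open>rho\<close>,
  which contributes exponent 1 of each level 1 variable: the descent ends in a nonzero constant term
  exactly if all exponents left at level 1 are -1. The same shift makes \<open>p + 1\<close> the
  number of factors in the generating function of the q-binomial coefficients. The infinite product
  for \<open>z\<close> enters only as a limit of ratios of consecutive levels. Constant terms become
  stationary along such limits, which proves the independence of \<open>K\<close> together with the
  formula.\<close>

text \<open>
  The ring \<open>qring C\<close> depends on \<open>C\<close>.  In the coordinates \<open>(a', y) = (\<delta> a, - C\<^sup>-\<^sup>1 b)\<close> the twist is the pairing
  \<open>y \<cdot> a'\<close> and the cone spanned by the exponents of the \<open>x\<^sub>\<beta>\<close> is the set of vectors of natural numbers, so all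
  these rings embed into a single type of class \<open>ring_1\<close>.
\<close>

type_synonym 'r expo = "(rat^'r) \<times> (rat^'r)"

definition nvec :: "(rat^'r) set" where
  "nvec = {c. \<forall>\<beta>. c $ \<beta> \<in> \<nat>}"

definition deg :: "rat^('r::finite) \<Rightarrow> rat" where
  "deg y = (\<Sum>\<beta>\<in>UNIV. y $ \<beta>)"

lemma nvec_0 [simp]: "0 \<in> nvec"
  by (simp add: nvec_def)

lemma nvec_add: "x \<in> nvec \<Longrightarrow> y \<in> nvec \<Longrightarrow> x + y \<in> nvec"
  by (simp add: nvec_def)

lemma deg_0 [simp]: "deg 0 = 0"
  and deg_add: "deg (x + y) = deg x + deg y"
  and deg_diff: "deg (x - y) = deg x - deg y"
  by (simp_all add: deg_def sum.distrib sum_subtractf)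

lemma Nats_ge_0: "(x::rat) \<in> \<nat> \<Longrightarrow> 0 \<le> x"
  by (auto simp: Nats_def)

lemma nvec_deg: "c \<in> nvec \<Longrightarrow> 0 \<le> deg c"
  by (auto simp: nvec_def deg_def Nats_ge_0 intro!: sum_nonneg)

lemma finite_bounded_nvec: "finite {c \<in> nvec. \<forall>\<beta>. c $ \<beta> \<le> (w $ \<beta> :: rat)}" (is "finite ?A")
  for w :: "rat^'r::finite"
proof -
  let ?F = "\<Pi>\<^sub>E \<beta>\<in>(UNIV::'r set). of_nat ` {..nat \<lfloor>w $ \<beta>\<rfloor>} :: rat set"
  have "c \<in> vec_lambda ` ?F" if "c \<in> ?A" for c
  proof (rule image_eqI[of _ _ "vec_nth c"])
    show "vec_nth c \<in> ?F"
    proof (intro PiE_I)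
      fix \<beta>
      from that obtain k where k: "c $ \<beta> = of_nat k" "of_nat k \<le> w $ \<beta>"
        by (metis (mono_tags, lifting) Nats_cases mem_Collect_eq nvec_def)
      then have "k \<le> nat \<lfloor>w $ \<beta>\<rfloor>"
        by (simp add: le_floor_iff le_nat_iff)
      with k show "c $ \<beta> \<in> of_nat ` {..nat \<lfloor>w $ \<beta>\<rfloor>}" by auto
    qed auto
  qed simp
  moreover have "finite (vec_lambda ` ?F)"
    by (intro finite_imageI finite_PiE) auto
  ultimately show ?thesis by (meson finite_subset subsetI)
qed

text \<open>The support condition of \<open>qcarrier\<close> in the new coordinates: as
  \<open>y\<close> stands for minus the inverse of \<open>C\<close> applied to \<open>b\<close>, the
  cone \<open>b = d - C *v c\<close> with \<open>c\<close> nonnegative becomes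
  \<open>y - d \<in> nvec\<close>.\<close>

definition tame :: "('r::finite) expo set \<Rightarrow> bool" where
  "tame S \<longleftrightarrow> (\<forall>y. finite {a. (a, y) \<in> S}) \<and>
     (\<exists>D. finite D \<and> (\<forall>a y. (a, y) \<in> S \<longrightarrow> (\<exists>d\<in>D. y - d \<in> nvec)))"

definition supp :: "('r expo \<Rightarrow> scalar) \<Rightarrow> 'r expo set" where
  "supp f = {v. f v \<noteq> 0}"

lemma tame_subset: "tame T \<Longrightarrow> S \<subseteq> T \<Longrightarrow> tame S"
  unfolding tame_def
  by (metis (mono_tags, lifting) Collect_mono finite_subset subsetD)

lemma tame_finite: assumes "finite S" shows "tame S"
proof -
  have "finite {a. (a, y) \<in> S}" for y
    by (rule finite_subset[of _ "fst ` S"]) (use assms in force)+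
  moreover have "\<exists>D. finite D \<and> (\<forall>a y. (a, y) \<in> S \<longrightarrow> (\<exists>d\<in>D. y - d \<in> nvec))"
    by (rule exI[of _ "snd ` S"]) (use assms in force)
  ultimately show ?thesis by (simp add: tame_def)
qed

lemma tame_Un: assumes "tame S" "tame T" shows "tame (S \<union> T)"
proof -
  obtain D E where "finite D" "finite E"
    "\<forall>a y. (a, y) \<in> S \<longrightarrow> (\<exists>d\<in>D. y - d \<in> nvec)" "\<forall>a y. (a, y) \<in> T \<longrightarrow> (\<exists>d\<in>E. y - d \<in> nvec)"
    using assms unfolding tame_def by blast
  then have "finite (D \<union> E) \<and> (\<forall>a y. (a, y) \<in> S \<union> T \<longrightarrow> (\<exists>d\<in>D\<union>E. y - d \<in> nvec))"
    by blast
  with assms show ?thesis unfolding tame_def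
    by (auto simp: Collect_disj_eq)
qed

text \<open>The point \<open>y\<close> is trapped: it lies above some \<open>d\<close> from the
  finite set of \<open>S\<close>, and \<open>z - y\<close> above some \<open>e\<close> from that of
  \<open>T\<close>, so \<open>y - d\<close> is a vector of naturals bounded by
  \<open>z - d - e\<close>.\<close>

lemma tame_snd_finite:
  assumes "tame S" "tame T"
  shows "finite {y. \<exists>a a'. (a, y) \<in> S \<and> (a', z - y) \<in> T}"
proof -
  obtain D E where D: "finite D" "\<forall>a y. (a, y) \<in> S \<longrightarrow> (\<exists>d\<in>D. y - d \<in> nvec)"
    and E: "finite E" "\<forall>a y. (a, y) \<in> T \<longrightarrow> (\<exists>d\<in>E. y - d \<in> nvec)"
    using assms unfolding tame_def by blast
  have "{y. \<exists>a a'. (a, y) \<in> S \<and> (a', z - y) \<in> T} \<subseteq>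
      (\<Union>d\<in>D. \<Union>e\<in>E. (\<lambda>c. d + c) ` {c \<in> nvec. \<forall>\<beta>. c $ \<beta> \<le> (z - d - e) $ \<beta>})"
  proof clarify
    fix y a a' assume "(a, y) \<in> S" "(a', z - y) \<in> T"
    then obtain d e where de: "d \<in> D" "e \<in> E" "y - d \<in> nvec" "z - y - e \<in> nvec"
      using D E by blast
    have "(y - d) $ \<beta> \<le> (z - d - e) $ \<beta>" for \<beta>
      using de(4) Nats_ge_0[of "(z - y - e) $ \<beta>"] by (simp add: nvec_def)
    with de show "y \<in> (\<Union>d\<in>D. \<Union>e\<in>E. (\<lambda>c. d + c) ` {c \<in> nvec. \<forall>\<beta>. c $ \<beta> \<le> (z - d - e) $ \<beta>})"
      by (intro UN_I[of d] UN_I[of e] image_eqI[of _ _ "y - d"]) auto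
  qed
  then show ?thesis
    by (rule finite_subset) (intro finite_UN_I D E finite_imageI finite_bounded_nvec)
qed

lemma tame_conv_finite:
  assumes "tame S" "tame T"
  shows "finite {s \<in> S. z - s \<in> T}"
proof -
  let ?Y = "{y. \<exists>a a'. (a, y) \<in> S \<and> (a', snd z - y) \<in> T}"
  have "{s \<in> S. z - s \<in> T} \<subseteq> (\<Union>y\<in>?Y. (\<lambda>a. (a, y)) ` {a. (a, y) \<in> S})"
  proof clarify
    fix a y assume "(a, y) \<in> S" "z - (a, y) \<in> T"
    then show "(a, y) \<in> (\<Union>y\<in>?Y. (\<lambda>a. (a, y)) ` {a. (a, y) \<in> S})"
      by (cases z) auto
  qed
  moreover have "finite {a. (a, y) \<in> S}" for y
    using assms by (simp add: tame_def)
  then have "finite (\<Union>y\<in>?Y. (\<lambda>a. (a, y)) ` {a. (a, y) \<in> S})"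
    by (intro finite_UN_I tame_snd_finite assms finite_imageI)
  ultimately show ?thesis by (rule finite_subset)
qed

lemma tame_sum:
  assumes "tame S" "tame T"
  shows "tame {s + t | s t. s \<in> S \<and> t \<in> T}"
proof -
  obtain D E where D: "finite D" "\<forall>a y. (a, y) \<in> S \<longrightarrow> (\<exists>d\<in>D. y - d \<in> nvec)"
    and E: "finite E" "\<forall>a y. (a, y) \<in> T \<longrightarrow> (\<exists>d\<in>E. y - d \<in> nvec)"
    using assms unfolding tame_def by blast
  have "\<exists>d\<in>(\<lambda>(d, e). d + e) ` (D \<times> E). y - d \<in> nvec"
    if st: "s \<in> S" "t \<in> T" "(a, y) = s + t" for s t a y
  proof -
    obtain d e where de: "d \<in> D" "e \<in> E" "snd s - d \<in> nvec" "snd t - e \<in> nvec"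
      using D E st by (metis prod.collapse)
    have "y - (d + e) = (snd s - d) + (snd t - e)"
      using st by (metis add_diff_add snd_add snd_conv)
    with de have "y - (d + e) \<in> nvec" by (simp only: nvec_add)
    then show ?thesis by (rule bexI) (use de in force)
  qed
  moreover have "finite {a. \<exists>s t. (a, y) = s + t \<and> s \<in> S \<and> t \<in> T}" for y
  proof -
    let ?Y = "{u. \<exists>a a'. (a, u) \<in> S \<and> (a', y - u) \<in> T}"
    have "{a. \<exists>s t. (a, y) = s + t \<and> s \<in> S \<and> t \<in> T} \<subseteq>
      (\<Union>u\<in>?Y. (\<lambda>(a, b). a + b) ` ({a. (a, u) \<in> S} \<times> {a. (a, y - u) \<in> T}))"
    proof clarify
      fix a a1 y1 a2 y2
      assume "(a, y) = (a1, y1) + (a2, y2)" "(a1, y1) \<in> S" "(a2, y2) \<in> T"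
      then show "a \<in> (\<Union>u\<in>?Y. (\<lambda>(a, b). a + b) ` ({a. (a, u) \<in> S} \<times> {a. (a, y - u) \<in> T}))"
        by (intro UN_I[of y1]) (auto intro!: image_eqI[of _ _ "(a1, a2)"])
    qed
    moreover have "finite {a. (a, u) \<in> S}" "finite {a. (a, u) \<in> T}" for u
      using assms by (simp_all add: tame_def)
    then have "finite (\<Union>u\<in>?Y. (\<lambda>(a, b). a + b) ` ({a. (a, u) \<in> S} \<times> {a. (a, y - u) \<in> T}))"
      by (intro finite_UN_I tame_snd_finite assms finite_imageI finite_cartesian_product)
    ultimately show ?thesis by (rule finite_subset)
  qed
  moreover have "finite ((\<lambda>(d, e). d + e) ` (D \<times> E))"
    using D E by simp
  ultimately show ?thesis
    unfolding tame_def by (intro conjI allI exI[of _ "(\<lambda>(d, e). d + e) ` (D \<times> E)"]) auto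
qed

section \<open>Twisted convolution and the ring of twisted series\<close>

definition tw :: "('r::finite) expo \<Rightarrow> 'r expo \<Rightarrow> rat" where
  "tw s t = (\<Sum>\<beta>\<in>UNIV. snd s $ \<beta> * fst t $ \<beta>)"

lemma tw_diff: "tw (s - s') t = tw s t - tw s' t" "tw s (t - t') = tw s t - tw s t'"
  and tw_minus: "tw (- s) t = - tw s t" "tw s (- t) = - tw s t"
  and tw_0 [simp]: "tw 0 t = 0" "tw s 0 = 0"
  by (simp_all add: tw_def algebra_simps sum.distrib sum_subtractf sum_negf)

lemma tpow_add: "tpow (e + f) = tpow e * tpow f"
  by (simp add: tpow_def mult_single)

lemma tpow_0 [simp]: "tpow 0 = 1"
  by (simp add: tpow_def)

lemma tpow_mult: "tpow e * tpow f = tpow (e + f)"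
  by (simp add: tpow_add)

typedef ('r::finite) qtorus = "{f :: 'r expo \<Rightarrow> scalar. tame (supp f)}" morphisms cf Hs
  by (rule exI[of _ "\<lambda>_. 0"]) (simp add: supp_def tame_finite)

lemma tame_cf: "tame (supp (cf f))"
  using cf[of f] by simp

lemma qtorus_eqI: "(\<And>v. cf f v = cf g v) \<Longrightarrow> f = g"
  by (metis cf_inject ext)

lemma cf_Hs: "tame (supp f) \<Longrightarrow> cf (Hs f) = f"
  by (simp add: Hs_inverse)

instantiation qtorus :: (finite) ab_group_add
begin

definition "0 = Hs (\<lambda>_. 0)"
definition "f + g = Hs (\<lambda>v. cf f v + cf g v)"
definition "f - g = Hs (\<lambda>v. cf f v - cf g v)"
definition "- f = Hs (\<lambda>v. - cf f v)"

lemma cf_0 [simp]: "cf 0 v = 0"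
  by (simp add: zero_qtorus_def cf_Hs supp_def tame_finite)

lemma cf_add [simp]: "cf (f + g) v = cf f v + cf g v"
  unfolding plus_qtorus_def
  by (subst cf_Hs) (auto intro!: tame_subset[OF tame_Un[OF tame_cf tame_cf, of f g]] simp: supp_def)

lemma cf_diff [simp]: "cf (f - g) v = cf f v - cf g v"
  unfolding minus_qtorus_def
  by (subst cf_Hs) (auto intro!: tame_subset[OF tame_Un[OF tame_cf tame_cf, of f g]] simp: supp_def)

lemma cf_minus [simp]: "cf (- f) v = - cf f v"
  unfolding uminus_qtorus_def
  by (subst cf_Hs) (auto intro!: tame_subset[OF tame_cf, of _ f] simp: supp_def)

instance
  by standard (auto intro!: qtorus_eqI)

end

definition conv :: "('r::finite expo \<Rightarrow> scalar) \<Rightarrow> ('r expo \<Rightarrow> scalar) \<Rightarrow> 'r expo \<Rightarrow> scalar" where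
  "conv f g z = (\<Sum>s\<in>{s \<in> supp f. z - s \<in> supp g}. f s * g (z - s) * tpow (tw s (z - s)))"

text \<open>Enlarging the index set makes convolutions with different supports comparable, as in the
  distributive laws.\<close>

lemma conv_eval:
  assumes "finite U" "{s \<in> supp f. z - s \<in> supp g} \<subseteq> U"
  shows "conv f g z = (\<Sum>s\<in>U. f s * g (z - s) * tpow (tw s (z - s)))"
  unfolding conv_def
  by (rule sum.mono_neutral_left) (use assms in \<open>auto simp: supp_def\<close>)

lemma supp_conv: "supp (conv f g) \<subseteq> {s + t | s t. s \<in> supp f \<and> t \<in> supp g}"
proof
  fix z assume z: "z \<in> supp (conv f g)"
  have "{s \<in> supp f. z - s \<in> supp g} \<noteq> {}"
  proof
    assume "{s \<in> supp f. z - s \<in> supp g} = {}"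
    then have "conv f g z = 0"
      unfolding conv_def by (simp only: sum.empty)
    with z show False by (simp add: supp_def)
  qed
  then show "z \<in> {s + t | s t. s \<in> supp f \<and> t \<in> supp g}"
    by (smt (verit, ccfv_threshold) Collect_empty_eq add_diff_cancel_left' diff_add_cancel mem_Collect_eq add.commute)
qed

text \<open>Both bracketings are the sum of \<open>F\<close> over the finite set \<open>A\<close> of
  splittings \<open>z = s + t + u\<close>. As \<open>tw\<close> is bilinear, each of them collects
  the exponent \<open>tw s t + tw s u + tw t u\<close>.\<close>

lemma conv_assoc:
  assumes "tame (supp f)" "tame (supp g)" "tame (supp h)"
  shows "conv (conv f g) h z = conv f (conv g h) z"
proof -
  define A where "A = {(s, t). s \<in> supp f \<and> t \<in> supp g \<and> z - s - t \<in> supp h}"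
  define F where "F = (\<lambda>(s, t). f s * g t * h (z - s - t) * tpow (tw s t + tw s (z - s - t) + tw t (z - s - t)))"
  have A: "finite A"
  proof -
    have "A \<subseteq> (SIGMA s:{s \<in> supp f. z - s \<in> {t + u | t u. t \<in> supp g \<and> u \<in> supp h}}. {t \<in> supp g. z - s - t \<in> supp h})"
    proof
      fix x assume "x \<in> A"
      then obtain s t where x: "x = (s, t)" "s \<in> supp f" "t \<in> supp g" "z - s - t \<in> supp h"
        by (cases x) (simp add: A_def)
      have "z - s = t + (z - s - t)" by simp
      with x show "x \<in> (SIGMA s:{s \<in> supp f. z - s \<in> {t + u | t u. t \<in> supp g \<and> u \<in> supp h}}. {t \<in> supp g. z - s - t \<in> supp h})"
        by blast
    qed
    moreover have "finite \<dots>"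
      by (intro finite_SigmaI tame_conv_finite tame_sum assms)
    ultimately show ?thesis by (rule finite_subset)
  qed
  have "conv (conv f g) h z = sum F A"
  proof -
    have "conv (conv f g) h z =
        (\<Sum>w\<in>(\<lambda>(s, t). s + t) ` A. conv f g w * h (z - w) * tpow (tw w (z - w)))"
    proof (rule conv_eval)
      show "{s \<in> supp (conv f g). z - s \<in> supp h} \<subseteq> (\<lambda>(s, t). s + t) ` A"
      proof
        fix w assume "w \<in> {s \<in> supp (conv f g). z - s \<in> supp h}"
        then obtain s t where st: "w = s + t" "s \<in> supp f" "t \<in> supp g" "z - w \<in> supp h"
          using supp_conv[of f g] by blast
        then have "z - s - t \<in> supp h" by (simp only: diff_diff_eq)
        with st have "(s, t) \<in> A" by (simp add: A_def)
        then show "w \<in> (\<lambda>(s, t). s + t) ` A" using st by force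
      qed
    qed (use A in simp)
    also have "\<dots> = (\<Sum>w\<in>(\<lambda>(s, t). s + t) ` A. sum F {x \<in> A. (\<lambda>(s, t). s + t) x = w})"
    proof (rule sum.cong[OF refl])
      fix w assume "w \<in> (\<lambda>(s, t). s + t) ` A"
      then obtain x where "w = fst x + snd x" "x \<in> A" by (metis (mono_tags, lifting) case_prod_beta imageE)
      then have zw: "z - w \<in> supp h"
        by (simp only: A_def case_prod_beta mem_Collect_eq diff_diff_eq simp_thms)
      have "{x \<in> A. (\<lambda>(s, t). s + t) x = w} = (\<lambda>s. (s, w - s)) ` {s \<in> supp f. w - s \<in> supp g}" (is "?L = ?R")
      proof (intro equalityI subsetI)
        fix x assume "x \<in> ?L"
        then obtain s t where "x = (s, t)" "s \<in> supp f" "t \<in> supp g" "s + t = w"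
          by (cases x) (simp add: A_def)
        moreover from this have "t = w - s" by (metis add_diff_cancel_left')
        ultimately show "x \<in> ?R" by simp
      next
        fix x assume "x \<in> ?R"
        then obtain s where x: "x = (s, w - s)" "s \<in> supp f" "w - s \<in> supp g" by blast
        moreover have "z - s - (w - s) = z - w" "s + (w - s) = w" by simp_all
        ultimately show "x \<in> ?L" using zw unfolding A_def by (simp only: mem_Collect_eq prod.case simp_thms)
      qed
      then have "sum F {x \<in> A. (\<lambda>(s, t). s + t) x = w} = sum F ((\<lambda>s. (s, w - s)) ` {s \<in> supp f. w - s \<in> supp g})"
        by (simp only:)
      also have "\<dots> = (\<Sum>s\<in>{s \<in> supp f. w - s \<in> supp g}. F (s, w - s))"
        by (subst sum.reindex) (auto simp: inj_on_def)
      also have "\<dots> = conv f g w * h (z - w) * tpow (tw w (z - w))"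
        unfolding conv_def sum_distrib_right F_def
      proof (rule sum.cong[OF refl])
        fix s
        have "z - s - (w - s) = z - w" by simp
        moreover have "tpow (tw s (w - s) + tw s (z - w) + tw (w - s) (z - w)) = tpow (tw s (w - s)) * tpow (tw w (z - w))"
          unfolding tpow_mult by (rule arg_cong[of _ _ tpow]) (simp add: tw_diff)
        ultimately show "(case (s, w - s) of (s, t) \<Rightarrow> f s * g t * h (z - s - t) * tpow (tw s t + tw s (z - s - t) + tw t (z - s - t)))
          = f s * g (w - s) * tpow (tw s (w - s)) * h (z - w) * tpow (tw w (z - w))"
          by (simp only: prod.case mult_ac)
      qed
      finally show "conv f g w * h (z - w) * tpow (tw w (z - w)) = sum F {x \<in> A. (\<lambda>(s, t). s + t) x = w}" ..
    qed
    also have "\<dots> = sum F A"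
      by (rule sum.group) (use A in auto)
    finally show ?thesis .
  qed
  moreover have "conv f (conv g h) z = sum F A"
  proof -
    have "conv f (conv g h) z = (\<Sum>s\<in>fst ` A. f s * conv g h (z - s) * tpow (tw s (z - s)))"
    proof (rule conv_eval)
      show "{s \<in> supp f. z - s \<in> supp (conv g h)} \<subseteq> fst ` A"
      proof clarify
        fix s1 s2 assume s: "(s1, s2) \<in> supp f" "z - (s1, s2) \<in> supp (conv g h)"
        then obtain t u where tu: "t \<in> supp g" "u \<in> supp h" "z - (s1, s2) = t + u"
          using supp_conv[of g h] by blast
        then have "z - (s1, s2) - t \<in> supp h" by simp
        with s tu have "((s1, s2), t) \<in> A" by (simp add: A_def)
        then show "(s1, s2) \<in> fst ` A" by force
      qed
    qed (use A in simp)
    also have "\<dots> = (\<Sum>s\<in>fst ` A. sum F {x \<in> A. fst x = s})"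
    proof (rule sum.cong[OF refl])
      fix s assume "s \<in> fst ` A"
      then have s: "s \<in> supp f" by (auto simp: A_def)
      have "{x \<in> A. fst x = s} = Pair s ` {t \<in> supp g. z - s - t \<in> supp h}" (is "?L = ?R")
      proof (intro equalityI subsetI)
        fix x assume "x \<in> ?L"
        then show "x \<in> ?R" by (cases x) (simp add: A_def)
      next
        fix x assume "x \<in> ?R"
        then show "x \<in> ?L" using s unfolding A_def by force
      qed
      then have "sum F {x \<in> A. fst x = s} = sum F (Pair s ` {t \<in> supp g. z - s - t \<in> supp h})"
        by (simp only:)
      also have "\<dots> = (\<Sum>t\<in>{t \<in> supp g. z - s - t \<in> supp h}. F (s, t))"
        by (subst sum.reindex) (auto simp: inj_on_def)
      also have "\<dots> = f s * conv g h (z - s) * tpow (tw s (z - s))"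
        unfolding conv_def sum_distrib_right sum_distrib_left F_def
      proof (rule sum.cong[OF refl])
        fix t
        have "tpow (tw s t + tw s (z - s - t) + tw t (z - s - t)) = tpow (tw t (z - s - t)) * tpow (tw s (z - s))"
          unfolding tpow_mult by (rule arg_cong[of _ _ tpow]) (simp add: tw_diff)
        then show "(case (s, t) of (s, t) \<Rightarrow> f s * g t * h (z - s - t) * tpow (tw s t + tw s (z - s - t) + tw t (z - s - t)))
          = f s * (g t * h (z - s - t) * tpow (tw t (z - s - t))) * tpow (tw s (z - s))"
          by (simp only: prod.case mult_ac)
      qed
      finally show "f s * conv g h (z - s) * tpow (tw s (z - s)) = sum F {x \<in> A. fst x = s}" ..
    qed
    also have "\<dots> = sum F A"
      by (rule sum.group) (use A in auto)
    finally show ?thesis .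
  qed
  ultimately show ?thesis by simp
qed

instantiation qtorus :: (finite) ring_1
begin

definition "1 = Hs (\<lambda>v. if v = 0 then 1 else 0)"
definition "f * g = Hs (conv (cf f) (cf g))"

lemma cf_1: "cf 1 v = (if v = 0 then 1 else 0)"
  unfolding one_qtorus_def by (subst cf_Hs) (auto simp: supp_def tame_finite)

lemma cf_mult: "cf (f * g) = conv (cf f) (cf g)"
  unfolding times_qtorus_def
  by (subst cf_Hs) (auto intro!: tame_subset[OF tame_sum[OF tame_cf tame_cf] supp_conv])

instance
proof
  fix a b c :: "'a qtorus"
  show "a * b * c = a * (b * c)"
    by (rule qtorus_eqI) (simp add: cf_mult conv_assoc tame_cf)
  show "1 * a = a"
  proof (rule qtorus_eqI)
    fix v
    have "conv (cf 1) (cf a) v = (\<Sum>s\<in>{0}. cf 1 s * cf a (v - s) * tpow (tw s (v - s)))"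
      by (rule conv_eval) (auto simp: supp_def cf_1 split: if_splits)
    then show "cf (1 * a) v = cf a v" by (simp add: cf_mult cf_1)
  qed
  show "a * 1 = a"
  proof (rule qtorus_eqI)
    fix v
    have "conv (cf a) (cf 1) v = (\<Sum>s\<in>{v}. cf a s * cf 1 (v - s) * tpow (tw s (v - s)))"
      by (rule conv_eval) (auto simp: supp_def cf_1 split: if_splits)
    then show "cf (a * 1) v = cf a v" by (simp add: cf_mult cf_1)
  qed
  show "(a + b) * c = a * c + b * c"
  proof (rule qtorus_eqI)
    fix v
    let ?U = "{s \<in> supp (cf a). v - s \<in> supp (cf c)} \<union> {s \<in> supp (cf b). v - s \<in> supp (cf c)}"
    have U: "finite ?U" by (simp add: tame_conv_finite tame_cf)
    have "conv (cf (a + b)) (cf c) v = (\<Sum>s\<in>?U. cf (a + b) s * cf c (v - s) * tpow (tw s (v - s)))"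
      "conv (cf a) (cf c) v = (\<Sum>s\<in>?U. cf a s * cf c (v - s) * tpow (tw s (v - s)))"
      "conv (cf b) (cf c) v = (\<Sum>s\<in>?U. cf b s * cf c (v - s) * tpow (tw s (v - s)))"
      by (rule conv_eval[OF U]; auto simp: supp_def)+
    then show "cf ((a + b) * c) v = cf (a * c + b * c) v"
      by (simp add: cf_mult algebra_simps sum.distrib)
  qed
  show "a * (b + c) = a * b + a * c"
  proof (rule qtorus_eqI)
    fix v
    let ?U = "{s \<in> supp (cf a). v - s \<in> supp (cf b)} \<union> {s \<in> supp (cf a). v - s \<in> supp (cf c)}"
    have U: "finite ?U" by (simp add: tame_conv_finite tame_cf)
    have "conv (cf a) (cf (b + c)) v = (\<Sum>s\<in>?U. cf a s * cf (b + c) (v - s) * tpow (tw s (v - s)))"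
      "conv (cf a) (cf b) v = (\<Sum>s\<in>?U. cf a s * cf b (v - s) * tpow (tw s (v - s)))"
      "conv (cf a) (cf c) v = (\<Sum>s\<in>?U. cf a s * cf c (v - s) * tpow (tw s (v - s)))"
      by (rule conv_eval[OF U]; auto simp: supp_def)+
    then show "cf (a * (b + c)) v = cf (a * b + a * c) v"
      by (simp add: cf_mult algebra_simps sum.distrib)
  qed
  show "(0::'a qtorus) \<noteq> 1"
    by (metis cf_0 cf_1 zero_neq_one)
qed

end

definition qmon :: "scalar \<Rightarrow> ('r::finite) expo \<Rightarrow> 'r qtorus" where
  "qmon c v = Hs (\<lambda>w. if w = v then c else 0)"

lemma cf_qmon: "cf (qmon c v) w = (if w = v then c else 0)"
proof -
  have "supp (\<lambda>w. if w = v then c else 0) \<subseteq> {v}" by (auto simp: supp_def)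
  then show ?thesis
    unfolding qmon_def by (subst cf_Hs) (auto intro: tame_finite finite_subset)
qed

lemma cf_qmon_mult: "cf (qmon c v * g) z = c * cf g (z - v) * tpow (tw v (z - v))"
proof -
  have "conv (cf (qmon c v)) (cf g) z = (\<Sum>s\<in>{v}. cf (qmon c v) s * cf g (z - s) * tpow (tw s (z - s)))"
    by (rule conv_eval) (auto simp: supp_def cf_qmon split: if_splits)
  then show ?thesis by (simp add: cf_mult cf_qmon)
qed

lemma cf_mult_qmon: "cf (g * qmon c v) z = cf g (z - v) * c * tpow (tw (z - v) v)"
proof -
  have "conv (cf g) (cf (qmon c v)) z = (\<Sum>s\<in>{z - v}. cf g s * cf (qmon c v) (z - s) * tpow (tw s (z - s)))"
    by (rule conv_eval) (auto simp: supp_def cf_qmon split: if_splits)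
  then show ?thesis by (simp add: cf_mult cf_qmon)
qed

lemma qmon_mult: "qmon c v * qmon c' v' = qmon (c * c' * tpow (tw v v')) (v + v')"
proof (rule qtorus_eqI)
  fix z
  show "cf (qmon c v * qmon c' v') z = cf (qmon (c * c' * tpow (tw v v')) (v + v')) z"
    by (auto simp: cf_qmon_mult cf_qmon)
qed

lemma qmon_1: "qmon 1 0 = 1"
  by (rule qtorus_eqI) (simp add: cf_qmon cf_1)

definition sc :: "scalar \<Rightarrow> ('r::finite) qtorus" where "sc c = qmon c 0"

lemma cf_sc: "cf (sc c) v = (if v = 0 then c else 0)"
  by (simp add: sc_def cf_qmon)

lemma cf_sc_mult: "cf (sc c * f) v = c * cf f v" "cf (f * sc c) v = c * cf f v"
  by (simp_all add: sc_def cf_qmon_mult cf_mult_qmon mult.commute)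

lemma sc_central: "f * sc c = sc c * f"
  by (rule qtorus_eqI) (simp add: cf_sc_mult)

lemma sc_1 [simp]: "sc 1 = 1"
  and sc_0 [simp]: "sc 0 = 0"
  and sc_mult: "sc (c * d) = sc c * sc d"
  and sc_diff: "sc (c - d) = sc c - sc d"
  by (auto intro!: qtorus_eqI simp: cf_sc_mult cf_sc cf_1)

definition tm :: "rat \<Rightarrow> ('r::finite) qtorus \<Rightarrow> 'r qtorus" (infixr "\<triangleright>" 69) where
  "e \<triangleright> x = sc (tpow e) * x"

lemma cf_tm [simp]: "cf (e \<triangleright> x) v = tpow e * cf x v"
  by (simp add: tm_def cf_sc_mult)

lemma tm_tm [simp]: "e \<triangleright> f \<triangleright> x = (e + f) \<triangleright> x"
  and tm_0 [simp]: "0 \<triangleright> x = x"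
  and tm_mult_left [simp]: "(e \<triangleright> x) * y = e \<triangleright> x * y"
  and tm_add: "e \<triangleright> (x + y) = (e \<triangleright> x) + (e \<triangleright> y)"
  and tm_diff: "e \<triangleright> (x - y) = (e \<triangleright> x) - (e \<triangleright> y)"
  by (simp_all add: tm_def tpow_add sc_mult algebra_simps)

lemma tm_mult_right [simp]: "x * (e \<triangleright> y) = e \<triangleright> x * y"
  unfolding tm_def by (metis sc_central mult.assoc)

text \<open>
  Orders are measured by the total degree in the \<open>x\<^sub>\<beta>\<close>.
\<close>

definition hi :: "rat \<Rightarrow> ('r::finite) qtorus \<Rightarrow> bool" where
  "hi N f \<longleftrightarrow> (\<forall>v. cf f v \<noteq> 0 \<longrightarrow> N \<le> deg (snd v))"

definition pw :: "('r::finite) qtorus \<Rightarrow> bool" where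
  "pw f \<longleftrightarrow> (\<forall>v. cf f v \<noteq> 0 \<longrightarrow> snd v \<in> nvec)"

lemma cf_mult_nonzeroE:
  assumes "cf (f * g) z \<noteq> 0"
  obtains s t where "cf f s \<noteq> 0" "cf g t \<noteq> 0" "z = s + t"
  using assms supp_conv[of "cf f" "cf g"] unfolding cf_mult supp_def by blast

lemma hi_0 [simp]: "hi N 0"
  and hi_mono: "hi M f \<Longrightarrow> N \<le> M \<Longrightarrow> hi N f"
  and hi_minus: "hi N f \<Longrightarrow> hi N (- f)"
  by (auto simp: hi_def) (meson order_trans)+

lemma hi_add: "hi N f \<Longrightarrow> hi N g \<Longrightarrow> hi N (f + g)"
  and hi_diff: "hi N f \<Longrightarrow> hi N g \<Longrightarrow> hi N (f - g)"
  unfolding hi_def by (metis add.right_neutral cf_add) (metis cf_diff diff_zero)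

lemma hi_mult: "hi N f \<Longrightarrow> hi M g \<Longrightarrow> hi (N + M) (f * g)"
  unfolding hi_def by (metis add_mono cf_mult_nonzeroE deg_add snd_add)

lemma hi_1: "hi 0 1"
  by (auto simp: hi_def cf_1 zero_prod_def split: if_splits)

lemma hi_qmon: "hi (deg (snd v)) (qmon c v)"
  by (auto simp: hi_def cf_qmon)

lemma hi_tm: "hi N x \<Longrightarrow> hi N (e \<triangleright> x)" and hi_sc: "hi 0 (sc c)"
  by (auto simp: hi_def cf_sc zero_prod_def split: if_splits)

lemma hi_power: "hi N f \<Longrightarrow> hi (of_nat k * N) (f ^ k)"
proof (induction k)
  case (Suc k)
  then have "hi (N + of_nat k * N) (f * f ^ k)" by (intro hi_mult) auto
  then show ?case by (simp add: algebra_simps)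
qed (simp add: hi_1)

lemma hi_exists: "\<exists>N. hi N f"
proof -
  obtain D where D: "finite D" "\<And>v. cf f v \<noteq> 0 \<Longrightarrow> \<exists>d\<in>D. snd v - d \<in> nvec"
    using tame_cf[of f] unfolding tame_def supp_def by auto
  have "hi (Min (insert 0 (deg ` D))) f"
    unfolding hi_def
  proof (intro allI impI)
    fix v assume "cf f v \<noteq> 0"
    then obtain d where d: "d \<in> D" "snd v - d \<in> nvec" using D by blast
    have "Min (insert 0 (deg ` D)) \<le> deg d" using D d by (intro Min_le) auto
    with nvec_deg[OF d(2)] show "Min (insert 0 (deg ` D)) \<le> deg (snd v)"
      by (simp add: deg_diff)
  qed
  then show ?thesis ..
qed

text \<open>The filtration by order is separated; uniqueness of limits rests on this.\<close>

lemma hi_all_0: assumes "\<And>N. hi N f" shows "f = 0"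
proof (rule qtorus_eqI, rule ccontr)
  fix v assume "cf f v \<noteq> cf 0 v"
  with assms[of "deg (snd v) + 1"] show False by (simp add: hi_def) (metis add_le_same_cancel1 not_one_le_zero prod.collapse)
qed

lemma pw_1: "pw 1" and pw_tm: "pw f \<Longrightarrow> pw (e \<triangleright> f)"
  by (auto simp: pw_def cf_1 zero_prod_def split: if_splits)

lemma pw_diff: "pw f \<Longrightarrow> pw g \<Longrightarrow> pw (f - g)"
  unfolding pw_def by (metis cf_diff diff_zero)

lemma pw_mult: "pw f \<Longrightarrow> pw g \<Longrightarrow> pw (f * g)"
  unfolding pw_def by (metis cf_mult_nonzeroE nvec_add snd_add)

lemma pw_power: "pw f \<Longrightarrow> pw (f ^ k)"
  by (induction k) (auto intro: pw_1 pw_mult)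

lemma pw_hi: "pw f \<Longrightarrow> hi 0 f"
  by (auto simp: pw_def hi_def nvec_deg)

section \<open>Convergence with respect to the degree, and geometric series\<close>

definition flim :: "(nat \<Rightarrow> ('r::finite) qtorus) \<Rightarrow> 'r qtorus \<Rightarrow> bool" where
  "flim F f \<longleftrightarrow> (\<forall>N. \<forall>\<^sub>F k in sequentially. hi N (F k - f))"

lemma flim_const [intro]: "flim (\<lambda>_. f) f"
  by (simp add: flim_def)

lemma flim_add:
  assumes "flim F f" "flim G g" shows "flim (\<lambda>k. F k + G k) (f + g)"
  unfolding flim_def
proof
  fix N
  have "\<forall>\<^sub>F k in sequentially. hi N (F k - f)" "\<forall>\<^sub>F k in sequentially. hi N (G k - g)"
    using assms by (auto simp: flim_def)
  then show "\<forall>\<^sub>F k in sequentially. hi N (F k + G k - (f + g))"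
  proof eventually_elim
    case (elim k)
    then show ?case using hi_add[of N "F k - f" "G k - g"] by (simp add: algebra_simps)
  qed
qed

text \<open>The reason for measuring convergence by the total degree: coefficientwise limits as in
  \<open>has_qlim\<close> do not respect products, since the \<open>k\<close>-th powers of some
  \<open>x_\<beta>\<close> and of its inverse both tend to 0 in that sense.\<close>

lemma flim_mult:
  assumes "flim F f" "flim G g" shows "flim (\<lambda>k. F k * G k) (f * g)"
  unfolding flim_def
proof
  fix N
  obtain M L where bd: "hi M f" "hi L g" using hi_exists by metis
  have "\<forall>\<^sub>F k in sequentially. hi (max M (N - L)) (F k - f)" "\<forall>\<^sub>F k in sequentially. hi (N - M) (G k - g)"
    using assms by (auto simp: flim_def)
  then show "\<forall>\<^sub>F k in sequentially. hi N (F k * G k - f * g)"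
  proof eventually_elim
    case (elim k)
    \<comment> \<open>The two halves of the maximum: the first gives \<open>F k\<close> the lower
      bound \<open>M\<close> of \<open>f\<close>, the second controls the error multiplied by
      \<open>g\<close>.\<close>
    then have "hi M (F k - f)" "hi (N - L) (F k - f)" by (auto intro: hi_mono)
    then have "hi M (F k)" using hi_add[of M "F k - f" f] bd by simp
    then have "hi (M + (N - M)) (F k * (G k - g))" by (rule hi_mult) (rule elim)
    moreover have "hi (N - L + L) ((F k - f) * g)" by (rule hi_mult) (use elim bd in \<open>auto intro: hi_mono\<close>)
    ultimately have "hi N (F k * (G k - g) + (F k - f) * g)" by (intro hi_add) simp_all
    then show ?case by (simp add: algebra_simps)
  qed
qed

lemma flim_mult_left: "flim F f \<Longrightarrow> flim (\<lambda>k. g * F k) (g * f)"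
  and flim_mult_right: "flim F f \<Longrightarrow> flim (\<lambda>k. F k * g) (f * g)"
  by (auto intro: flim_mult)

lemma flim_unique: assumes "flim F f" "flim F g" shows "f = g"
proof -
  have "hi N (f - g)" for N
  proof -
    have "\<forall>\<^sub>F k in sequentially. hi N (F k - f)" "\<forall>\<^sub>F k in sequentially. hi N (F k - g)"
      using assms by (auto simp: flim_def)
    then have "\<forall>\<^sub>F k in sequentially. hi N (f - g)"
    proof eventually_elim
      case (elim k)
      then show ?case using hi_diff[of N "F k - g" "F k - f"] by simp
    qed
    then show ?thesis by simp
  qed
  then show ?thesis using hi_all_0[of "f - g"] by simp
qed

lemma flim_hi:
  assumes "\<And>k. hi (of_nat k + c) (F k - f)"
  shows "flim F f"
  unfolding flim_def
proof
  fix N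
  show "\<forall>\<^sub>F k in sequentially. hi N (F k - f)"
    unfolding eventually_sequentially
  proof (intro exI allI impI)
    fix k assume "nat \<lceil>N - c\<rceil> \<le> k"
    then have "N \<le> of_nat k + c" by linarith
    with assms show "hi N (F k - f)" by (blast intro: hi_mono)
  qed
qed

lemma flim_power_0: "hi 1 u \<Longrightarrow> flim (\<lambda>k. u ^ k) 0"
  by (rule flim_hi[of 0]) (use hi_power[of 1 u] in auto)

lemma flim_eventually: "flim F f \<Longrightarrow> \<forall>\<^sub>F k in sequentially. \<forall>a. cf (F k) (a, y) = cf f (a, y)"
proof -
  assume "flim F f"
  then have "\<forall>\<^sub>F k in sequentially. hi (deg y + 1) (F k - f)" by (simp add: flim_def)
  then show ?thesis
    by eventually_elim (force simp: hi_def)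
qed

text \<open>The series of all powers of \<open>u\<close>. If \<open>u\<close> has order at least 1,
  then \<open>u ^ k\<close> has order at least \<open>k\<close>, so the powers beyond the degree of
  \<open>v\<close> cannot contribute to the coefficient of \<open>v\<close>.\<close>

definition geom :: "('r::finite) qtorus \<Rightarrow> 'r qtorus" where
  "geom u = Hs (\<lambda>v. \<Sum>k\<le>nat \<lfloor>deg (snd v)\<rfloor>. cf (u ^ k) v)"

lemma cf_power_high: "hi 1 u \<Longrightarrow> deg (snd v) < of_nat k \<Longrightarrow> cf (u ^ k) v = 0"
  using hi_power[of 1 u k] unfolding hi_def by (metis leD mult.right_neutral)

lemma cf_sum: "cf (sum f A) v = (\<Sum>i\<in>A. cf (f i) v)"
  by (induction A rule: infinite_finite_induct) auto

lemma cf_geom: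
  assumes "pw u" "hi 1 u"
  shows "cf (geom u) v = (\<Sum>k\<le>nat \<lfloor>deg (snd v)\<rfloor>. cf (u ^ k) v)"
proof -
  let ?f = "\<lambda>v. \<Sum>k\<le>nat \<lfloor>deg (snd v)\<rfloor>. cf (u ^ k) v"
  have *: "\<exists>k\<le>nat \<lfloor>deg (snd v)\<rfloor>. cf (u ^ k) v \<noteq> 0" if "v \<in> supp ?f" for v
  proof (rule ccontr)
    assume "\<not> ?thesis"
    then have "?f v = 0" by (intro sum.neutral) auto
    with that show False by (simp add: supp_def)
  qed
  have "tame (supp ?f)"
    unfolding tame_def
  proof (intro conjI allI exI[of _ "{0}"] impI)
    fix y
    have "{a. (a, y) \<in> supp ?f} \<subseteq> (\<Union>k\<le>nat \<lfloor>deg y\<rfloor>. {a. (a, y) \<in> supp (cf (u ^ k))})"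
    proof
      fix a assume "a \<in> {a. (a, y) \<in> supp ?f}"
      then have "\<exists>k\<le>nat \<lfloor>deg y\<rfloor>. cf (u ^ k) (a, y) \<noteq> 0" using *[of "(a, y)"] by simp
      then show "a \<in> (\<Union>k\<le>nat \<lfloor>deg y\<rfloor>. {a. (a, y) \<in> supp (cf (u ^ k))})"
        by (auto simp: supp_def)
    qed
    moreover have "finite (\<Union>k\<le>nat \<lfloor>deg y\<rfloor>. {a. (a, y) \<in> supp (cf (u ^ k))})"
      using tame_cf by (auto simp: tame_def)
    ultimately show "finite {a. (a, y) \<in> supp ?f}" by (rule finite_subset)
  next
    fix a y assume "(a, y) \<in> supp ?f"
    with * obtain k where "cf (u ^ k) (a, y) \<noteq> 0" by blast
    with pw_power[OF assms(1), of k] show "\<exists>d\<in>{0}. y - d \<in> nvec" by (auto simp: pw_def)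
  qed simp
  then show ?thesis by (simp add: geom_def cf_Hs)
qed

lemma geom_partial:
  assumes "pw u" "hi 1 u"
  shows "flim (\<lambda>N. \<Sum>k<N. u ^ k) (geom u)"
proof (rule flim_hi[of 0])
  fix N
  show "hi (of_nat N + 0) ((\<Sum>k<N. u ^ k) - geom u)"
    unfolding hi_def
  proof (intro allI impI, rule ccontr)
    fix v assume v: "cf ((\<Sum>k<N. u ^ k) - geom u) v \<noteq> 0" "\<not> of_nat N + 0 \<le> deg (snd v)"
    let ?n = "nat \<lfloor>deg (snd v)\<rfloor>"
    have "(\<Sum>k<N. cf (u ^ k) v) = (\<Sum>k\<in>{..<N} \<inter> {..?n}. cf (u ^ k) v)"
    proof (rule sum.mono_neutral_right)
      show "\<forall>k\<in>{..<N} - {..<N} \<inter> {..?n}. cf (u ^ k) v = 0"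
      proof
        fix k assume "k \<in> {..<N} - {..<N} \<inter> {..?n}"
        then have "deg (snd v) < of_nat k" by simp linarith
        then show "cf (u ^ k) v = 0" using assms by (intro cf_power_high)
      qed
    qed auto
    also have "(\<Sum>k\<in>{..<N} \<inter> {..?n}. cf (u ^ k) v) = (\<Sum>k\<le>?n. cf (u ^ k) v)"
    \<comment> \<open>For a negative degree \<open>nat\<close> still admits the index 0, but every
      power of \<open>u\<close> has order at least 0.\<close>
    proof (cases "deg (snd v) < 0")
      case True
      then have "cf (u ^ k) v = 0" for k using assms by (intro cf_power_high) auto
      then show ?thesis by simp
    next
      case False
      then have "{..<N} \<inter> {..?n} = {..?n}"
        using v(2) by (auto simp: nat_less_iff floor_less_iff) linarith
      then show ?thesis by simp
    qed
    also have "\<dots> = cf (geom u) v" using assms by (simp add: cf_geom)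
    finally show False using v(1) by (simp add: cf_sum)
  qed
qed

lemma pw_geom: assumes "pw u" "hi 1 u" shows "pw (geom u)"
  unfolding pw_def
proof (intro allI impI, rule ccontr)
  fix v assume v: "cf (geom u) v \<noteq> 0" "snd v \<notin> nvec"
  then have "cf (u ^ k) v = 0" for k using pw_power[OF assms(1), of k] unfolding pw_def by blast
  with v show False using assms by (simp add: cf_geom)
qed

lemma geom_inverse:
  assumes "pw u" "hi 1 u"
  shows "(1 - u) * geom u = 1" "geom u * (1 - u) = 1"
proof -
  have *: "flim (\<lambda>N. 1 - u ^ N) 1"
    using flim_add[OF flim_const[of 1] flim_mult_left[OF flim_power_0[OF assms(2)], of "-1"]] by simp
  have eq: "(1 - u) * (\<Sum>k<N. u ^ k) = 1 - u ^ N" for N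
    by (induction N) (simp_all only: sum.lessThan_Suc distrib_left, simp_all add: left_diff_distrib)
  have eq': "(\<Sum>k<N. u ^ k) * (1 - u) = 1 - u ^ N" for N
    by (induction N) (simp_all only: sum.lessThan_Suc distrib_right, simp_all add: right_diff_distrib power_commutes)
  show "(1 - u) * geom u = 1"
    using flim_mult_left[OF geom_partial[OF assms], of "1 - u"] * unfolding eq by (rule flim_unique)
  show "geom u * (1 - u) = 1"
    using flim_mult_right[OF geom_partial[OF assms], of "1 - u"] * unfolding eq' by (rule flim_unique)
qed

subsection \<open>Invertible elements and commutation up to powers of t\<close>

definition invble :: "'a::monoid_mult \<Rightarrow> bool" where
  "invble x \<longleftrightarrow> (\<exists>y. x * y = 1 \<and> y * x = 1)"

definition rinv :: "'a::monoid_mult \<Rightarrow> 'a" where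
  "rinv x = (SOME y. x * y = 1 \<and> y * x = 1)"

lemma rinv: "invble x \<Longrightarrow> x * rinv x = 1 \<and> rinv x * x = 1"
  unfolding invble_def rinv_def by (rule someI_ex)

lemma rinv_right [simp]: "invble x \<Longrightarrow> x * rinv x = 1"
  and rinv_left [simp]: "invble x \<Longrightarrow> rinv x * x = 1"
  by (simp_all add: rinv)

lemma rinv_right_assoc [simp]: "invble x \<Longrightarrow> x * (rinv x * y) = y"
  and rinv_left_assoc [simp]: "invble x \<Longrightarrow> rinv x * (x * y) = y"
  by (simp_all flip: mult.assoc)

lemma isuI: "x * y = 1 \<Longrightarrow> y * x = 1 \<Longrightarrow> invble x"
  by (auto simp: invble_def)

lemma rinv_eqI: assumes "x * y = 1" "y * x = 1" shows "rinv x = y"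
proof -
  have "invble x" using assms by (rule isuI)
  then have "rinv x = rinv x * (x * y)" using assms by simp
  then show ?thesis using \<open>invble x\<close> by simp
qed

lemma invble_1 [simp]: "invble 1" and rinv_1 [simp]: "rinv 1 = 1"
  by (auto intro: isuI rinv_eqI)

lemma invble_rinv [simp]: "invble x \<Longrightarrow> invble (rinv x)"
  and rinv_rinv [simp]: "invble x \<Longrightarrow> rinv (rinv x) = x"
  by (rule isuI[of _ x] rinv_eqI; simp)+

lemma invble_mult [simp]: "invble x \<Longrightarrow> invble y \<Longrightarrow> invble (x * y)"
  and rinv_mult: "invble x \<Longrightarrow> invble y \<Longrightarrow> rinv (x * y) = rinv y * rinv x"
  by (rule isuI[of _ "rinv y * rinv x"] rinv_eqI, simp_all add: mult.assoc)+

lemma invble_power [simp]: "invble x \<Longrightarrow> invble (x ^ k)"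
  by (induction k) auto

lemma rinv_power: "invble x \<Longrightarrow> rinv (x ^ k) = rinv x ^ k"
proof (induction k)
  case (Suc k)
  then have "rinv (x ^ k * x) = rinv x * rinv x ^ k" by (subst rinv_mult) auto
  then show ?case by (simp add: power_commutes)
qed simp

lemma invble_cancel: "invble x \<Longrightarrow> y * x = z * x \<longleftrightarrow> y = z" "invble x \<Longrightarrow> x * y = x * z \<longleftrightarrow> y = z"
  by (metis mult.assoc mult.right_neutral rinv_right) (metis rinv_left_assoc)

definition ipow :: "'a::monoid_mult \<Rightarrow> int \<Rightarrow> 'a" where
  "ipow x z = (if z < 0 then rinv (x ^ nat (- z)) else x ^ nat z)"

lemma ipow_0 [simp]: "ipow x 0 = 1" and ipow_1 [simp]: "ipow x 1 = x"
  and ipow_of_nat: "ipow x (int k) = x ^ k" and ipow_numeral: "ipow x (numeral w) = x ^ numeral w"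
  by (auto simp: ipow_def)

lemma invble_ipow [simp]: "invble x \<Longrightarrow> invble (ipow x z)"
  by (simp add: ipow_def)

lemma ipow_succ: assumes "invble x" shows "ipow x (z + 1) = ipow x z * x"
proof (cases "z < 0")
  case True
  then obtain k where k: "z = - int (Suc k)"
    by (metis int_cases le_minus_one_simps(3) linorder_not_less of_nat_0_le_iff)
  have "ipow x (z + 1) = rinv x ^ k"
    using assms by (auto simp: ipow_def k rinv_power)
  moreover have "ipow x z = rinv x ^ Suc k"
    using assms by (simp add: ipow_def k nat_add_distrib rinv_power del: power_Suc)
  then have "ipow x z * x = rinv x ^ k * (rinv x * x)"
    by (simp add: mult.assoc power_Suc2 del: power_Suc)
  ultimately show ?thesis using assms by simp
next
  case False
  then have "nat (z + 1) = Suc (nat z)" by simp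
  with False show ?thesis by (simp add: ipow_def power_Suc2 del: power_Suc)
qed

lemma ipow_add: assumes "invble x" shows "ipow x (a + b) = ipow x a * ipow x b"
proof (induction b rule: int_induct[where k = 0])
  case (step1 i)
  then show ?case using ipow_succ[OF assms, of "a + i"] ipow_succ[OF assms, of i]
    by (simp add: algebra_simps)
next
  case (step2 i)
  have "ipow x (a + (i - 1)) * x = ipow x a * ipow x (i - 1) * x"
    using step2 ipow_succ[OF assms, of "a + i - 1"] ipow_succ[OF assms, of "i - 1"]
    by (simp add: algebra_simps)
  then show ?case using assms by (simp add: invble_cancel)
qed simp

lemma ipow_minus: assumes "invble x" shows "ipow x (- z) = rinv (ipow x z)"
proof (rule rinv_eqI[symmetric])
  show "ipow x z * ipow x (- z) = 1" "ipow x (- z) * ipow x z = 1"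
    using ipow_add[OF assms, of z "- z"] ipow_add[OF assms, of "- z" z] by simp_all
qed

lemma ipow_m1: "invble x \<Longrightarrow> ipow x (- 1) = rinv x"
  using ipow_minus[of x 1] by simp

lemma ipow_commute:
  assumes "x * y = y * x" "invble y" shows "x * ipow y z = ipow y z * x"
proof -
  have *: "x * y ^ k = y ^ k * x" for k
  proof (induction k)
    case (Suc k)
    have "x * (y * y ^ k) = y * (x * y ^ k)" using assms by (metis mult.assoc)
    with Suc show ?case by (simp add: mult.assoc)
  qed simp
  have "x * rinv w = rinv w * x" if "x * w = w * x" "invble w" for w
    using that by (metis mult.assoc mult.left_neutral mult.right_neutral rinv_left rinv_right)
  with * assms show ?thesis by (simp add: ipow_def)
qed

section \<open>Ordered monomials in a family of invertible elements\<close>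

definition enumr :: "'r::{finite,linorder} list" where
  "enumr = sorted_list_of_set UNIV"

lemma set_enumr [simp]: "set enumr = UNIV" and distinct_enumr [simp]: "distinct enumr"
  by (simp_all add: enumr_def)

definition vp :: "('r::{finite,linorder} \<Rightarrow> 'a::monoid_mult) \<Rightarrow> 'r ivector \<Rightarrow> 'a" where
  "vp Q w = prod_list (map (\<lambda>\<beta>. ipow (Q \<beta>) (w $ \<beta>)) enumr)"

definition cfam :: "('r \<Rightarrow> 'a::monoid_mult) \<Rightarrow> bool" where
  "cfam Q \<longleftrightarrow> (\<forall>\<alpha>. invble (Q \<alpha>)) \<and> (\<forall>\<alpha> \<beta>. Q \<alpha> * Q \<beta> = Q \<beta> * Q \<alpha>)"

lemma prod_list_commute:
  "(\<And>y. y \<in> set ys \<Longrightarrow> x * y = y * x) \<Longrightarrow> x * prod_list ys = prod_list ys * (x::'a::monoid_mult)"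
proof (induction ys)
  case (Cons y ys)
  have "x * (y * prod_list ys) = y * (x * prod_list ys)" using Cons.prems[of y] by (simp flip: mult.assoc)
  with Cons show ?case by (simp add: mult.assoc)
qed simp

lemma prod_list_map_mult:
  assumes "\<And>x y. x \<in> set xs \<Longrightarrow> y \<in> set xs \<Longrightarrow> g x * f y = f y * (g x :: 'a::monoid_mult)"
  shows "prod_list (map (\<lambda>x. f x * g x) xs) = prod_list (map f xs) * prod_list (map g xs)"
  using assms
proof (induction xs)
  case (Cons x xs)
  have "g x * prod_list (map f xs) = prod_list (map f xs) * g x"
    by (rule prod_list_commute) (use Cons.prems in auto)
  then have "f x * g x * (prod_list (map f xs) * prod_list (map g xs)) =
      f x * (prod_list (map f xs) * (g x * prod_list (map g xs)))"
    by (metis mult.assoc)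
  with Cons show ?case by (simp add: mult.assoc)
qed simp

lemma prod_list_single:
  "distinct xs \<Longrightarrow> a \<in> set xs \<Longrightarrow> (\<And>x. x \<noteq> a \<Longrightarrow> f x = 1) \<Longrightarrow> prod_list (map f xs) = (f a :: 'a::monoid_mult)"
proof (induction xs)
  case (Cons x xs)
  show ?case
  proof (cases "x = a")
    case True
    have "prod_list (map f xs) = prod_list (map (\<lambda>_. 1) xs)"
      by (rule arg_cong[of _ _ prod_list], rule map_cong) (use Cons True in fastforce)+
    also have "\<dots> = 1" by (induction xs) auto
    finally show ?thesis using True by simp
  qed (use Cons in auto)
qed simp

lemma invble_prod_list: "(\<And>x. x \<in> set xs \<Longrightarrow> invble (f x)) \<Longrightarrow> invble (prod_list (map f xs))"
  by (induction xs) auto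

lemma invble_vp [simp]: "cfam Q \<Longrightarrow> invble (vp Q w)"
  by (simp add: vp_def cfam_def invble_prod_list)

lemma ipow_ipow_commute: "cfam Q \<Longrightarrow> ipow (Q \<alpha>) a * ipow (Q \<beta>) b = ipow (Q \<beta>) b * ipow (Q \<alpha>) a"
  by (intro ipow_commute ipow_commute[symmetric]) (auto simp: cfam_def)

lemma vp_add: "cfam Q \<Longrightarrow> vp Q (a + b) = vp Q a * vp Q b"
  unfolding vp_def
proof (subst prod_list_map_mult[symmetric])
  assume Q: "cfam Q"
  show "ipow (Q x) (b $ x) * ipow (Q y) (a $ y) = ipow (Q y) (a $ y) * ipow (Q x) (b $ x)" for x y
    by (rule ipow_ipow_commute[OF Q])
  show "prod_list (map (\<lambda>\<beta>. ipow (Q \<beta>) ((a + b) $ \<beta>)) enumr) =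
    prod_list (map (\<lambda>x. ipow (Q x) (a $ x) * ipow (Q x) (b $ x)) enumr)"
    using Q by (simp add: ipow_add cfam_def)
qed

lemma vp_0 [simp]: "vp Q 0 = 1"
proof -
  have "prod_list (map (\<lambda>_. 1) xs) = 1" for xs :: "'b list" by (induction xs) auto
  then show ?thesis by (simp add: vp_def)
qed

lemma vp_axis: "vp Q (axis \<alpha> k) = ipow (Q \<alpha>) k"
  unfolding vp_def by (subst prod_list_single[of _ \<alpha>]) (auto simp: axis_def)

lemma vp_minus: assumes "cfam Q" shows "vp Q (- w) = rinv (vp Q w)"
  by (rule rinv_eqI[symmetric]) (use vp_add[OF assms, of w "- w"] vp_add[OF assms, of "- w" w] in simp_all)

lemma vp_commute: "cfam Q \<Longrightarrow> vp Q a * vp Q b = vp Q b * vp Q a"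
  by (metis add.commute vp_add)

section \<open>Commutation up to a power of \<open>t\<close>\<close>

definition qcomm :: "rat \<Rightarrow> ('r::finite) qtorus \<Rightarrow> 'r qtorus \<Rightarrow> bool" where
  "qcomm e x y \<longleftrightarrow> x * y = e \<triangleright> y * x"

lemma invble_tm [simp]: "invble x \<Longrightarrow> invble (e \<triangleright> x)"
  and rinv_tm: "invble x \<Longrightarrow> rinv (e \<triangleright> x) = (- e) \<triangleright> rinv x"
  by (rule isuI[of _ "(- e) \<triangleright> rinv x"] rinv_eqI; simp)+

lemma tm_power: "(e \<triangleright> x) ^ k = (of_nat k * e) \<triangleright> x ^ k"
  by (induction k) (simp_all add: algebra_simps)

lemma qcomm_0: "qcomm 0 x y \<longleftrightarrow> x * y = y * x"
  by (simp add: qcomm_def)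

lemma qcomm_sym: assumes "qcomm e x y" shows "qcomm (- e) y x"
  using assms by (simp add: qcomm_def)

lemma qcomm_mult_right: assumes "qcomm e x y" "qcomm f x z" shows "qcomm (e + f) x (y * z)"
proof -
  have "x * (y * z) = (x * y) * z" by (simp only: mult.assoc)
  also have "\<dots> = e \<triangleright> y * (x * z)" using assms(1) by (simp only: qcomm_def tm_mult_left mult.assoc)
  also have "\<dots> = (e + f) \<triangleright> y * z * x"
    using assms(2) by (simp only: qcomm_def tm_mult_right tm_tm mult.assoc)
  finally show ?thesis by (simp only: qcomm_def mult.assoc)
qed

lemma qcomm_rinv_right: assumes "qcomm e x y" "invble y" shows "qcomm (- e) x (rinv y)"
proof -
  have "rinv y * (x * y) * rinv y = e \<triangleright> x * rinv y"
    using assms by (simp add: qcomm_def mult.assoc)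
  then have "rinv y * x = e \<triangleright> x * rinv y" using assms(2) by (simp add: mult.assoc)
  then show ?thesis by (simp add: qcomm_def)
qed

lemma qcomm_rinv_left: assumes "qcomm e x y" "invble x" shows "qcomm (- e) (rinv x) y"
  using qcomm_sym[OF qcomm_rinv_right[OF qcomm_sym[OF assms(1)] assms(2)]] by simp

lemma qcomm_1: "qcomm 0 x 1"
  by (simp add: qcomm_0)

lemma qcomm_tm: "qcomm e x y \<Longrightarrow> qcomm e x (f \<triangleright> y)" "qcomm e x y \<Longrightarrow> qcomm e (f \<triangleright> x) y"
  by (simp_all add: qcomm_def algebra_simps)

lemma qcomm_diff: "qcomm e x y \<Longrightarrow> qcomm e x z \<Longrightarrow> qcomm e x (y - z)"
  by (simp add: qcomm_def right_diff_distrib left_diff_distrib tm_diff)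

lemma qcomm_power: "qcomm e x y \<Longrightarrow> qcomm (of_nat k * e) x (y ^ k)"
proof (induction k)
  case (Suc k)
  then have "qcomm (e + of_nat k * e) x (y * y ^ k)" by (intro qcomm_mult_right) auto
  then show ?case by (simp add: algebra_simps)
qed (simp add: qcomm_1)

lemma qcomm_ipow: assumes "qcomm e x y" "invble y" shows "qcomm (of_int z * e) x (ipow y z)"
proof (cases "z < 0")
  case True
  then have "qcomm (- (of_nat (nat (- z)) * e)) x (rinv (y ^ nat (- z)))"
    using assms by (intro qcomm_rinv_right qcomm_power) auto
  with True show ?thesis by (simp add: ipow_def of_nat_nat)
next
  case False
  with qcomm_power[OF assms(1), of "nat z"] show ?thesis by (simp add: ipow_def of_nat_nat)
qed

lemma qcomm_prod_list:
  "(\<And>i. i \<in> set xs \<Longrightarrow> qcomm (e i) x (f i)) \<Longrightarrow> qcomm (sum_list (map e xs)) x (prod_list (map f xs))"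
  by (induction xs) (auto intro: qcomm_1 qcomm_mult_right)

lemma sum_list_enumr: "sum_list (map f enumr) = sum f UNIV"
  by (simp add: sum_list_distinct_conv_sum_set)

lemma qcomm_vp:
  assumes "\<And>\<beta>. qcomm (e \<beta>) x (Q \<beta>)" "\<And>\<beta>. invble (Q \<beta>)"
  shows "qcomm (\<Sum>\<beta>\<in>UNIV. of_int (w $ \<beta>) * e \<beta>) x (vp Q w)"
  unfolding vp_def sum_list_enumr[symmetric] by (intro qcomm_prod_list qcomm_ipow assms)

subsection \<open>Solving the Q-system\<close>

text \<open>Power series in the \<open>x_\<beta>\<close> with leading term 1. They form a group,
  inverses being geometric series.\<close>

definition inU :: "('r::finite) qtorus \<Rightarrow> bool" where
  "inU g \<longleftrightarrow> pw g \<and> hi 1 (g - 1)"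

lemma inU_1: "inU 1"
  by (simp add: inU_def pw_1)

lemma inU_mult: assumes "inU f" "inU g" shows "inU (f * g)"
proof -
  have "hi (1 + 0) ((f - 1) * g)"
    using assms by (intro hi_mult pw_hi) (auto simp: inU_def)
  then have "hi 1 ((f - 1) * g + (g - 1))"
    using assms by (intro hi_add) (auto simp: inU_def)
  then show ?thesis using assms by (simp add: inU_def pw_mult algebra_simps)
qed

lemma inU_diff: "pw u \<Longrightarrow> hi 1 u \<Longrightarrow> inU (1 - u)"
  by (simp add: inU_def pw_diff pw_1 hi_minus)

lemma inU_inverse: assumes "inU g" shows "invble g" "inU (rinv g)" "rinv g = geom (1 - g)"
proof -
  have u: "pw (1 - g)" "hi 1 (1 - g)"
    using assms hi_minus[of 1 "g - 1"] by (auto simp: inU_def intro: pw_diff pw_1)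
  have g: "g * geom (1 - g) = 1" "geom (1 - g) * g = 1"
    using geom_inverse[OF u] by simp_all
  then show "invble g" by (rule isuI)
  show r: "rinv g = geom (1 - g)" using g by (rule rinv_eqI)
  have "hi (1 + 0) ((1 - g) * geom (1 - g))"
    by (intro hi_mult pw_hi pw_geom u)
  then have "hi 1 (geom (1 - g) - 1)" using g by (simp add: algebra_simps)
  then show "inU (rinv g)" using pw_geom[OF u] by (simp add: inU_def r)
qed

lemma flim_rinv:
  assumes "pw u" "hi 1 u" shows "flim (\<lambda>N. \<Sum>k<N. u ^ k) (rinv (1 - u))"
  using geom_partial[OF assms] inU_inverse(3)[OF inU_diff[OF assms]] by simp

lemma invble_qmon [simp]: "invble (qmon 1 v)" and rinv_qmon: "rinv (qmon 1 v) = (tw v v) \<triangleright> qmon 1 (- v)"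
proof -
  have "qmon 1 v * ((tw v v) \<triangleright> qmon 1 (- v)) = 1" "((tw v v) \<triangleright> qmon 1 (- v)) * qmon 1 v = 1"
    by (simp_all add: qmon_mult tw_minus tm_def sc_def flip: tpow_add qmon_1)
  then show "invble (qmon 1 v)" "rinv (qmon 1 v) = (tw v v) \<triangleright> qmon 1 (- v)"
    by (rule isuI rinv_eqI; assumption)+
qed

lemma cf_conj_nonzero: "cf (qmon c v * g * qmon c' (- v)) z \<noteq> 0 \<Longrightarrow> cf g z \<noteq> 0"
  by (auto simp: cf_mult_qmon cf_qmon_mult)

text \<open>Conjugation by a monomial multiplies each coefficient by a power of \<open>t\<close> and
  moves no exponent.\<close>

lemma inU_conj: assumes "inU g" shows "inU (qmon 1 v * g * rinv (qmon 1 v))"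
proof -
  have *: "cf (qmon 1 v * h * rinv (qmon 1 v)) z \<noteq> 0 \<Longrightarrow> cf h z \<noteq> 0" for h z
    using cf_conj_nonzero[of 1 v h 1 z] by (auto simp: rinv_qmon)
  have "qmon 1 v * g * rinv (qmon 1 v) - 1 = qmon 1 v * (g - 1) * rinv (qmon 1 v)"
    by (simp add: algebra_simps)
  with assms * show ?thesis unfolding inU_def pw_def hi_def by metis
qed

lemma inU_conj': assumes "inU g" shows "inU (rinv (qmon 1 v) * g * qmon 1 v)"
proof -
  have "qmon 1 v = (- tw v v) \<triangleright> rinv (qmon 1 (- v))"
    by (simp add: rinv_qmon tw_minus)
  then have "rinv (qmon 1 v) * g * qmon 1 v = rinv (qmon 1 v) * g * ((- tw v v) \<triangleright> rinv (qmon 1 (- v)))"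
    by (rule arg_cong)
  also have "\<dots> = qmon 1 (- v) * g * rinv (qmon 1 (- v))"
    by (simp add: rinv_qmon[of v])
  finally show ?thesis using inU_conj[OF assms, of "- v"] by simp
qed

text \<open>Such elements form a group, because a monomial can be moved past an element of
  \<open>inU\<close>. Only \<open>y\<close> is recorded: the degree, and with it convergence, is
  read off from it.\<close>

definition lead :: "rat^('r::finite) \<Rightarrow> 'r qtorus \<Rightarrow> bool" where
  "lead y f \<longleftrightarrow> (\<exists>e a g. inU g \<and> f = e \<triangleright> qmon 1 (a, y) * g)"

lemma lead_qmon: "lead y (qmon 1 (a, y))"
  unfolding lead_def by (intro exI[of _ 0] exI[of _ a] exI[of _ 1]) (simp add: inU_1)

lemma lead_inU: "inU g \<Longrightarrow> lead 0 g"
  unfolding lead_def by (intro exI[of _ 0] exI[of _ g]) (simp add: qmon_1 flip: zero_prod_def)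

lemma lead_1: "lead 0 1"
  by (simp add: lead_inU inU_1)

lemma lead_tm: "lead y f \<Longrightarrow> lead y (e \<triangleright> f)"
  unfolding lead_def by (metis tm_tm)

lemma lead_mult: assumes "lead y f" "lead y' f'" shows "lead (y + y') (f * f')"
proof -
  obtain e a g e' a' g' where g: "inU g" "f = e \<triangleright> qmon 1 (a, y) * g" "inU g'" "f' = e' \<triangleright> qmon 1 (a', y') * g'"
    using assms unfolding lead_def by blast
  let ?h = "rinv (qmon 1 (a', y')) * g * qmon 1 (a', y') * g'"
  have "f * f' = (e + e') \<triangleright> (qmon 1 (a, y) * qmon 1 (a', y')) * ?h"
    by (simp add: g mult.assoc add.commute)
  also have "\<dots> = (e + e' + tw (a, y) (a', y')) \<triangleright> qmon 1 (a + a', y + y') * ?h"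
  proof -
    have "qmon 1 (a, y) * qmon 1 (a', y') = tw (a, y) (a', y') \<triangleright> qmon 1 (a + a', y + y')"
      by (simp add: qmon_mult tm_def sc_def)
    then show ?thesis by (simp add: add_ac)
  qed
  finally show ?thesis
    using g inU_conj'[of g "(a', y')"] inU_mult unfolding lead_def by blast
qed

lemma lead_inverse: assumes "lead y f" shows "invble f" "lead (- y) (rinv f)"
proof -
  obtain e a g where g: "inU g" "f = e \<triangleright> qmon 1 (a, y) * g"
    using assms unfolding lead_def by blast
  then show "invble f" by (simp add: inU_inverse)
  have "lead (0 + - y) ((- e) \<triangleright> rinv g * rinv (qmon 1 (a, y)))"
    unfolding rinv_qmon uminus_prod_def prod.case
    by (intro lead_tm lead_mult lead_inU lead_qmon inU_inverse g) (simp add: lead_tm lead_qmon)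
  then show "lead (- y) (rinv f)"
    using g by (simp add: rinv_tm rinv_mult inU_inverse)
qed

lemma lead_power: "lead y f \<Longrightarrow> lead (of_nat k *s y) (f ^ k)"
proof (induction k)
  case (Suc k)
  then have "lead (y + of_nat k *s y) (f * f ^ k)" by (intro lead_mult)
  moreover have "y + of_nat k *s y = of_nat (Suc k) *s y" by (simp add: vec_eq_iff algebra_simps)
  ultimately show ?case by simp
qed (simp add: lead_1)

lemma lead_ipow: assumes "lead y f" shows "lead (of_int z *s y) (ipow f z)"
proof (cases "z < 0")
  case True
  have "lead (- (of_nat (nat (- z)) *s y)) (rinv (f ^ nat (- z)))"
    by (intro lead_inverse lead_power assms)
  moreover have "- (of_nat (nat (- z)) *s y) = of_int z *s y"
    using True by (simp add: vec_eq_iff of_nat_nat)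
  ultimately show ?thesis using True by (simp add: ipow_def)
next
  case False
  with lead_power[OF assms, of "nat z"] show ?thesis by (simp add: ipow_def of_nat_nat)
qed

lemma lead_prod_list:
  "(\<And>i. i \<in> set xs \<Longrightarrow> lead (y i) (f i)) \<Longrightarrow> lead (sum_list (map y xs)) (prod_list (map f xs))"
  by (induction xs) (auto intro: lead_1 lead_mult)

lemma lead_vp:
  assumes "\<And>\<beta>. lead (y \<beta>) (Q \<beta>)"
  shows "lead (\<Sum>\<beta>\<in>UNIV. of_int (w $ \<beta>) *s y \<beta>) (vp Q w)"
  unfolding vp_def sum_list_enumr[symmetric] by (intro lead_prod_list lead_ipow assms)

lemma lead_hi: assumes "lead y f" shows "hi (deg y) f"
proof -
  obtain e a g where g: "inU g" "f = e \<triangleright> qmon 1 (a, y) * g"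
    using assms unfolding lead_def by blast
  have "hi (deg y + 0) (qmon 1 (a, y) * g)"
    using g hi_qmon[of "(a, y)" 1] by (intro hi_mult pw_hi) (auto simp: inU_def)
  then show ?thesis using g by (simp add: hi_tm)
qed

lemma lead_pw: assumes "lead y f" "y \<in> nvec" shows "pw f"
proof -
  obtain e a g where g: "inU g" "f = e \<triangleright> qmon 1 (a, y) * g"
    using assms unfolding lead_def by blast
  have "pw (qmon 1 (a, y))" using assms(2) by (simp add: pw_def cf_qmon)
  with g show ?thesis by (simp add: pw_tm pw_mult inU_def)
qed

section \<open>The Cartan matrix, its inverse and the bilinear form given by
  \<open>lam\<close>\<close>

locale cartan =
  fixes C :: "('r::{finite,linorder}) imatrix"
  assumes cartan: "simple_simply_laced_cartan_matrix C"
begin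

abbreviation cq :: "((rat, 'r) vec, 'r) vec" where "cq \<equiv> (\<chi> \<gamma> \<epsilon>. of_int (C $ \<gamma> $ \<epsilon>))"

definition ci :: "((rat, 'r) vec, 'r) vec" where "ci = matrix_inv cq"

definition dl :: rat where "dl = of_int (det C)"

definition lm :: "'r \<Rightarrow> 'r \<Rightarrow> rat" where "lm \<alpha> \<beta> = lam C $ \<alpha> $ \<beta>"

lemma C_diag [simp]: "C $ \<alpha> $ \<alpha> = 2"
  using cartan by (simp add: simple_simply_laced_cartan_matrix_def finite_type_cartan_matrix_def)

lemma C_off: "\<alpha> \<noteq> \<beta> \<Longrightarrow> C $ \<alpha> $ \<beta> = 0 \<or> C $ \<alpha> $ \<beta> = - 1"
  using cartan by (auto simp: simple_simply_laced_cartan_matrix_def simply_laced_matrix_def)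

lemma C_sym: "C $ \<alpha> $ \<beta> = C $ \<beta> $ \<alpha>"
proof (cases "\<alpha> = \<beta>")
  case False
  have "C $ \<alpha> $ \<beta> = 0 \<Longrightarrow> C $ \<beta> $ \<alpha> = 0" for \<alpha> \<beta>
    using cartan by (auto simp: simple_simply_laced_cartan_matrix_def finite_type_cartan_matrix_def)
  with C_off[of \<alpha> \<beta>] C_off[of \<beta> \<alpha>] False show ?thesis by metis
qed simp

text \<open>Finite type enters here: the symmetrized form is positive definite, and it takes the
  value 0 at every vector of the kernel.\<close>

lemma cq_ker: assumes "cq *v x = 0" shows "x = 0"
proof (rule ccontr)
  assume "x \<noteq> 0"
  then have "\<exists>\<alpha>. x $ \<alpha> \<noteq> 0" by (simp add: vec_eq_iff)
  moreover obtain d :: "'r \<Rightarrow> rat" where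
    "\<forall>v :: 'r \<Rightarrow> rat. (\<exists>\<alpha>. v \<alpha> \<noteq> 0) \<longrightarrow>
           0 < (\<Sum>\<alpha>\<in>UNIV. \<Sum>\<beta>\<in>UNIV. v \<alpha> * (d \<alpha> * of_int (C $ \<alpha> $ \<beta>)) * v \<beta>)"
    using cartan unfolding simple_simply_laced_cartan_matrix_def finite_type_cartan_matrix_def by blast
  ultimately have "0 < (\<Sum>\<alpha>\<in>UNIV. \<Sum>\<beta>\<in>UNIV. x $ \<alpha> * (d \<alpha> * of_int (C $ \<alpha> $ \<beta>)) * x $ \<beta>)"
    by blast
  also have "\<dots> = (\<Sum>\<alpha>\<in>UNIV. x $ \<alpha> * d \<alpha> * (cq *v x) $ \<alpha>)"
    by (simp add: matrix_vector_mult_def sum_distrib_left mult_ac)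
  also have "\<dots> = 0" using assms by simp
  finally show False by simp
qed

lemma ci_right: "cq ** ci = mat 1" and ci_left: "ci ** cq = mat 1" and det_cq: "det cq \<noteq> 0"
proof -
  have "\<exists>B. B ** cq = mat 1"
    using cq_ker by (simp add: matrix_left_invertible_ker)
  then have inv: "invertible cq" by (simp add: invertible_left_inverse)
  then have "cq ** ci = mat 1 \<and> ci ** cq = mat 1"
    unfolding ci_def matrix_inv_def invertible_def by (rule someI_ex)
  then show "cq ** ci = mat 1" "ci ** cq = mat 1" by auto
  show "det cq \<noteq> 0" using inv by (simp add: invertible_det_nz)
qed

lemma dl_det: "dl = det cq"
  by (simp add: dl_def det_def)

lemma dl_nz [simp]: "dl \<noteq> 0"
  using det_cq by (simp add: dl_det)

lemma lm_ci: "lm \<alpha> \<beta> = dl * ci $ \<alpha> $ \<beta>"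
  by (simp add: lm_def lam_def dl_def ci_def)

lemma cq_ci: "(\<Sum>\<gamma>\<in>UNIV. of_int (C $ \<alpha> $ \<gamma>) * ci $ \<gamma> $ \<beta>) = (if \<alpha> = \<beta> then 1 else 0)"
  using arg_cong[OF ci_right, of "\<lambda>M. M $ \<alpha> $ \<beta>"] by (simp add: matrix_matrix_mult_def mat_def)

lemma ci_cq: "(\<Sum>\<gamma>\<in>UNIV. ci $ \<alpha> $ \<gamma> * of_int (C $ \<gamma> $ \<beta>)) = (if \<alpha> = \<beta> then 1 else 0)"
  using arg_cong[OF ci_left, of "\<lambda>M. M $ \<alpha> $ \<beta>"] by (simp add: matrix_matrix_mult_def mat_def)

lemma ci_sym: "ci $ \<alpha> $ \<beta> = ci $ \<beta> $ \<alpha>"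
proof -
  have t: "transpose cq = cq" by (simp add: transpose_def vec_eq_iff C_sym)
  have "transpose ci ** cq = mat 1"
    using arg_cong[OF ci_right, of transpose] by (simp add: matrix_transpose_mul t transpose_mat)
  then have "transpose ci = ci"
    by (metis ci_right matrix_mul_assoc matrix_mul_lid matrix_mul_rid)
  moreover have "transpose ci $ \<beta> $ \<alpha> = ci $ \<alpha> $ \<beta>" by (simp add: transpose_def)
  ultimately show ?thesis by simp
qed

lemma lm_sym: "lm \<alpha> \<beta> = lm \<beta> \<alpha>"
  by (simp add: lm_ci ci_sym)

lemma lm_C: "(\<Sum>\<gamma>\<in>UNIV. lm \<alpha> \<gamma> * of_int (C $ \<gamma> $ \<beta>)) = (if \<alpha> = \<beta> then dl else 0)"
  by (simp add: lm_ci mult.assoc ci_cq flip: sum_distrib_left)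

definition lf :: "'r ivector \<Rightarrow> 'r ivector \<Rightarrow> rat" where
  "lf a b = (\<Sum>\<alpha>\<in>UNIV. \<Sum>\<beta>\<in>UNIV. of_int (a $ \<alpha>) * lm \<alpha> \<beta> * of_int (b $ \<beta>))"

lemma lf_add: "lf (a + a') b = lf a b + lf a' b" "lf a (b + b') = lf a b + lf a b'"
  and lf_diff: "lf (a - a') b = lf a b - lf a' b" "lf a (b - b') = lf a b - lf a b'"
  and lf_minus: "lf (- a) b = - lf a b" "lf a (- b) = - lf a b"
  and lf_0 [simp]: "lf 0 b = 0" "lf a 0 = 0"
  by (simp_all add: lf_def algebra_simps sum.distrib sum_subtractf sum_negf)

lemma lf_sym: "lf a b = lf b a"
  unfolding lf_def by (subst sum.swap) (simp add: lm_sym mult_ac)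

lemma lf_scale: "lf (k *s a) b = of_int k * lf a b" "lf a (k *s b) = of_int k * lf a b"
  by (simp_all add: lf_def sum_distrib_left mult_ac)

lemma lf_axis: "lf (axis \<alpha> 1) b = (\<Sum>\<beta>\<in>UNIV. lm \<alpha> \<beta> * of_int (b $ \<beta>))"
proof -
  have "lf (axis \<alpha> 1) b = (\<Sum>\<gamma>\<in>UNIV. if \<gamma> = \<alpha> then (\<Sum>\<beta>\<in>UNIV. lm \<alpha> \<beta> * of_int (b $ \<beta>)) else 0)"
    unfolding lf_def by (rule sum.cong) (auto simp: axis_def)
  then show ?thesis by simp
qed

lemma lf_axis_axis: "lf (axis \<alpha> 1) (axis \<beta> 1) = lm \<alpha> \<beta>"
proof -
  have "lf (axis \<alpha> 1) (axis \<beta> 1) = (\<Sum>\<gamma>\<in>UNIV. if \<gamma> = \<beta> then lm \<alpha> \<beta> else 0)"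
    unfolding lf_axis by (rule sum.cong) (auto simp: axis_def)
  then show ?thesis by simp
qed

definition dot :: "'r ivector \<Rightarrow> 'r ivector \<Rightarrow> rat" where
  "dot a b = (\<Sum>\<alpha>\<in>UNIV. of_int (a $ \<alpha> * b $ \<alpha>))"

text \<open>From \<open>\<lambda> C = \<delta>\<close>. Through this identity the exponents of
  \<open>t\<close> that come from \<open>C\<close> become multiples of \<open>dl\<close>, that is,
  exponents of \<open>q\<close>.\<close>

lemma lf_C: "lf a (C *v s) = dl * dot a s"
proof -
  have "lf a (C *v s) = (\<Sum>\<alpha>\<in>UNIV. of_int (a $ \<alpha>) * (\<Sum>\<beta>\<in>UNIV. \<Sum>\<gamma>\<in>UNIV. lm \<alpha> \<beta> * of_int (C $ \<beta> $ \<gamma>) * of_int (s $ \<gamma>)))"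
    by (simp add: lf_def matrix_vector_mult_def sum_distrib_left mult_ac)
  also have "\<dots> = (\<Sum>\<alpha>\<in>UNIV. of_int (a $ \<alpha>) * (\<Sum>\<gamma>\<in>UNIV. (\<Sum>\<beta>\<in>UNIV. lm \<alpha> \<beta> * of_int (C $ \<beta> $ \<gamma>)) * of_int (s $ \<gamma>)))"
    by (subst sum.swap) (simp add: sum_distrib_right)
  also have "\<dots> = (\<Sum>\<alpha>\<in>UNIV. of_int (a $ \<alpha>) * (dl * of_int (s $ \<alpha>)))"
    by (simp add: lm_C if_distrib[of "\<lambda>x. x * _"] cong: if_cong)
  finally show ?thesis by (simp add: dot_def sum_distrib_left mult_ac)
qed

lemma dot_add: "dot a (b + b') = dot a b + dot a b'"
  and dot_sym: "dot a b = dot b a"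
  and dot_scale: "dot a (k *s b) = of_int k * dot a b"
  by (simp_all add: dot_def algebra_simps sum.distrib sum_distrib_left)

lemma dot_sum: "dot a (\<Sum>i\<in>A. f i) = (\<Sum>i\<in>A. dot a (f i))"
  by (induction A rule: infinite_finite_induct) (simp_all add: dot_add, simp_all add: dot_def)

lemma dot_axis: "dot a (axis \<alpha> 1) = of_int (a $ \<alpha>)"
  by (simp add: dot_def axis_def if_distrib[of "\<lambda>x. _ * x"] if_distrib[of of_int] cong: if_cong)

lemma C_axis: "(C *v axis \<alpha> 1) $ \<beta> = C $ \<beta> $ \<alpha>"
  by (simp add: matrix_vector_mult_def axis_def if_distrib[of "\<lambda>x. _ * x"] cong: if_cong)

text \<open>A column of the inverse Cartan matrix; its negative is the second coordinate of the
  variable \<open>Q\<^sub>\<alpha>\<^sub>,\<^sub>1\<close>.\<close>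

definition civ :: "'r \<Rightarrow> (rat, 'r) vec" where "civ \<alpha> = (\<chi> \<gamma>. ci $ \<gamma> $ \<alpha>)"

text \<open>The Q-system solved for the larger index, with the factor \<open>1 - X\<close> split off
  on the left. As \<open>rinv\<close> is total, the recursion makes sense at once; that the inverted
  elements are invertible follows from \<open>lead_QQ\<close>. The initial values are the two
  families of variables in the new coordinates.\<close>

fun QQ :: "nat \<Rightarrow> 'r \<Rightarrow> 'r qtorus" where
  "QQ 0 \<alpha> = qmon 1 (axis \<alpha> dl, 0)"
| "QQ (Suc 0) \<alpha> = qmon 1 (0, - civ \<alpha>)"
| "QQ (Suc (Suc n)) \<alpha> =
    (1 - vp (QQ (Suc n)) (- (C *v axis \<alpha> 1))) * ((- lm \<alpha> \<alpha>) \<triangleright> QQ (Suc n) \<alpha> ^ 2 * rinv (QQ n \<alpha>))"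

declare QQ.simps [simp del]

definition X :: "nat \<Rightarrow> 'r \<Rightarrow> 'r qtorus" where "X n \<alpha> = vp (QQ n) (- (C *v axis \<alpha> 1))"

definition u :: "nat \<Rightarrow> 'r \<Rightarrow> 'r qtorus" where
  "u n \<alpha> = (- lm \<alpha> \<alpha>) \<triangleright> QQ (Suc n) \<alpha> ^ 2 * rinv (QQ n \<alpha>)"

lemma QQ_step: "QQ (Suc (Suc n)) \<alpha> = (1 - X (Suc n) \<alpha>) * u n \<alpha>"
  by (simp add: X_def u_def QQ.simps)

text \<open>This is the leading exponent of \<open>X n \<alpha>\<close> when each
  \<open>QQ n \<beta>\<close> leads like the \<open>n\<close>-th power of
  \<open>QQ 1 \<beta>\<close>: the matrix cancels its inverse, and \<open>X n \<alpha>\<close> leads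
  like the \<open>n\<close>-th power of \<open>x_\<alpha>\<close>.\<close>

lemma civ_sum: "(\<Sum>\<beta>\<in>UNIV. of_int ((- (C *v axis \<alpha> 1)) $ \<beta>) *s (- (of_nat n *s civ \<beta>))) = of_nat n *s axis \<alpha> 1"
  unfolding vec_eq_iff
proof
  fix \<gamma>
  have "(\<Sum>\<beta>\<in>UNIV. of_int ((- (C *v axis \<alpha> 1)) $ \<beta>) *s (- (of_nat n *s civ \<beta>))) $ \<gamma> =
      of_nat n * (\<Sum>\<beta>\<in>UNIV. ci $ \<gamma> $ \<beta> * of_int (C $ \<beta> $ \<alpha>))"
    by (simp add: C_axis civ_def sum_distrib_left mult_ac)
  then show "(\<Sum>\<beta>\<in>UNIV. of_int ((- (C *v axis \<alpha> 1)) $ \<beta>) *s (- (of_nat n *s civ \<beta>))) $ \<gamma> = (of_nat n *s axis \<alpha> 1) $ \<gamma>"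
    by (simp add: ci_cq axis_def)
qed

text \<open>Linear growth of the exponents is consistent with the recursion since
  \<open>2 * (k + 1) - k = k + 2\<close>. The factor \<open>1 - X (Suc k) \<alpha>\<close> lies in
  \<open>inU\<close> because \<open>X (Suc k) \<alpha>\<close> has order at least 1.\<close>

lemma lead_QQ: "lead (- (of_nat n *s civ \<alpha>)) (QQ n \<alpha>)"
proof (induction n arbitrary: \<alpha> rule: less_induct)
  case (less n)
  show ?case
  proof (cases "(n, \<alpha>)" rule: QQ.cases)
    case (3 k \<beta>)
    have IH: "lead (- (of_nat (Suc k) *s civ \<beta>)) (QQ (Suc k) \<beta>)" "lead (- (of_nat k *s civ \<beta>)) (QQ k \<beta>)" for \<beta>
      using 3 less[of "Suc k" \<beta>] less[of k \<beta>] by (simp_all del: of_nat_Suc)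
    have "lead (\<Sum>\<beta>\<in>UNIV. of_int ((- (C *v axis \<alpha> 1)) $ \<beta>) *s (- (of_nat (Suc k) *s civ \<beta>))) (X (Suc k) \<alpha>)"
      unfolding X_def by (intro lead_vp IH)
    then have X: "lead (of_nat (Suc k) *s axis \<alpha> 1) (X (Suc k) \<alpha>)"
      unfolding civ_sum .
    have "deg (of_nat (Suc k) *s axis \<alpha> 1) = of_nat (Suc k)"
      by (simp add: deg_def axis_def if_distrib cong: if_cong)
    then have "hi 1 (X (Suc k) \<alpha>)"
      using lead_hi[OF X] by (auto intro: hi_mono)
    moreover have "pw (X (Suc k) \<alpha>)"
      by (rule lead_pw[OF X]) (auto simp: nvec_def axis_def)
    ultimately have "lead 0 (1 - X (Suc k) \<alpha>)"
      by (intro lead_inU inU_diff)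
    then have "lead (0 + (of_nat 2 *s (- (of_nat (Suc k) *s civ \<alpha>)) + - (- (of_nat k *s civ \<alpha>)))) (QQ (Suc (Suc k)) \<alpha>)"
      unfolding QQ_step u_def by (intro lead_mult lead_tm lead_inverse lead_power IH)
    moreover have "0 + (of_nat 2 *s (- (of_nat (Suc k) *s civ \<alpha>)) + - (- (of_nat k *s civ \<alpha>))) = - (of_nat (Suc (Suc k)) *s civ \<alpha>)"
      by (simp add: vec_eq_iff algebra_simps)
    ultimately show ?thesis using 3 by simp
  qed (auto simp: QQ.simps intro: lead_qmon)
qed

lemma invble_QQ [simp]: "invble (QQ n \<alpha>)"
  using lead_inverse lead_QQ by blast

lemma lead_X: "lead (of_nat n *s axis \<alpha> 1) (X n \<alpha>)"
proof -
  have "lead (\<Sum>\<beta>\<in>UNIV. of_int ((- (C *v axis \<alpha> 1)) $ \<beta>) *s (- (of_nat n *s civ \<beta>))) (X n \<alpha>)"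
    unfolding X_def by (intro lead_vp lead_QQ)
  then show ?thesis unfolding civ_sum .
qed

lemma hi_X: "hi (of_nat n) (X n \<alpha>)"
proof -
  have "deg (of_nat n *s axis \<alpha> 1) = of_nat n"
    by (simp add: deg_def axis_def if_distrib cong: if_cong)
  then show ?thesis using lead_hi[OF lead_X, of n \<alpha>] by simp
qed

lemma pw_X: "pw (X n \<alpha>)"
  by (rule lead_pw[OF lead_X]) (auto simp: nvec_def axis_def)

lemma hi1_X: "hi 1 (X (Suc n) \<alpha>)"
  using hi_X[of "Suc n" \<alpha>] by (auto intro: hi_mono)

lemma inU_X: "inU (1 - X (Suc n) \<alpha>)"
  by (intro inU_diff pw_X hi1_X)

lemma invble_1X [simp]: "invble (1 - X (Suc n) \<alpha>)"
  using inU_X by (rule inU_inverse)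

lemma invble_u [simp]: "invble (u n \<alpha>)"
  by (simp add: u_def)

text \<open>The three statements support each other and pass together to the next pair of levels.
  The Cartan matrix enters in \<open>nX\<close>: by \<open>\<lambda> C = \<delta>\<close>,
  \<open>QQ n \<alpha>\<close> commutes with \<open>X (Suc n) \<beta>\<close> for
  \<open>\<alpha> \<noteq> \<beta>\<close>. For \<open>\<alpha> = \<beta>\<close> commutation within
  the new level is trivial.\<close>

lemma QQ_comm:
  "(\<forall>\<alpha> \<beta>. QQ n \<alpha> * QQ n \<beta> = QQ n \<beta> * QQ n \<alpha>) \<and>
   (\<forall>\<alpha> \<beta>. QQ (Suc n) \<alpha> * QQ (Suc n) \<beta> = QQ (Suc n) \<beta> * QQ (Suc n) \<alpha>) \<and>
   (\<forall>\<alpha> \<beta>. qcomm (lm \<alpha> \<beta>) (QQ n \<alpha>) (QQ (Suc n) \<beta>))"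
proof (induction n)
  case 0
  have "QQ 0 \<alpha> * QQ 0 \<beta> = QQ 0 \<beta> * QQ 0 \<alpha>" for \<alpha> \<beta>
    by (simp add: QQ.simps qmon_mult tw_def add.commute)
  moreover have "QQ (Suc 0) \<alpha> * QQ (Suc 0) \<beta> = QQ (Suc 0) \<beta> * QQ (Suc 0) \<alpha>" for \<alpha> \<beta>
    by (simp add: QQ.simps qmon_mult tw_def add.commute)
  moreover have "qcomm (lm \<alpha> \<beta>) (QQ 0 \<alpha>) (QQ (Suc 0) \<beta>)" for \<alpha> \<beta>
  proof -
    have "tw (0, - civ \<beta>) (axis \<alpha> dl, 0) = - lm \<alpha> \<beta>"
      by (simp add: tw_def axis_def civ_def lm_ci sum_negf if_distrib[of "\<lambda>x. _ * x"] cong: if_cong)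
    moreover have "tw (axis \<alpha> dl, 0) (0, - civ \<beta>) = 0"
      by (simp add: tw_def)
    ultimately show ?thesis
      by (simp add: QQ.simps qcomm_def qmon_mult tm_def sc_def flip: tpow_add)
  qed
  ultimately show ?case by blast
next
  case (Suc n)
  then have c0: "QQ n \<alpha> * QQ n \<beta> = QQ n \<beta> * QQ n \<alpha>"
    and c1: "QQ (Suc n) \<alpha> * QQ (Suc n) \<beta> = QQ (Suc n) \<beta> * QQ (Suc n) \<alpha>"
    and q: "qcomm (lm \<alpha> \<beta>) (QQ n \<alpha>) (QQ (Suc n) \<beta>)" for \<alpha> \<beta>
    by blast+
  have q': "qcomm (- lm \<alpha> \<beta>) (QQ (Suc n) \<alpha>) (QQ n \<beta>)" for \<alpha> \<beta>
    using qcomm_sym[OF q[of \<beta> \<alpha>]] by (simp add: lm_sym)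
  have cX: "qcomm 0 (QQ (Suc n) \<alpha>) (X (Suc n) \<beta>)" for \<alpha> \<beta>
    using qcomm_vp[of "\<lambda>_. 0" "QQ (Suc n) \<alpha>" "QQ (Suc n)"] c1 by (simp add: X_def qcomm_0)
  have nX: "qcomm (if \<alpha> = \<beta> then - dl else 0) (QQ n \<alpha>) (X (Suc n) \<beta>)" for \<alpha> \<beta>
  proof -
    have "(\<Sum>\<gamma>\<in>UNIV. of_int ((- (C *v axis \<beta> 1)) $ \<gamma>) * lm \<alpha> \<gamma>) = (if \<alpha> = \<beta> then - dl else 0)"
      using lm_C[of \<alpha> \<beta>] by (simp add: C_axis sum_negf mult.commute)
    then show ?thesis
      using qcomm_vp[of "lm \<alpha>" "QQ n \<alpha>" "QQ (Suc n)" "- (C *v axis \<beta> 1)"] q by (simp add: X_def)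
  qed
  have XX: "qcomm 0 (X (Suc n) \<alpha>) (X (Suc n) \<beta>)" for \<alpha> \<beta>
  proof -
    have "cfam (QQ (Suc n))" using c1 by (simp add: cfam_def)
    then show ?thesis unfolding X_def qcomm_0 by (rule vp_commute)
  qed
  have Qu: "qcomm (lm \<alpha> \<beta>) (QQ (Suc n) \<alpha>) (u n \<beta>)" for \<alpha> \<beta>
  proof -
    have "qcomm (of_nat 2 * 0 + - (- lm \<alpha> \<beta>)) (QQ (Suc n) \<alpha>) (QQ (Suc n) \<beta> ^ 2 * rinv (QQ n \<beta>))"
      using c1 by (intro qcomm_mult_right qcomm_power qcomm_rinv_right q') (simp_all add: qcomm_0)
    then show ?thesis unfolding u_def by (intro qcomm_tm) simp
  qed
  have 1: "qcomm (lm \<alpha> \<beta>) (QQ (Suc n) \<alpha>) (QQ (Suc (Suc n)) \<beta>)" for \<alpha> \<beta>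
  proof -
    have "qcomm (0 + lm \<alpha> \<beta>) (QQ (Suc n) \<alpha>) ((1 - X (Suc n) \<beta>) * u n \<beta>)"
      by (intro qcomm_mult_right qcomm_diff qcomm_1 cX Qu)
    then show ?thesis unfolding QQ_step by simp
  qed
  have uX: "qcomm 0 (u n \<alpha>) (X (Suc n) \<beta>)" if "\<alpha> \<noteq> \<beta>" for \<alpha> \<beta>
  proof -
    have "qcomm 0 (X (Suc n) \<beta>) (QQ n \<alpha>)" using qcomm_sym[OF nX[of \<alpha> \<beta>]] that by simp
    then have "qcomm (of_nat 2 * - 0 + - 0) (X (Suc n) \<beta>) (QQ (Suc n) \<alpha> ^ 2 * rinv (QQ n \<alpha>))"
      by (intro qcomm_mult_right qcomm_power qcomm_rinv_right qcomm_sym[OF cX]) simp_all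
    then have "qcomm 0 (X (Suc n) \<beta>) (u n \<alpha>)" unfolding u_def by (intro qcomm_tm) simp
    then show ?thesis using qcomm_sym by fastforce
  qed
  have uu: "qcomm 0 (u n \<alpha>) (u n \<beta>)" for \<alpha> \<beta>
  proof -
    have "qcomm (of_nat 2 * lm \<alpha> \<beta> + - 0) (QQ n \<alpha>) (QQ (Suc n) \<beta> ^ 2 * rinv (QQ n \<beta>))"
      using c0 by (intro qcomm_mult_right qcomm_power qcomm_rinv_right q) (simp_all add: qcomm_0)
    then have "qcomm (- (of_nat 2 * lm \<alpha> \<beta>)) (rinv (QQ n \<alpha>)) (u n \<beta>)"
      unfolding u_def by (intro qcomm_rinv_left qcomm_tm) simp_all
    from qcomm_mult_right[OF qcomm_power[OF qcomm_sym[OF Qu[of \<alpha> \<beta>]], of 2] qcomm_sym[OF this]]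
    have "qcomm 0 (u n \<beta>) (QQ (Suc n) \<alpha> ^ 2 * rinv (QQ n \<alpha>))" by simp
    then have "qcomm 0 (u n \<beta>) (u n \<alpha>)" unfolding u_def[of n \<alpha>] by (intro qcomm_tm)
    then show ?thesis using qcomm_sym by fastforce
  qed
  have 2: "QQ (Suc (Suc n)) \<alpha> * QQ (Suc (Suc n)) \<beta> = QQ (Suc (Suc n)) \<beta> * QQ (Suc (Suc n)) \<alpha>" for \<alpha> \<beta>
  proof (cases "\<alpha> = \<beta>")
    case False
    have a: "qcomm (0 + 0) (u n \<alpha>) ((1 - X (Suc n) \<beta>) * u n \<beta>)"
      using False by (intro qcomm_mult_right qcomm_diff qcomm_1 uX uu)
    have "qcomm 0 (u n \<beta>) (X (Suc n) \<alpha>)" using False by (intro uX) simp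
    then have "qcomm 0 (X (Suc n) \<alpha>) (u n \<beta>)" using qcomm_sym by fastforce
    then have "qcomm (0 + 0) (X (Suc n) \<alpha>) ((1 - X (Suc n) \<beta>) * u n \<beta>)"
      by (intro qcomm_mult_right qcomm_diff qcomm_1 XX)
    then have b: "qcomm (- (0 + 0)) ((1 - X (Suc n) \<beta>) * u n \<beta>) (1 - X (Suc n) \<alpha>)"
      by (intro qcomm_diff) (use qcomm_1 qcomm_sym in fastforce)+
    have "qcomm (- (0 + 0) + - (0 + 0)) ((1 - X (Suc n) \<beta>) * u n \<beta>) ((1 - X (Suc n) \<alpha>) * u n \<alpha>)"
      by (intro qcomm_mult_right qcomm_sym[OF a] b)
    then show ?thesis unfolding QQ_step by (simp add: qcomm_0)
  qed simp
  from c1 1 2 show ?case by blast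
qed

lemma cfam_QQ [simp]: "cfam (QQ n)"
  using QQ_comm by (auto simp: cfam_def)

lemma qcomm_QQ: "qcomm (lm \<alpha> \<beta>) (QQ n \<alpha>) (QQ (Suc n) \<beta>)"
  using QQ_comm by blast

end

subsection \<open>Positivity after evaluation\<close>

lemma finite_slice: "finite {a. cf f (a, y) \<noteq> 0}"
  using tame_cf[of f] by (simp add: tame_def supp_def)

definition ev :: "('r::finite) qtorus \<Rightarrow> (rat, 'r) vec \<Rightarrow> scalar" where
  "ev f y = (\<Sum>a\<in>{a. cf f (a, y) \<noteq> 0}. cf f (a, y))"

lemma ev_eval: "finite A \<Longrightarrow> {a. cf f (a, y) \<noteq> 0} \<subseteq> A \<Longrightarrow> ev f y = (\<Sum>a\<in>A. cf f (a, y))"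
  unfolding ev_def by (rule sum.mono_neutral_left) auto

lemma ev_add: "ev (f + g) y = ev f y + ev g y"
  and ev_diff: "ev (f - g) y = ev f y - ev g y"
proof -
  let ?A = "{a. cf f (a, y) \<noteq> 0} \<union> {a. cf g (a, y) \<noteq> 0}"
  have A: "finite ?A" by (simp add: finite_slice)
  have "ev (f + g) y = (\<Sum>a\<in>?A. cf (f + g) (a, y))" "ev (f - g) y = (\<Sum>a\<in>?A. cf (f - g) (a, y))"
    "ev f y = (\<Sum>a\<in>?A. cf f (a, y))" "ev g y = (\<Sum>a\<in>?A. cf g (a, y))"
    by (rule ev_eval[OF A]; auto)+
  then show "ev (f + g) y = ev f y + ev g y" "ev (f - g) y = ev f y - ev g y"
    by (simp_all add: sum.distrib sum_subtractf)
qed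

lemma ev_0 [simp]: "ev 0 y = 0"
  by (simp add: ev_def)

lemma ev_sum: "ev (sum f A) y = (\<Sum>i\<in>A. ev (f i) y)"
  by (induction A rule: infinite_finite_induct) (simp_all add: ev_add)

lemma ev_sc: "ev (sc c * f) y = c * ev f y"
proof -
  have "ev (sc c * f) y = (\<Sum>a\<in>{a. cf f (a, y) \<noteq> 0}. cf (sc c * f) (a, y))"
    by (rule ev_eval) (auto simp: finite_slice cf_sc_mult)
  then show ?thesis by (simp add: ev_def cf_sc_mult sum_distrib_left)
qed

lemma ev_tm: "ev (e \<triangleright> f) y = tpow e * ev f y"
  by (simp add: tm_def ev_sc)

lemma ev_qmon: "ev (qmon c (a, y')) y = (if y = y' then c else 0)"
proof -
  have "ev (qmon c (a, y')) y = (\<Sum>b\<in>{a}. cf (qmon c (a, y')) (b, y))"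
    by (rule ev_eval) (auto simp: cf_qmon split: if_splits)
  then show ?thesis by (simp add: cf_qmon)
qed

lemma flim_ev: "flim F f \<Longrightarrow> \<forall>\<^sub>F k in sequentially. ev (F k) y = ev f y"
  by (drule flim_eventually[where y = y], erule eventually_mono) (simp add: ev_def)

text \<open>
  Evaluation at \<open>Q\<^sub>0 = 1\<close> turns right multiplication by \<open>g\<close> into an operation on the evaluated series alone.
\<close>

lemma ev_mult:
  "\<exists>Y. finite Y \<and> ev (f * g) y = (\<Sum>y1\<in>Y. ev f y1 * ev (qmon 1 (0, y1) * g) y)"
proof -
  define Y where "Y = {y1. \<exists>a a'. (a, y1) \<in> supp (cf f) \<and> (a', y - y1) \<in> supp (cf g)}"
  have Y: "finite Y" unfolding Y_def by (rule tame_snd_finite) (rule tame_cf)+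
  define A1 where "A1 = (\<Union>y1\<in>Y. {a. cf f (a, y1) \<noteq> 0})"
  define A2 where "A2 = (\<Union>y1\<in>Y. {a. cf g (a, y - y1) \<noteq> 0})"
  define A where "A = (\<lambda>(a, b). a + b) ` (A1 \<times> A2)"
  have fin: "finite A1" "finite A2" "finite A"
    using Y by (auto simp: A1_def A2_def A_def finite_slice)
  have S: "cf (f * g) (a, y) = (\<Sum>(a1, y1)\<in>A1 \<times> Y. cf f (a1, y1) * cf g (a - a1, y - y1) * tpow (tw (a1, y1) (a - a1, y - y1)))" for a
  proof -
    have "cf (f * g) (a, y) = (\<Sum>s\<in>A1 \<times> Y. cf f s * cf g ((a, y) - s) * tpow (tw s ((a, y) - s)))"
      unfolding cf_mult
    proof (rule conv_eval)
      show "{s \<in> supp (cf f). (a, y) - s \<in> supp (cf g)} \<subseteq> A1 \<times> Y"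
      proof clarify
        fix a1 y1 assume *: "(a1, y1) \<in> supp (cf f)" "(a, y) - (a1, y1) \<in> supp (cf g)"
        then have "y1 \<in> Y" unfolding Y_def by auto
        with * show "a1 \<in> A1 \<and> y1 \<in> Y" by (auto simp: A1_def supp_def)
      qed
    qed (use fin Y in simp)
    then show ?thesis by (simp add: case_prod_unfold) (simp add: minus_prod_def)
  qed
  have "ev (f * g) y = (\<Sum>a\<in>A. cf (f * g) (a, y))"
  proof (rule ev_eval[OF fin(3)], clarify, rule ccontr)
    fix a assume a: "cf (f * g) (a, y) \<noteq> 0" "a \<notin> A"
    have "cf (f * g) (a, y) = 0"
      unfolding S
    proof (rule sum.neutral, clarify)
      fix a1 y1 assume "a1 \<in> A1" "y1 \<in> Y"
      then have "cf g (a - a1, y - y1) = 0"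
        using a(2) by (auto simp: A_def A2_def image_iff) (metis diff_add_cancel add.commute)
      then show "cf f (a1, y1) * cf g (a - a1, y - y1) * tpow (tw (a1, y1) (a - a1, y - y1)) = 0" by simp
    qed
    with a show False by simp
  qed
  also have "\<dots> = (\<Sum>(a1, y1)\<in>A1 \<times> Y. \<Sum>a\<in>A. cf f (a1, y1) * cf g (a - a1, y - y1) * tpow (tw (a1, y1) (a - a1, y - y1)))"
    unfolding S by (subst sum.swap) (simp add: case_prod_unfold)
  also have "\<dots> = (\<Sum>(a1, y1)\<in>A1 \<times> Y. cf f (a1, y1) * ev (qmon 1 (0, y1) * g) y)"
  proof (rule sum.cong[OF refl], clarify)
    fix a1 y1 assume 1: "a1 \<in> A1" "y1 \<in> Y"
    let ?h = "\<lambda>a. cf g (a, y - y1) * tpow (tw (0, y1) (a, y - y1))"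
    \<comment> \<open>The twist reads the second coordinate of the left factor and the first of the
      right one. Hence \<open>a1\<close> acts only as a translation of the summation index, which
      the sum over \<open>a\<close> absorbs.\<close>
    have "(\<Sum>a\<in>A. cf f (a1, y1) * cf g (a - a1, y - y1) * tpow (tw (a1, y1) (a - a1, y - y1))) =
        cf f (a1, y1) * (\<Sum>a\<in>A. ?h (a - a1))"
      by (simp add: sum_distrib_left mult.assoc tw_def)
    also have "(\<Sum>a\<in>A. ?h (a - a1)) = (\<Sum>a\<in>(+) a1 ` A2. ?h (a - a1))"
    proof (rule sum.mono_neutral_right[OF fin(3)])
      show "(+) a1 ` A2 \<subseteq> A" using 1 by (auto simp: A_def)
      show "\<forall>a\<in>A - (+) a1 ` A2. ?h (a - a1) = 0"
      proof
        fix a assume "a \<in> A - (+) a1 ` A2"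
        then have "a - a1 \<notin> A2" by (auto simp: image_iff)
        then show "?h (a - a1) = 0" using 1 by (auto simp: A2_def)
      qed
    qed
    also have "\<dots> = (\<Sum>a\<in>A2. ?h a)"
      by (subst sum.reindex) (auto simp: inj_on_def)
    also have "\<dots> = (\<Sum>a\<in>A2. cf (qmon 1 (0, y1) * g) (a, y))"
      by (simp add: cf_qmon_mult)
    also have "\<dots> = ev (qmon 1 (0, y1) * g) y"
      by (rule ev_eval[symmetric, OF fin(2)]) (use 1 in \<open>auto simp: cf_qmon_mult A2_def\<close>)
    finally show "(\<Sum>a\<in>A. cf f (a1, y1) * cf g (a - a1, y - y1) * tpow (tw (a1, y1) (a - a1, y - y1))) =
        cf f (a1, y1) * ev (qmon 1 (0, y1) * g) y" .
  qed
  also have "\<dots> = (\<Sum>y1\<in>Y. \<Sum>a1\<in>A1. cf f (a1, y1) * ev (qmon 1 (0, y1) * g) y)"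
    by (subst sum.swap) (simp add: sum.cartesian_product)
  also have "\<dots> = (\<Sum>y1\<in>Y. ev f y1 * ev (qmon 1 (0, y1) * g) y)"
  proof (rule sum.cong[OF refl])
    fix y1 assume "y1 \<in> Y"
    then have "ev f y1 = (\<Sum>a1\<in>A1. cf f (a1, y1))"
      by (intro ev_eval fin) (auto simp: A1_def)
    then show "(\<Sum>a1\<in>A1. cf f (a1, y1) * ev (qmon 1 (0, y1) * g) y) = ev f y1 * ev (qmon 1 (0, y1) * g) y"
      by (simp add: sum_distrib_right)
  qed
  finally show ?thesis using Y by blast
qed

text \<open>Turns ordered monomials in the initial variables into single \<open>qmon\<close>: within
  level 0, and within level 1, the twist vanishes and \<open>qmon\<close> is a homomorphism in the
  exponent.\<close>

lemma vp_hom: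
  fixes h :: "(rat, 'r::{finite,linorder}) vec \<Rightarrow> 'a::monoid_mult" and v :: "'r \<Rightarrow> (rat, 'r) vec"
  assumes add: "\<And>a b. h (a + b) = h a * h b" and zero: "h 0 = 1"
  shows "vp (\<lambda>\<beta>. h (v \<beta>)) w = h (\<Sum>\<beta>\<in>UNIV. of_int (w $ \<beta>) *s v \<beta>)"
proof -
  have p: "h a ^ k = h (of_nat k *s a)" for a k
  proof (induction k)
    case (Suc k)
    have "a + of_nat k *s a = of_nat (Suc k) *s a" by (simp add: vec_eq_iff algebra_simps)
    with Suc show ?case by (simp flip: add)
  qed (simp add: zero)
  have r: "rinv (h a) = h (- a)" for a
    by (rule rinv_eqI) (simp_all add: zero flip: add)
  have i: "ipow (h a) z = h (of_int z *s a)" for a z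
  proof (cases "z < 0")
    case True
    have "- (of_nat (nat (- z)) *s a) = of_int z *s a"
      using True by (simp add: vec_eq_iff of_nat_nat)
    with True show ?thesis by (simp add: ipow_def p r)
  qed (simp add: ipow_def p of_nat_nat)
  have l: "prod_list (map (\<lambda>\<beta>. h (f \<beta>)) xs) = h (sum_list (map f xs))" for xs and f :: "'r \<Rightarrow> (rat, 'r) vec"
    by (induction xs) (simp_all add: add zero)
  show ?thesis unfolding vp_def i l sum_list_enumr ..
qed

context cartan
begin

text \<open>
  With the Weyl normalization the product of two monomials only produces half of the symplectic pairing.
\<close>

definition E :: "nat \<Rightarrow> 'r ivector \<Rightarrow> 'r ivector \<Rightarrow> 'r qtorus" where
  "E n a b = (- (lf a b / 2)) \<triangleright> vp (QQ n) a * vp (QQ (Suc n)) b"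

lemma qcomm_vp_vp: "qcomm (lf a b) (vp (QQ n) a) (vp (QQ (Suc n)) b)"
proof -
  have "qcomm (\<Sum>\<beta>\<in>UNIV. of_int (a $ \<beta>) * - lm \<beta> \<gamma>) (QQ (Suc n) \<gamma>) (vp (QQ n) a)" for \<gamma>
    by (intro qcomm_vp qcomm_sym[OF qcomm_QQ] invble_QQ)
  then have "qcomm (\<Sum>\<beta>\<in>UNIV. of_int (a $ \<beta>) * lm \<beta> \<gamma>) (vp (QQ n) a) (QQ (Suc n) \<gamma>)" for \<gamma>
    using qcomm_sym by (fastforce simp: sum_negf)
  then have "qcomm (\<Sum>\<gamma>\<in>UNIV. of_int (b $ \<gamma>) * (\<Sum>\<beta>\<in>UNIV. of_int (a $ \<beta>) * lm \<beta> \<gamma>)) (vp (QQ n) a) (vp (QQ (Suc n)) b)"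
    by (intro qcomm_vp invble_QQ)
  moreover have "(\<Sum>\<gamma>\<in>UNIV. of_int (b $ \<gamma>) * (\<Sum>\<beta>\<in>UNIV. of_int (a $ \<beta>) * lm \<beta> \<gamma>)) = lf a b"
    unfolding lf_def sum_distrib_left by (subst sum.swap) (simp add: mult_ac)
  ultimately show ?thesis by simp
qed

lemma vp_swap: "vp (QQ (Suc n)) b * vp (QQ n) a = (- lf a b) \<triangleright> vp (QQ n) a * vp (QQ (Suc n)) b"
  using qcomm_vp_vp[of a b n] by (simp add: qcomm_def)

lemma E_mult: "E n a b * E n a' b' = ((lf a b' - lf a' b) / 2) \<triangleright> E n (a + a') (b + b')"
proof -
  have "E n a b * E n a' b' = (- (lf a' b' / 2) - lf a b / 2) \<triangleright>
      vp (QQ n) a * (vp (QQ (Suc n)) b * vp (QQ n) a') * vp (QQ (Suc n)) b'"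
    by (simp add: E_def mult.assoc)
  also have "\<dots> = (- (lf a' b' / 2) - lf a b / 2 - lf a' b) \<triangleright>
      (vp (QQ n) a * vp (QQ n) a') * (vp (QQ (Suc n)) b * vp (QQ (Suc n)) b')"
    by (simp add: vp_swap mult.assoc)
  also have "\<dots> = ((lf a b' - lf a' b) / 2) \<triangleright> E n (a + a') (b + b')"
  proof -
    have "- (lf a' b' / 2) - lf a b / 2 - lf a' b = (lf a b' - lf a' b) / 2 - lf (a + a') (b + b') / 2"
      by (simp add: lf_add field_simps)
    then show ?thesis by (simp add: E_def vp_add)
  qed
  finally show ?thesis .
qed

lemma E_0_left: "E n 0 b = vp (QQ (Suc n)) b" and E_0_right: "E n a 0 = vp (QQ n) a"
  by (simp_all add: E_def)

lemma qcomm_E: "qcomm (lf a b' - lf a' b) (E n a b) (E n a' b')"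
  unfolding qcomm_def E_mult by (simp add: add.commute diff_divide_distrib)

lemma lf_C_axis: "lf a (C *v axis \<beta> 1) = dl * of_int (a $ \<beta>)"
  by (simp add: lf_C dot_axis)

lemma lf_axis_C: "lf (axis \<alpha> 1) (C *v axis \<beta> 1) = (if \<alpha> = \<beta> then dl else 0)"
  by (simp add: lf_C_axis) (simp add: axis_def)

lemma E_Suc: "E n 0 (axis \<alpha> 1) = QQ (Suc n) \<alpha>" and E_at: "E n (axis \<alpha> 1) 0 = QQ n \<alpha>"
  by (simp_all add: E_0_left E_0_right vp_axis)

lemma axis_eqs: "2 *s axis \<alpha> 1 = axis \<alpha> (2::int)" "- axis \<alpha> 1 = axis \<alpha> (-1::int)"
  by (simp_all add: vec_eq_iff axis_def)

lemma vp_2: "vp (QQ n) (2 *s axis \<alpha> 1) = QQ n \<alpha> ^ 2"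
  by (simp add: axis_eqs vp_axis ipow_numeral)

text \<open>The power of \<open>t\<close> in the relation is exactly the one of the Weyl
  normalization, so that \<open>u\<close> needs no coefficient when written with
  \<open>E\<close>.\<close>

lemma u_E: "u n \<alpha> = E n (- axis \<alpha> 1) (2 *s axis \<alpha> 1)"
proof -
  have "u n \<alpha> = (- lm \<alpha> \<alpha>) \<triangleright> vp (QQ (Suc n)) (2 *s axis \<alpha> 1) * vp (QQ n) (- axis \<alpha> 1)"
    by (simp add: u_def vp_2 axis_eqs(2) vp_axis ipow_m1)
  also have "\<dots> = (lm \<alpha> \<alpha>) \<triangleright> vp (QQ n) (- axis \<alpha> 1) * vp (QQ (Suc n)) (2 *s axis \<alpha> 1)"
    by (simp add: vp_swap lf_minus lf_scale lf_axis_axis)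
  finally show ?thesis by (simp add: E_def lf_minus lf_scale lf_axis_axis)
qed

lemma X_E: "X (Suc n) \<alpha> = E n 0 (- (C *v axis \<alpha> 1))"
  by (simp add: X_def E_0_left)

lemma E_invble [simp]: "invble (E n a b)"
  by (simp add: E_def)

lemma E_power: "E n a b ^ k = E n (int k *s a) (int k *s b)"
proof (induction k)
  case 0
  show ?case by (simp add: E_def)
next
  case (Suc k)
  have "a + int k *s a = int (Suc k) *s a" for a :: "'r ivector"
    by (simp add: vec_eq_iff algebra_simps)
  with Suc show ?case by (simp add: E_mult lf_scale)
qed

lemma E_rinv: "rinv (E n a b) = E n (- a) (- b)"
  by (rule rinv_eqI) (simp_all add: E_mult lf_minus, simp_all add: E_def)

text \<open>
  The second term on the right-hand side of the Q-system.
\<close>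

definition Y :: "nat \<Rightarrow> 'r \<Rightarrow> 'r qtorus" where
  "Y n \<alpha> = vp (QQ n) (2 *s axis \<alpha> 1 - C *v axis \<alpha> 1)"

lemma Y_X: "Y n \<alpha> = X n \<alpha> * QQ n \<alpha> ^ 2"
  unfolding Y_def X_def vp_2[symmetric] by (simp flip: vp_add)

text \<open>
  The exponent of \<open>Q\<^sub>\<alpha>\<^sub>,\<^sub>1\<close> in a monomial with second coordinate \<open>y\<close> is \<open>- (C y)\<^sub>\<alpha>\<close>.
\<close>

definition pos_exp :: "'r \<Rightarrow> (rat, 'r) vec \<Rightarrow> bool" where
  "pos_exp \<alpha> y \<longleftrightarrow> (\<exists>k. - ((cq *v y) $ \<alpha>) = of_nat (Suc k))"

definition psupp :: "'r \<Rightarrow> 'r qtorus \<Rightarrow> bool" where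
  "psupp \<alpha> f \<longleftrightarrow> (\<forall>y. ev f y \<noteq> 0 \<longrightarrow> pos_exp \<alpha> y)"

text \<open>Right multiplications compose, so these elements are closed under sums, products and
  limits. Inverses have to be treated individually.\<close>

definition keeps :: "'r \<Rightarrow> 'r qtorus \<Rightarrow> bool" where
  "keeps \<alpha> g \<longleftrightarrow> (\<forall>f. psupp \<alpha> f \<longrightarrow> psupp \<alpha> (f * g))"

lemma psupp_add: "psupp \<alpha> f \<Longrightarrow> psupp \<alpha> g \<Longrightarrow> psupp \<alpha> (f + g)"
  and psupp_diff: "psupp \<alpha> f \<Longrightarrow> psupp \<alpha> g \<Longrightarrow> psupp \<alpha> (f - g)"
  and psupp_tm: "psupp \<alpha> f \<Longrightarrow> psupp \<alpha> (e \<triangleright> f)"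
  unfolding psupp_def ev_add ev_diff ev_tm by (metis add.right_neutral, metis diff_zero, metis mult_zero_right)

lemma psupp_flim: assumes "flim F f" "\<And>k. psupp \<alpha> (F k)" shows "psupp \<alpha> f"
  unfolding psupp_def
proof (intro allI impI)
  fix y assume "ev f y \<noteq> 0"
  moreover obtain k where "ev (F k) y = ev f y"
    using flim_ev[OF assms(1), of y] eventually_happens by force
  ultimately show "pos_exp \<alpha> y" using assms(2) by (metis psupp_def)
qed

lemma keeps_1: "keeps \<alpha> 1" and keeps_mult: "keeps \<alpha> f \<Longrightarrow> keeps \<alpha> g \<Longrightarrow> keeps \<alpha> (f * g)"
  and keeps_add: "keeps \<alpha> f \<Longrightarrow> keeps \<alpha> g \<Longrightarrow> keeps \<alpha> (f + g)"
  and keeps_diff: "keeps \<alpha> f \<Longrightarrow> keeps \<alpha> g \<Longrightarrow> keeps \<alpha> (f - g)"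
  and keeps_tm: "keeps \<alpha> f \<Longrightarrow> keeps \<alpha> (e \<triangleright> f)"
  unfolding keeps_def by (auto simp: distrib_left right_diff_distrib psupp_add psupp_diff psupp_tm simp flip: mult.assoc)

lemma keeps_power: "keeps \<alpha> f \<Longrightarrow> keeps \<alpha> (f ^ k)"
  by (induction k) (auto intro: keeps_1 keeps_mult)

lemma keeps_0: "keeps \<alpha> 0" by (simp add: keeps_def psupp_def)

lemma keeps_sum: "(\<And>i. i \<in> A \<Longrightarrow> keeps \<alpha> (f i)) \<Longrightarrow> keeps \<alpha> (sum f A)"
  by (induction A rule: infinite_finite_induct) (auto intro: keeps_0 keeps_add)

lemma keeps_prod_list: "(\<And>i. i \<in> set xs \<Longrightarrow> keeps \<alpha> (f i)) \<Longrightarrow> keeps \<alpha> (prod_list (map f xs))"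
  by (induction xs) (auto intro: keeps_1 keeps_mult)

lemma keeps_flim: "flim F f \<Longrightarrow> (\<And>k. keeps \<alpha> (F k)) \<Longrightarrow> keeps \<alpha> f"
  unfolding keeps_def using psupp_flim flim_mult_left by metis

lemma keeps_rinv_1X: "keeps \<alpha> (X (Suc n) \<beta>) \<Longrightarrow> keeps \<alpha> (rinv (1 - X (Suc n) \<beta>))"
  by (rule keeps_flim[OF flim_rinv[OF pw_X hi1_X]]) (intro keeps_sum keeps_power)

lemma keeps_ipow: "keeps \<alpha> f \<Longrightarrow> invble f \<Longrightarrow> (z < 0 \<Longrightarrow> keeps \<alpha> (rinv f)) \<Longrightarrow> keeps \<alpha> (ipow f z)"
  unfolding ipow_def by (auto simp: rinv_power intro: keeps_power)

text \<open>By \<open>ev_mult\<close> it suffices to test the monomials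
  \<open>qmon 1 (0, y1)\<close> with trivial exponent at level 0.\<close>

lemma keeps_I:
  assumes "\<And>y1 y. pos_exp \<alpha> y1 \<Longrightarrow> ev (qmon 1 (0, y1) * g) y \<noteq> 0 \<Longrightarrow> pos_exp \<alpha> y"
  shows "keeps \<alpha> g"
  unfolding keeps_def psupp_def
proof (intro allI impI)
  fix f y assume f: "\<forall>y. ev f y \<noteq> 0 \<longrightarrow> pos_exp \<alpha> y" and "ev (f * g) y \<noteq> 0"
  moreover obtain Y where "ev (f * g) y = (\<Sum>y1\<in>Y. ev f y1 * ev (qmon 1 (0, y1) * g) y)"
    using ev_mult by blast
  ultimately obtain y1 where "ev f y1 * ev (qmon 1 (0, y1) * g) y \<noteq> 0"
    by (metis (no_types, lifting) sum.neutral)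
  then show "pos_exp \<alpha> y" using f assms by (metis mult_zero_left mult_zero_right)
qed

lemma pos_exp_add: assumes "pos_exp \<alpha> y" "- ((cq *v y') $ \<alpha>) = of_nat k" shows "pos_exp \<alpha> (y + y')"
proof -
  obtain j where "- ((cq *v y) $ \<alpha>) = of_nat (Suc j)" using assms(1) by (auto simp: pos_exp_def)
  then have "- ((cq *v (y + y')) $ \<alpha>) = of_nat (Suc (j + k))"
    using assms(2) by (simp add: matrix_vector_right_distrib)
  then show ?thesis unfolding pos_exp_def by blast
qed

lemma keeps_qmon: assumes "- ((cq *v y) $ \<alpha>) = of_nat k" shows "keeps \<alpha> (qmon 1 (a, y))"
proof (rule keeps_I)
  fix y1 y2 assume "pos_exp \<alpha> y1" and *: "ev (qmon 1 (0, y1) * qmon 1 (a, y)) y2 \<noteq> 0"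
  moreover have "y2 = y1 + y" using * by (simp add: qmon_mult ev_qmon split: if_splits)
  ultimately show "pos_exp \<alpha> y2" using pos_exp_add assms by blast
qed

lemma cq_civ: "(cq *v civ \<beta>) $ \<alpha> = (if \<alpha> = \<beta> then 1 else 0)"
  by (simp add: matrix_vector_mult_def civ_def cq_ci)

lemma cq_minus: "(cq *v (- y)) $ \<alpha> = - (cq *v y) $ \<alpha>"
  by (simp add: matrix_vector_mult_def sum_negf)

lemma keeps_base:
  "keeps \<alpha> (QQ 0 \<beta>)" "keeps \<alpha> (rinv (QQ 0 \<beta>))" "keeps \<alpha> (QQ (Suc 0) \<beta>)" "\<beta> \<noteq> \<alpha> \<Longrightarrow> keeps \<alpha> (rinv (QQ (Suc 0) \<beta>))"
proof -
  show "keeps \<alpha> (QQ 0 \<beta>)" by (simp add: QQ.simps, rule keeps_qmon[of _ _ 0]) simp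
  show "keeps \<alpha> (rinv (QQ 0 \<beta>))"
    by (simp add: QQ.simps rinv_qmon, intro keeps_tm keeps_qmon[of _ _ 0]) simp
  show "keeps \<alpha> (QQ (Suc 0) \<beta>)"
    by (simp add: QQ.simps, rule keeps_qmon[of _ _ "if \<alpha> = \<beta> then 1 else 0"]) (simp add: cq_minus cq_civ)
  show "keeps \<alpha> (rinv (QQ (Suc 0) \<beta>))" if "\<beta> \<noteq> \<alpha>"
    by (simp add: QQ.simps rinv_qmon, intro keeps_tm keeps_qmon[of _ _ 0]) (use that in \<open>simp add: cq_civ\<close>)
qed

lemma vp_QQ0: "vp (QQ 0) w = qmon 1 (\<chi> \<beta>. dl * of_int (w $ \<beta>), 0)"
proof -
  have "vp (QQ 0) w = qmon 1 (\<Sum>\<beta>\<in>UNIV. of_int (w $ \<beta>) *s axis \<beta> dl, 0)"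
    using vp_hom[of "\<lambda>a. qmon 1 (a, 0)" "\<lambda>\<beta>. axis \<beta> dl" w]
    by (simp add: QQ.simps qmon_mult tw_def qmon_1 vp_def flip: zero_prod_def)
  moreover have "(\<Sum>\<beta>\<in>UNIV. of_int (w $ \<beta>) *s axis \<beta> dl) = (\<chi> \<beta>. dl * of_int (w $ \<beta>))"
    by (simp add: vec_eq_iff axis_def if_distrib[of "\<lambda>x. _ * x"] mult.commute cong: if_cong)
  ultimately show ?thesis by simp
qed

text \<open>The second coordinate of the monomial with exponents \<open>b\<close> at level 1: minus
  the inverse Cartan matrix applied to \<open>b\<close>.\<close>

definition yb :: "'r ivector \<Rightarrow> (rat, 'r) vec" where
  "yb b = (\<Sum>\<beta>\<in>UNIV. of_int (b $ \<beta>) *s - civ \<beta>)"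

lemma vp_QQ1: "vp (QQ (Suc 0)) w = qmon 1 (0, yb w)"
  using vp_hom[of "\<lambda>y. qmon 1 (0, y)" "\<lambda>\<beta>. - civ \<beta>" w]
  by (simp add: yb_def QQ.simps qmon_mult tw_def qmon_1 vp_def flip: zero_prod_def)

text \<open>
  This is \<open>Q\<^sub>\<alpha>\<^sub>,\<^sub>-\<^sub>1\<close>, which maps \<open>Q\<^sub>\<alpha>\<^sub>,\<^sub>1\<close> to 0 at \<open>Q\<^sub>0 = 1\<close>.
\<close>

definition Qm1 :: "'r \<Rightarrow> 'r qtorus" where
  "Qm1 \<alpha> = ((lm \<alpha> \<alpha> \<triangleright> QQ 0 \<alpha> ^ 2) - (lm \<alpha> \<alpha> - dl) \<triangleright> Y 0 \<alpha>) * rinv (QQ (Suc 0) \<alpha>)"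

text \<open>Multiplication by \<open>Qm1 \<alpha>\<close> lowers the exponent of
  \<open>Q\<^sub>\<alpha>\<^sub>,\<^sub>1\<close> by 1, which is dangerous only for the exponent 1.
  There the two terms cancel after evaluation: moving the monomial past them produces exponents of
  \<open>t\<close> that differ by \<open>dl\<close> times its exponent, which makes up for the
  \<open>- dl\<close> in the coefficient of \<open>Y 0 \<alpha>\<close>.\<close>

lemma keeps_Qm1: "keeps \<alpha> (Qm1 \<alpha>)"
proof (rule keeps_I)
  fix y1 y assume b: "pos_exp \<alpha> y1" and nz: "ev (qmon 1 (0, y1) * Qm1 \<alpha>) y \<noteq> 0"
  define a1 where "a1 = (\<chi> \<beta>. dl * of_int ((2 *s axis \<alpha> 1 :: 'r ivector) $ \<beta>))"
  define a2 where "a2 = (\<chi> \<beta>. dl * of_int ((2 *s axis \<alpha> 1 - C *v axis \<alpha> 1) $ \<beta>))"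
  have m: "qmon 1 (0, y1) * (qmon 1 (a, 0) * qmon 1 (0, civ \<alpha>)) = tw (0, y1) (a, 0) \<triangleright> qmon 1 (a, y1 + civ \<alpha>)" for a
    by (simp add: qmon_mult tm_def sc_def tw_def)
  have "Qm1 \<alpha> = (lm \<alpha> \<alpha> \<triangleright> qmon 1 (a1, 0) * qmon 1 (0, civ \<alpha>)) - ((lm \<alpha> \<alpha> - dl) \<triangleright> qmon 1 (a2, 0) * qmon 1 (0, civ \<alpha>))"
    unfolding Qm1_def Y_def vp_2[symmetric] vp_QQ0 a1_def a2_def
    by (simp add: QQ.simps rinv_qmon tw_def left_diff_distrib)
  then have eq: "qmon 1 (0, y1) * Qm1 \<alpha> =
      ((lm \<alpha> \<alpha> + tw (0, y1) (a1, 0)) \<triangleright> qmon 1 (a1, y1 + civ \<alpha>)) -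
      ((lm \<alpha> \<alpha> - dl + tw (0, y1) (a2, 0)) \<triangleright> qmon 1 (a2, y1 + civ \<alpha>))"
    by (simp add: right_diff_distrib m)
  obtain k where k: "- ((cq *v y1) $ \<alpha>) = of_nat (Suc k)" using b by (auto simp: pos_exp_def)
  have "tw (0, y1) (a1, 0) - tw (0, y1) (a2, 0) = (\<Sum>\<beta>\<in>UNIV. y1 $ \<beta> * (dl * of_int (C $ \<beta> $ \<alpha>)))"
    by (simp add: tw_def a1_def a2_def C_axis flip: sum_subtractf) (simp add: algebra_simps)
  also have "\<dots> = dl * (cq *v y1) $ \<alpha>"
    by (simp add: matrix_vector_mult_def sum_distrib_left C_sym[of \<alpha>] mult_ac)
  finally have d: "tw (0, y1) (a2, 0) = tw (0, y1) (a1, 0) + dl * of_nat (Suc k)"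
    unfolding k[symmetric] by (simp add: algebra_simps)
  have y: "y = y1 + civ \<alpha>"
    using nz unfolding eq by (auto simp: ev_diff ev_tm ev_qmon split: if_splits)
  have "k \<noteq> 0"
  proof
    assume "k = 0"
    then have "lm \<alpha> \<alpha> - dl + tw (0, y1) (a2, 0) = lm \<alpha> \<alpha> + tw (0, y1) (a1, 0)"
      by (simp add: d)
    then show False using nz unfolding eq by (simp only: ev_diff ev_tm ev_qmon) auto
  qed
  then obtain j where "k = Suc j" using not0_implies_Suc by blast
  then have "- ((cq *v y) $ \<alpha>) = of_nat (Suc j)"
    using k by (simp add: y matrix_vector_right_distrib cq_civ)
  then show "pos_exp \<alpha> y" unfolding pos_exp_def by blast
qed

text \<open>Inverses are demanded only for \<open>\<beta> \<noteq> \<alpha>\<close>, since inverting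
  the variable with index \<open>\<alpha>\<close> at level 1 would lower the very exponent that has
  to stay positive.\<close>

definition keeps_lev :: "'r \<Rightarrow> nat \<Rightarrow> bool" where
  "keeps_lev \<alpha> n \<longleftrightarrow> keeps \<alpha> (QQ n \<alpha>) \<and> (\<forall>\<beta>. \<beta> \<noteq> \<alpha> \<longrightarrow> keeps \<alpha> (QQ n \<beta>) \<and> keeps \<alpha> (rinv (QQ n \<beta>)))"

lemma keeps_vp: assumes "keeps_lev \<alpha> n" "0 \<le> w $ \<alpha>" shows "keeps \<alpha> (vp (QQ n) w)"
  unfolding vp_def
proof (rule keeps_prod_list)
  fix \<beta>
  show "keeps \<alpha> (ipow (QQ n \<beta>) (w $ \<beta>))"
    using assms by (cases "\<beta> = \<alpha>") (auto intro!: keeps_ipow simp: keeps_lev_def)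
qed

text \<open>For \<open>\<beta> \<noteq> \<alpha>\<close> the variable with index
  \<open>\<alpha>\<close> enters \<open>X (Suc n) \<beta>\<close> with an exponent at least 0, as
  the off-diagonal entries of \<open>C\<close> are not positive. So \<open>X\<close> and its
  geometric series are harmless, and \<open>u n \<beta>\<close> inverts only variables with index
  \<open>\<beta>\<close>.\<close>

lemma keeps_lev_step_other:
  assumes "keeps_lev \<alpha> n" "keeps_lev \<alpha> (Suc n)" "\<beta> \<noteq> \<alpha>"
  shows "keeps \<alpha> (u n \<beta>)" "keeps \<alpha> (QQ (Suc (Suc n)) \<beta>)" "keeps \<alpha> (rinv (QQ (Suc (Suc n)) \<beta>))"
proof -
  have X: "keeps \<alpha> (X (Suc n) \<beta>)"
    unfolding X_def
  proof (rule keeps_vp[OF assms(2)])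
    show "0 \<le> (- (C *v axis \<beta> 1)) $ \<alpha>" using C_off[of \<alpha> \<beta>] assms(3) by (auto simp: C_axis)
  qed
  show u: "keeps \<alpha> (u n \<beta>)"
    unfolding u_def using assms by (auto intro!: keeps_tm keeps_mult keeps_power simp: keeps_lev_def)
  show "keeps \<alpha> (QQ (Suc (Suc n)) \<beta>)"
    unfolding QQ_step by (intro keeps_mult keeps_diff keeps_1 X u)
  have "rinv (u n \<beta>) = lm \<beta> \<beta> \<triangleright> QQ n \<beta> * rinv (QQ (Suc n) \<beta>) ^ 2"
    by (simp add: u_def rinv_tm rinv_mult rinv_power)
  then have "keeps \<alpha> (rinv (u n \<beta>))"
    using assms by (auto intro!: keeps_tm keeps_mult keeps_power simp: keeps_lev_def)
  then show "keeps \<alpha> (rinv (QQ (Suc (Suc n)) \<beta>))"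
    unfolding QQ_step by (subst rinv_mult) (auto intro!: keeps_mult keeps_rinv_1X X)
qed

section \<open>Divisibility by \<open>QQ n \<alpha>\<close> and the induction on the level\<close>

lemma QQ_rel: "QQ (Suc (Suc n)) \<alpha> * QQ n \<alpha> = (- lm \<alpha> \<alpha>) \<triangleright> (QQ (Suc n) \<alpha> ^ 2 - Y (Suc n) \<alpha>)"
  unfolding QQ_step u_def Y_X by (simp add: algebra_simps tm_diff)

text \<open>With the factors interchanged, the right-hand side is a right multiple of the variable
  at the higher level. In this form \<open>QQ n \<alpha>\<close> can serve as the element
  \<open>A\<close> of \<open>qcong_square\<close>.\<close>

lemma QQ_rel': "QQ n \<alpha> * QQ (Suc (Suc n)) \<alpha> = (lm \<alpha> \<alpha> \<triangleright> QQ (Suc n) \<alpha> ^ 2) - (lm \<alpha> \<alpha> - dl) \<triangleright> Y (Suc n) \<alpha>"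
proof -
  have "qcomm (2 * lm \<alpha> \<alpha>) (QQ n \<alpha>) (QQ (Suc n) \<alpha> ^ 2)"
    using qcomm_power[OF qcomm_QQ[of \<alpha> \<alpha> n], of 2] by simp
  moreover have "qcomm (2 * lm \<alpha> \<alpha> - dl) (QQ n \<alpha>) (Y (Suc n) \<alpha>)"
    using qcomm_E[of "axis \<alpha> 1" "2 *s axis \<alpha> 1 - C *v axis \<alpha> 1" 0 0 n]
    unfolding E_at E_0_left Y_def[symmetric]
    by (simp add: lf_diff lf_scale lf_axis_axis lf_axis_C)
  ultimately have "QQ n \<alpha> * (QQ (Suc n) \<alpha> ^ 2 - Y (Suc n) \<alpha>) =
     ((2 * lm \<alpha> \<alpha>) \<triangleright> QQ (Suc n) \<alpha> ^ 2 * QQ n \<alpha>) - ((2 * lm \<alpha> \<alpha> - dl) \<triangleright> Y (Suc n) \<alpha> * QQ n \<alpha>)"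
    by (simp add: qcomm_def right_diff_distrib)
  moreover have "QQ (Suc (Suc n)) \<alpha> = (- lm \<alpha> \<alpha>) \<triangleright> (QQ (Suc n) \<alpha> ^ 2 - Y (Suc n) \<alpha>) * rinv (QQ n \<alpha>)"
    unfolding QQ_step u_def Y_X by (simp add: left_diff_distrib mult.assoc)
  ultimately have "QQ n \<alpha> * QQ (Suc (Suc n)) \<alpha> = (- lm \<alpha> \<alpha>) \<triangleright>
     (((2 * lm \<alpha> \<alpha>) \<triangleright> QQ (Suc n) \<alpha> ^ 2 * QQ n \<alpha>) - ((2 * lm \<alpha> \<alpha> - dl) \<triangleright> Y (Suc n) \<alpha> * QQ n \<alpha>)) * rinv (QQ n \<alpha>)"
    by (simp flip: mult.assoc)
  then show ?thesis by (simp add: left_diff_distrib mult.assoc tm_diff)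
qed

text \<open>
  Congruence modulo the multiples of \<open>Q\<^sub>\<alpha>\<^sub>,\<^sub>n\<close> by elements that preserve positivity: it makes the division by
  \<open>Q\<^sub>\<alpha>\<^sub>,\<^sub>n\<close> in the definition of \<open>Q\<^sub>\<alpha>\<^sub>,\<^sub>n\<^sub>+\<^sub>2\<close> harmless.
\<close>

definition qcong :: "nat \<Rightarrow> 'r \<Rightarrow> 'r qtorus \<Rightarrow> 'r qtorus \<Rightarrow> bool" where
  "qcong n \<alpha> x y \<longleftrightarrow> (\<exists>g. keeps \<alpha> g \<and> x - y = g * QQ n \<alpha>)"

lemma qcong_refl: "qcong n \<alpha> x x"
  unfolding qcong_def by (intro exI[of _ 0]) (simp add: keeps_0)

lemma qcong_trans: assumes "qcong n \<alpha> x y" "qcong n \<alpha> y z" shows "qcong n \<alpha> x z"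
proof -
  obtain g h where gh: "keeps \<alpha> g" "x - y = g * QQ n \<alpha>" "keeps \<alpha> h" "y - z = h * QQ n \<alpha>"
    using assms unfolding qcong_def by blast
  have "x - z = (x - y) + (y - z)" by simp
  also have "\<dots> = (g + h) * QQ n \<alpha>" by (simp only: gh distrib_right)
  finally show ?thesis unfolding qcong_def using keeps_add[OF gh(1,3)] by blast
qed

lemma qcong_left: assumes "qcong n \<alpha> x y" "keeps \<alpha> h" shows "qcong n \<alpha> (h * x) (h * y)"
proof -
  obtain g where "keeps \<alpha> g" "x - y = g * QQ n \<alpha>"
    using assms unfolding qcong_def by blast
  then have "keeps \<alpha> (h * g) \<and> h * x - h * y = h * g * QQ n \<alpha>"
    using assms by (simp add: keeps_mult mult.assoc flip: right_diff_distrib)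
  then show ?thesis unfolding qcong_def by blast
qed

lemma qcong_tm: assumes "qcong n \<alpha> x y" shows "qcong n \<alpha> (e \<triangleright> x) (e \<triangleright> y)"
  using qcong_left[OF assms keeps_tm[OF keeps_1], of e] by simp

text \<open>Multiples of \<open>QQ n \<alpha>\<close> are formed on the left; a factor on the right
  is admissible if it can be moved past \<open>QQ n \<alpha>\<close> at the cost of a power of
  \<open>t\<close>.\<close>

lemma qcong_right: assumes "qcong n \<alpha> x y" "keeps \<alpha> h" "qcomm e (QQ n \<alpha>) h" shows "qcong n \<alpha> (x * h) (y * h)"
proof -
  obtain g where g: "keeps \<alpha> g" "x - y = g * QQ n \<alpha>"
    using assms unfolding qcong_def by blast
  have "x * h - y * h = g * (QQ n \<alpha> * h)"
    by (simp only: left_diff_distrib[symmetric] g mult.assoc)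
  also have "\<dots> = (e \<triangleright> g * h) * QQ n \<alpha>"
    using assms(3) by (simp add: qcomm_def mult.assoc)
  finally show ?thesis
    unfolding qcong_def using g assms by (intro exI[of _ "e \<triangleright> g * h"]) (simp add: keeps_tm keeps_mult)
qed

lemma qcong_sym: assumes "qcong n \<alpha> x y" shows "qcong n \<alpha> y x"
proof -
  obtain g where g: "keeps \<alpha> g" "x - y = g * QQ n \<alpha>"
    using assms unfolding qcong_def by blast
  then have "y - x = (0 - g) * QQ n \<alpha>" by (simp add: algebra_simps)
  then show ?thesis unfolding qcong_def using g keeps_diff[OF keeps_0] by blast
qed

lemma qcomm_QQ_u: "qcomm (lm \<alpha> \<beta>) (QQ (Suc n) \<alpha>) (u n \<beta>)"
proof -
  have "qcomm (lf 0 (2 *s axis \<beta> 1) - lf (- axis \<beta> 1) (axis \<alpha> 1)) (E n 0 (axis \<alpha> 1)) (u n \<beta>)"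
    unfolding u_E by (rule qcomm_E)
  then show ?thesis unfolding E_Suc by (simp add: lf_minus lf_axis_axis lm_sym)
qed

text \<open>The two sides differ by \<open>X (Suc m) \<beta> * u m \<beta>\<close>, and for a
  neighbour \<open>\<beta>\<close> of \<open>\<alpha>\<close> the monomial
  \<open>X (Suc m) \<beta>\<close> contains exactly one factor
  \<open>QQ (Suc m) \<alpha>\<close>.\<close>

lemma qcong_other:
  assumes "keeps_lev \<alpha> m" "keeps_lev \<alpha> (Suc m)" "C $ \<alpha> $ \<beta> = - 1"
  shows "qcong (Suc m) \<alpha> (QQ (Suc (Suc m)) \<beta>) (u m \<beta>)"
proof -
  have ne: "\<beta> \<noteq> \<alpha>" using assms(3) C_diag[of \<alpha>] by auto
  let ?w = "- (C *v axis \<beta> 1) - axis \<alpha> 1"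
  have "X (Suc m) \<beta> = vp (QQ (Suc m)) (?w + axis \<alpha> 1)" by (simp add: X_def)
  also have "\<dots> = vp (QQ (Suc m)) ?w * QQ (Suc m) \<alpha>"
    by (simp only: vp_add cfam_QQ vp_axis ipow_1)
  finally have X: "X (Suc m) \<beta> * u m \<beta> = (vp (QQ (Suc m)) ?w * (lm \<alpha> \<beta> \<triangleright> u m \<beta>)) * QQ (Suc m) \<alpha>"
    using qcomm_QQ_u[of \<alpha> \<beta> m] by (simp add: qcomm_def mult.assoc)
  have "keeps \<alpha> (vp (QQ (Suc m)) ?w)"
    by (rule keeps_vp[OF assms(2)]) (simp add: C_axis assms(3))
  then have "keeps \<alpha> (vp (QQ (Suc m)) ?w * (lm \<alpha> \<beta> \<triangleright> u m \<beta>))"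
    using keeps_lev_step_other(1)[OF assms(1,2) ne] by (intro keeps_mult keeps_tm)
  moreover have "u m \<beta> - QQ (Suc (Suc m)) \<beta> = X (Suc m) \<beta> * u m \<beta>"
    unfolding QQ_step by (simp add: left_diff_distrib)
  ultimately have "qcong (Suc m) \<alpha> (u m \<beta>) (QQ (Suc (Suc m)) \<beta>)"
    unfolding qcong_def X by blast
  then show ?thesis by (rule qcong_sym)
qed

text \<open>For symmetric pairings the powers of \<open>t\<close> in \<open>E_mult\<close> vanish
  one after the other.\<close>

lemma E_prod_list:
  assumes "\<And>i j. i \<in> set xs \<Longrightarrow> j \<in> set xs \<Longrightarrow> i \<noteq> j \<Longrightarrow> lf (a i) (b j) = lf (a j) (b i)" "distinct xs"
  shows "prod_list (map (\<lambda>i. E n (a i) (b i)) xs) = E n (sum_list (map a xs)) (sum_list (map b xs))"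
  using assms
proof (induction xs)
  case (Cons x xs)
  note P = Cons.prems(1) and D = Cons.prems(2)
  have "lf (a x) (sum_list (map b ys)) = lf (sum_list (map a ys)) (b x)" if "set ys \<subseteq> set xs" for ys
    using that
  proof (induction ys)
    case (Cons y ys)
    then have "y \<in> set xs" "x \<noteq> y" using Cons.prems D by auto
    then have "lf (a x) (b y) = lf (a y) (b x)" using P[of x y] by simp
    with Cons show ?case by (simp add: lf_add)
  qed simp
  with Cons show ?case by (simp add: E_mult)
qed (simp add: E_def)

text \<open>The indicator vector of the neighbours of \<open>\<alpha>\<close> in the Dynkin
  diagram.\<close>

definition nbv :: "'r \<Rightarrow> 'r ivector" where "nbv \<alpha> = 2 *s axis \<alpha> 1 - C *v axis \<alpha> 1"

lemma nbv_nth: "nbv \<alpha> $ \<beta> = (if \<beta> \<noteq> \<alpha> \<and> C $ \<alpha> $ \<beta> = - 1 then 1 else 0)"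
  using C_off[of \<alpha> \<beta>] C_sym[of \<alpha> \<beta>] by (auto simp: nbv_def C_axis) (auto simp: axis_def)

lemma lf_nbv: "lf (nbv \<alpha>) (nbv \<alpha>) = 4 * lm \<alpha> \<alpha> - 2 * dl"
proof -
  have "lf (C *v axis \<alpha> 1) (axis \<alpha> 1) = dl" by (subst lf_sym) (simp add: lf_axis_C)
  then show ?thesis
    by (simp add: nbv_def lf_diff lf_scale lf_axis_axis lf_axis_C) (simp add: lf_C_axis C_axis)
qed

text \<open>Modulo \<open>QQ (Suc m) \<alpha>\<close> each neighbour at level \<open>m + 2\<close>
  may be replaced by \<open>u m \<beta>\<close>, and the product of these is
  \<open>Y (Suc m) \<alpha> ^ 2\<close> divided by \<open>Y m \<alpha>\<close>. The exponent of
  \<open>t\<close> is \<open>- lf (nbv \<alpha>) (nbv \<alpha>)\<close>.\<close>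

lemma qcong_Y2:
  assumes "keeps_lev \<alpha> m" "keeps_lev \<alpha> (Suc m)"
  shows "qcong (Suc m) \<alpha> (Y (Suc (Suc m)) \<alpha>) ((2 * dl - 4 * lm \<alpha> \<alpha>) \<triangleright> Y (Suc m) \<alpha> ^ 2 * rinv (Y m \<alpha>))"
proof -
  let ?v = "nbv \<alpha>"
  have vn: "?v $ \<beta> = 0 \<or> ?v $ \<beta> = 1 \<and> C $ \<alpha> $ \<beta> = - 1 \<and> \<beta> \<noteq> \<alpha>" for \<beta>
    by (auto simp: nbv_nth)
  have f: "qcong (Suc m) \<alpha> (ipow (QQ (Suc (Suc m)) \<beta>) (?v $ \<beta>)) (ipow (u m \<beta>) (?v $ \<beta>))" for \<beta>
    using vn[of \<beta>] qcong_other[OF assms] by (auto simp: qcong_refl)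
  have s: "keeps \<alpha> (ipow (QQ (Suc (Suc m)) \<beta>) (?v $ \<beta>))" "keeps \<alpha> (ipow (u m \<beta>) (?v $ \<beta>))" for \<beta>
    using vn[of \<beta>] keeps_lev_step_other[OF assms] by (auto simp: keeps_1)
  have "qcong (Suc m) \<alpha> (prod_list (map (\<lambda>\<beta>. ipow (QQ (Suc (Suc m)) \<beta>) (?v $ \<beta>)) xs))
      (prod_list (map (\<lambda>\<beta>. ipow (u m \<beta>) (?v $ \<beta>)) xs))" for xs
  proof (induction xs)
    case (Cons \<beta> xs)
    let ?P = "prod_list (map (\<lambda>\<beta>. ipow (QQ (Suc (Suc m)) \<beta>) (?v $ \<beta>)) xs)"
    have "qcomm (sum_list (map (\<lambda>\<beta>. of_int (?v $ \<beta>) * lm \<alpha> \<beta>) xs)) (QQ (Suc m) \<alpha>) ?P"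
      by (intro qcomm_prod_list qcomm_ipow qcomm_QQ invble_QQ)
    moreover have "keeps \<alpha> ?P" by (intro keeps_prod_list s)
    ultimately have "qcong (Suc m) \<alpha> (ipow (QQ (Suc (Suc m)) \<beta>) (?v $ \<beta>) * ?P) (ipow (u m \<beta>) (?v $ \<beta>) * ?P)"
      using f qcong_right by blast
    from qcong_trans[OF this qcong_left[OF Cons s(2)]] show ?case by simp
  qed (simp add: qcong_refl)
  then have "qcong (Suc m) \<alpha> (Y (Suc (Suc m)) \<alpha>) (prod_list (map (\<lambda>\<beta>. ipow (u m \<beta>) (?v $ \<beta>)) enumr))"
    unfolding Y_def nbv_def[symmetric] vp_def .
  also have "(\<lambda>\<beta>. ipow (u m \<beta>) (?v $ \<beta>)) = (\<lambda>\<beta>. E m (?v $ \<beta> *s (- axis \<beta> 1)) (?v $ \<beta> *s (2 *s axis \<beta> 1)))"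
  proof
    fix \<beta>
    show "ipow (u m \<beta>) (?v $ \<beta>) = E m (?v $ \<beta> *s (- axis \<beta> 1)) (?v $ \<beta> *s (2 *s axis \<beta> 1))"
      using vn[of \<beta>] by (auto simp: u_E) (simp add: E_def)
  qed
  also have "prod_list (map (\<lambda>\<beta>. E m (?v $ \<beta> *s (- axis \<beta> 1)) (?v $ \<beta> *s (2 *s axis \<beta> 1))) enumr) =
      E m (sum_list (map (\<lambda>\<beta>. ?v $ \<beta> *s (- axis \<beta> 1)) enumr)) (sum_list (map (\<lambda>\<beta>. ?v $ \<beta> *s (2 *s axis \<beta> 1)) enumr))"
    by (rule E_prod_list) (simp_all add: lf_scale lf_minus lf_axis_axis lm_sym)
  also have "sum_list (map (\<lambda>\<beta>. ?v $ \<beta> *s (- axis \<beta> 1)) enumr) = - ?v"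
    unfolding sum_list_enumr
    by (simp add: vec_eq_iff axis_def sum_negf if_distrib[of "\<lambda>x. _ * x"] cong: if_cong)
  also have "sum_list (map (\<lambda>\<beta>. ?v $ \<beta> *s (2 *s axis \<beta> 1)) enumr) = 2 *s ?v"
    unfolding sum_list_enumr
    by (simp add: vec_eq_iff axis_def if_distrib[of "\<lambda>x. _ * x"] cong: if_cong)
  also have "E m (- ?v) (2 *s ?v) = (2 * dl - 4 * lm \<alpha> \<alpha>) \<triangleright> Y (Suc m) \<alpha> ^ 2 * rinv (Y m \<alpha>)"
  proof -
    have "2 *s ?v = ?v + ?v" by (simp add: vec_eq_iff)
    then have "vp (QQ (Suc m)) (2 *s ?v) = vp (QQ (Suc m)) ?v * vp (QQ (Suc m)) ?v"
      by (simp only: vp_add cfam_QQ)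
    then have "vp (QQ (Suc m)) (2 *s ?v) = Y (Suc m) \<alpha> ^ 2"
      by (simp only: Y_def nbv_def power2_eq_square)
    moreover have "vp (QQ m) (- ?v) = rinv (Y m \<alpha>)" by (simp only: vp_minus cfam_QQ Y_def nbv_def)
    moreover have h: "lf (- ?v) (2 *s ?v) / 2 = 2 * dl - 4 * lm \<alpha> \<alpha>"
      "- lf (- ?v) (2 *s ?v) = 8 * lm \<alpha> \<alpha> - 4 * dl"
      by (simp_all add: lf_minus lf_scale lf_nbv field_simps)
    ultimately show ?thesis
      using vp_swap[of m "2 *s ?v" "- ?v"] unfolding E_def h by simp
  qed
  finally show ?thesis .
qed

text \<open>\<open>A\<close> stands for the variable at level \<open>m - 1\<close>. Modulo
  \<open>QQ (Suc m) \<alpha>\<close> its relation identifies \<open>Y m \<alpha>\<close> with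
  \<open>QQ m \<alpha> ^ 2\<close> up to a power of \<open>t\<close>. Using the next relation twice,
  the squares at the levels \<open>m + 2\<close> and \<open>m\<close> multiply to
  \<open>Y (Suc m) \<alpha> ^ 2\<close> up to a power of \<open>t\<close>. It remains to divide by
  \<open>Y m \<alpha>\<close>, which is allowed because \<open>Y\<close> involves the neighbours of
  \<open>\<alpha>\<close> only.\<close>

lemma qcong_square:
  assumes "keeps_lev \<alpha> m" "keeps_lev \<alpha> (Suc m)" "keeps \<alpha> (QQ (Suc (Suc m)) \<alpha>)"
    and A: "keeps \<alpha> A" "A * QQ (Suc m) \<alpha> = (lm \<alpha> \<alpha> \<triangleright> QQ m \<alpha> ^ 2) - (lm \<alpha> \<alpha> - dl) \<triangleright> Y m \<alpha>"
  shows "qcong (Suc m) \<alpha> (QQ (Suc (Suc m)) \<alpha> ^ 2) ((2 * dl - 4 * lm \<alpha> \<alpha>) \<triangleright> Y (Suc m) \<alpha> ^ 2 * rinv (Y m \<alpha>))"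
proof -
  define b0 b1 b2 Y0 Y1 l where "b0 = QQ m \<alpha>" "b1 = QQ (Suc m) \<alpha>" "b2 = QQ (Suc (Suc m)) \<alpha>"
    "Y0 = Y m \<alpha>" "Y1 = Y (Suc m) \<alpha>" "l = lm \<alpha> \<alpha>"
  note defs = this
  have sY1: "keeps \<alpha> Y1" unfolding defs Y_def nbv_def[symmetric]
    by (rule keeps_vp[OF assms(2)]) (simp add: nbv_nth)
  have sb: "keeps \<alpha> b1" "keeps \<alpha> b2" using assms by (auto simp: defs keeps_lev_def)
  have "(dl - l) \<triangleright> A * b1 = (dl \<triangleright> b0 ^ 2) - Y0"
    using A(2) by (simp add: defs tm_diff)
  then have "(dl \<triangleright> b0 ^ 2) - Y0 = ((dl - l) \<triangleright> A) * b1" by simp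
  then have "qcong (Suc m) \<alpha> (dl \<triangleright> b0 ^ 2) Y0"
    unfolding qcong_def defs(2)[symmetric] using keeps_tm[OF A(1)] by blast
  then have 1: "qcong (Suc m) \<alpha> Y0 (dl \<triangleright> b0 ^ 2)" by (rule qcong_sym)
  then have 2: "qcong (Suc m) \<alpha> (b2 ^ 2 * Y0) (dl \<triangleright> b2 ^ 2 * b0 ^ 2)"
    using qcong_left[OF 1 keeps_power[OF sb(2), of 2]] by simp
  have c: "b1 * b0 = (- l) \<triangleright> b0 * b1"
    using qcomm_sym[OF qcomm_QQ[of \<alpha> \<alpha> m]] by (simp add: defs qcomm_def)
  have cY: "Y1 * b0 = (dl - 2 * l) \<triangleright> b0 * Y1"
    using vp_swap[of m "nbv \<alpha>" "axis \<alpha> 1"]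
    by (simp add: defs Y_def nbv_def vp_axis lf_diff lf_scale lf_axis_axis lf_axis_C)
  have c1: "Y1 * b1 = b1 * Y1"
    using vp_commute[OF cfam_QQ, of "Suc m" "nbv \<alpha>" "axis \<alpha> 1"] by (simp add: defs Y_def nbv_def vp_axis)
  have c1': "Y1 * (b1 * z) = b1 * (Y1 * z)" for z
    by (simp only: c1 flip: mult.assoc)
  have c11: "b1 ^ 2 * b0 = (- 2 * l) \<triangleright> b0 * b1 ^ 2"
  proof -
    have "b1 ^ 2 * b0 = b1 * (b1 * b0)" by (simp add: power2_eq_square mult.assoc)
    also have "\<dots> = b1 * ((- l) \<triangleright> b0 * b1)" by (simp only: c)
    also have "\<dots> = (- l) \<triangleright> (b1 * b0) * b1" by (simp only: tm_mult_right mult.assoc)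
    also have "\<dots> = (- l) \<triangleright> ((- l) \<triangleright> b0 * b1) * b1" by (simp only: c)
    also have "\<dots> = (- 2 * l) \<triangleright> b0 * b1 ^ 2" by (simp add: power2_eq_square mult.assoc)
    finally show ?thesis .
  qed
  have r: "b2 * b0 = (- l) \<triangleright> (b1 ^ 2 - Y1)"
    by (simp only: defs QQ_rel)
  have "b2 ^ 2 * b0 ^ 2 = b2 * (b2 * b0) * b0" by (simp add: power2_eq_square mult.assoc)
  also have "\<dots> = (- l) \<triangleright> b2 * (b1 ^ 2 * b0 - Y1 * b0)" by (simp add: r algebra_simps tm_diff)
  also have "b1 ^ 2 * b0 - Y1 * b0 = b0 * (((- 2 * l) \<triangleright> b1 ^ 2) - (dl - 2 * l) \<triangleright> Y1)"
    by (simp add: c11 cY right_diff_distrib)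
  also have "(- l) \<triangleright> b2 * (b0 * (((- 2 * l) \<triangleright> b1 ^ 2) - (dl - 2 * l) \<triangleright> Y1)) =
      (- l) \<triangleright> (b2 * b0) * (((- 2 * l) \<triangleright> b1 ^ 2) - (dl - 2 * l) \<triangleright> Y1)"
    by (simp only: mult.assoc)
  also have "\<dots> = (- 4 * l) \<triangleright> (b1 ^ 2 - Y1) * (b1 ^ 2 - dl \<triangleright> Y1)"
    by (simp add: r tm_diff right_diff_distrib left_diff_distrib)
  also have "\<dots> = ((dl - 4 * l) \<triangleright> Y1 ^ 2) + ((- 4 * l) \<triangleright> (b1 ^ 3 - (dl \<triangleright> Y1 * b1) - Y1 * b1)) * b1"
    by (simp add: tm_diff tm_add right_diff_distrib left_diff_distrib c1 c1' power2_eq_square power3_eq_cube mult.assoc)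
  finally have "qcong (Suc m) \<alpha> (b2 ^ 2 * b0 ^ 2) ((dl - 4 * l) \<triangleright> Y1 ^ 2)"
    unfolding qcong_def defs(2)[symmetric]
    by (intro exI[of _ "(- 4 * l) \<triangleright> (b1 ^ 3 - (dl \<triangleright> Y1 * b1) - Y1 * b1)"])
       (simp add: keeps_tm keeps_diff keeps_power keeps_mult sb sY1)
  from qcong_tm[OF this, of dl] have "qcong (Suc m) \<alpha> (dl \<triangleright> b2 ^ 2 * b0 ^ 2) ((2 * dl - 4 * l) \<triangleright> Y1 ^ 2)"
    by (simp add: algebra_simps)
  from qcong_trans[OF 2 this] have 3: "qcong (Suc m) \<alpha> (b2 ^ 2 * Y0) ((2 * dl - 4 * l) \<triangleright> Y1 ^ 2)" .
  have "rinv Y0 = vp (QQ m) (- nbv \<alpha>)" by (simp only: defs vp_minus cfam_QQ Y_def nbv_def)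
  then have "keeps \<alpha> (rinv Y0)" "qcomm (lf (- nbv \<alpha>) (axis \<alpha> 1) * - 1) b1 (rinv Y0)"
    using keeps_vp[OF assms(1), of "- nbv \<alpha>"] qcomm_sym[OF qcomm_vp_vp[of "- nbv \<alpha>" "axis \<alpha> 1" m]]
    by (simp_all add: nbv_nth defs vp_axis)
  then have "qcong (Suc m) \<alpha> (b2 ^ 2 * Y0 * rinv Y0) (((2 * dl - 4 * l) \<triangleright> Y1 ^ 2) * rinv Y0)"
    using qcong_right[OF 3] unfolding defs by blast
  moreover have "invble Y0" by (simp add: defs Y_def)
  ultimately have "qcong (Suc m) \<alpha> (b2 ^ 2) ((2 * dl - 4 * l) \<triangleright> Y1 ^ 2 * rinv Y0)"
    by (simp add: mult.assoc)
  then show ?thesis unfolding defs .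
qed

text \<open>The terms \<open>QQ (Suc (Suc m)) \<alpha> ^ 2\<close> and
  \<open>Y (Suc (Suc m)) \<alpha>\<close> of the next relation are congruent to the same element, so
  their difference is divisible by \<open>QQ (Suc m) \<alpha>\<close> with a quotient that keeps
  positivity.\<close>

lemma keeps_lev_step_same:
  assumes "keeps_lev \<alpha> m" "keeps_lev \<alpha> (Suc m)" "keeps \<alpha> (QQ (Suc (Suc m)) \<alpha>)"
    and "keeps \<alpha> A" "A * QQ (Suc m) \<alpha> = (lm \<alpha> \<alpha> \<triangleright> QQ m \<alpha> ^ 2) - (lm \<alpha> \<alpha> - dl) \<triangleright> Y m \<alpha>"
  shows "keeps \<alpha> (QQ (Suc (Suc (Suc m))) \<alpha>)"
proof -
  have "qcong (Suc m) \<alpha> (QQ (Suc (Suc m)) \<alpha> ^ 2) (Y (Suc (Suc m)) \<alpha>)"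
    by (rule qcong_trans[OF qcong_square[OF assms] qcong_sym[OF qcong_Y2[OF assms(1,2)]]])
  then obtain g where g: "keeps \<alpha> g" "QQ (Suc (Suc m)) \<alpha> ^ 2 - Y (Suc (Suc m)) \<alpha> = g * QQ (Suc m) \<alpha>"
    unfolding qcong_def by blast
  have "QQ (Suc (Suc (Suc m))) \<alpha> * QQ (Suc m) \<alpha> = ((- lm \<alpha> \<alpha>) \<triangleright> g) * QQ (Suc m) \<alpha>"
    by (simp only: QQ_rel g tm_mult_left)
  then have "QQ (Suc (Suc (Suc m))) \<alpha> = (- lm \<alpha> \<alpha>) \<triangleright> g"
    by (simp only: invble_cancel invble_QQ)
  with g show ?thesis by (simp only: keeps_tm)
qed

text \<open>Level 2 divides only by a variable of level 0, whose inverse is harmless. From level 3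
  on \<open>keeps_lev_step_same\<close> applies, with \<open>Qm1 \<alpha>\<close> as
  \<open>A\<close> at level 3 and the variable four levels below the new one afterwards.\<close>

lemma keeps_lev_all: "keeps_lev \<alpha> n"
proof (induction n rule: less_induct)
  case (less n)
  have base: "keeps_lev \<alpha> 0" "keeps_lev \<alpha> (Suc 0)"
    using keeps_base by (auto simp: keeps_lev_def)
  have 2: "keeps \<alpha> (QQ (Suc (Suc 0)) \<alpha>)"
  proof -
    have "QQ (Suc (Suc 0)) \<alpha> * QQ 0 \<alpha> = (((- lm \<alpha> \<alpha>) \<triangleright> (QQ (Suc 0) \<alpha> ^ 2 - Y (Suc 0) \<alpha>)) * rinv (QQ 0 \<alpha>)) * QQ 0 \<alpha>"
      by (simp add: QQ_rel mult.assoc)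
    then have "QQ (Suc (Suc 0)) \<alpha> = ((- lm \<alpha> \<alpha>) \<triangleright> (QQ (Suc 0) \<alpha> ^ 2 - Y (Suc 0) \<alpha>)) * rinv (QQ 0 \<alpha>)"
      by (simp only: invble_cancel invble_QQ)
    moreover have "keeps \<alpha> (Y (Suc 0) \<alpha>)"
      unfolding Y_def nbv_def[symmetric] by (rule keeps_vp[OF base(2)]) (simp add: nbv_nth)
    ultimately show ?thesis
      using keeps_base by (simp only: keeps_mult keeps_tm keeps_diff keeps_power)
  qed
  show ?case
  proof (cases n)
    case 0
    with base show ?thesis by simp
  next
    case (Suc n1)
    show ?thesis
    proof (cases n1)
      case 0
      with base Suc show ?thesis by simp
    next
      case (Suc n2)
      with \<open>n = Suc n1\<close> have n: "n = Suc (Suc n2)" by simp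
      then have "keeps_lev \<alpha> n2" "keeps_lev \<alpha> (Suc n2)" using less by auto
      note other = keeps_lev_step_other(2,3)[OF this]
      have "keeps \<alpha> (QQ n \<alpha>)"
      proof (cases n2)
        case 0
        with n 2 show ?thesis by simp
      next
        case (Suc m)
        then have g: "keeps_lev \<alpha> m" "keeps_lev \<alpha> (Suc m)" "keeps_lev \<alpha> (Suc (Suc m))" using less n by auto
        have "\<exists>A. keeps \<alpha> A \<and> A * QQ (Suc m) \<alpha> = (lm \<alpha> \<alpha> \<triangleright> QQ m \<alpha> ^ 2) - (lm \<alpha> \<alpha> - dl) \<triangleright> Y m \<alpha>"
        proof (cases m)
          case 0
          have "Qm1 \<alpha> * QQ (Suc 0) \<alpha> = (lm \<alpha> \<alpha> \<triangleright> QQ 0 \<alpha> ^ 2) - (lm \<alpha> \<alpha> - dl) \<triangleright> Y 0 \<alpha>"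
            by (simp add: Qm1_def mult.assoc)
          with 0 keeps_Qm1 show ?thesis by blast
        next
          case (Suc k)
          then have "keeps_lev \<alpha> k" using less n \<open>n2 = Suc m\<close> by auto
          then show ?thesis using QQ_rel'[of k \<alpha>] Suc unfolding keeps_lev_def by blast
        qed
        then show ?thesis
          using keeps_lev_step_same[OF g(1,2)] g(3) n Suc unfolding keeps_lev_def by blast
      qed
      with other n show ?thesis by (auto simp: keeps_lev_def)
    qed
  qed
qed

end

subsection \<open>Recursion in the level\<close>

lemma flim_prod_list:
  "(\<And>i. i \<in> set xs \<Longrightarrow> flim (F i) (f i)) \<Longrightarrow>
   flim (\<lambda>N. prod_list (map (\<lambda>i. F i N) xs)) (prod_list (map f xs))"
  by (induction xs) (auto intro: flim_mult)

lemma prod_list_sum: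
  fixes f :: "'i \<Rightarrow> 'j \<Rightarrow> 'a::semiring_1"
  assumes "distinct xs"
  shows "prod_list (map (\<lambda>i. \<Sum>s\<in>S. f i s) xs) =
    (\<Sum>g\<in>Pi\<^sub>E (set xs) (\<lambda>_. S). prod_list (map (\<lambda>i. f i (g i)) xs))"
  using assms
proof (induction xs)
  case (Cons x xs)
  let ?P = "Pi\<^sub>E (set xs) (\<lambda>_. S)"
  have x: "x \<notin> set xs" using Cons by simp
  have "(\<Sum>g\<in>Pi\<^sub>E (set (x # xs)) (\<lambda>_. S). prod_list (map (\<lambda>i. f i (g i)) (x # xs))) =
      (\<Sum>(s, g)\<in>S \<times> ?P. f x s * prod_list (map (\<lambda>i. f i (g i)) xs))"
  proof (rule sum.reindex_bij_witness[of _ "\<lambda>(s, g). g(x := s)" "\<lambda>g. (g x, g(x := undefined))"])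
    fix g assume g: "g \<in> Pi\<^sub>E (set (x # xs)) (\<lambda>_. S)"
    show "(case (g x, g(x := undefined)) of (s, g) \<Rightarrow> g(x := s)) = g" by simp
    show "(g x, g(x := undefined)) \<in> S \<times> ?P"
      using g x by (auto simp: PiE_iff extensional_def)
    have "map (\<lambda>i. f i ((g(x := undefined)) i)) xs = map (\<lambda>i. f i (g i)) xs"
      using x by auto
    then have "prod_list (map (\<lambda>i. f i ((g(x := undefined)) i)) xs) = prod_list (map (\<lambda>i. f i (g i)) xs)"
      by (simp only:)
    then show "(case (g x, g(x := undefined)) of (s, g) \<Rightarrow> f x s * prod_list (map (\<lambda>i. f i (g i)) xs)) =
      prod_list (map (\<lambda>i. f i (g i)) (x # xs))" by (simp only: prod.case list.map prod_list.Cons)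
  next
    fix b assume b: "b \<in> S \<times> ?P"
    then show "((case b of (s, g) \<Rightarrow> g(x := s)) x, (case b of (s, g) \<Rightarrow> g(x := s))(x := undefined)) = b"
      using x by (auto simp: PiE_iff extensional_def fun_eq_iff)
    show "(case b of (s, g) \<Rightarrow> g(x := s)) \<in> Pi\<^sub>E (set (x # xs)) (\<lambda>_. S)"
      using b by (auto simp: PiE_iff extensional_def)
  qed
  also have "\<dots> = (\<Sum>s\<in>S. f x s) * (\<Sum>g\<in>?P. prod_list (map (\<lambda>i. f i (g i)) xs))"
    by (simp add: sum_product sum.cartesian_product)
  finally show ?case using Cons by simp
qed simp

lemma prod_list_sc_tm:
  "prod_list (map (\<lambda>i. sc (c i) * (e i \<triangleright> f i)) xs) =
   sc (prod_list (map c xs)) * (sum_list (map e xs) \<triangleright> prod_list (map f xs))"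
proof (induction xs)
  case (Cons x xs)
  have "sc (c x) * f x * (sc y * z) = sc (c x * y) * (f x * z)" for y z
    by (metis mult.assoc sc_central sc_mult)
  with Cons show ?case by (simp add: mult.assoc add.commute)
qed simp

lemma sc_left: "x * (sc c * y) = sc c * (x * y)"
  by (metis mult.assoc sc_central)

lemma tm_sc: "e \<triangleright> sc c * x = sc (tpow e * c) * x"
  by (simp add: tm_def sc_mult mult.assoc)

lemma prod_list_enumr: "prod_list (map f enumr) = (\<Prod>i\<in>UNIV. f i :: 'a::comm_monoid_mult)"
  using prod.distinct_set_conv_list[of enumr f] by simp

definition box_fun :: "nat \<Rightarrow> ('r::finite \<Rightarrow> nat) set" where
  "box_fun N = {s. \<forall>\<alpha>. s \<alpha> < N}"

lemma box_fun_PiE: "Pi\<^sub>E UNIV (\<lambda>_. {..<N}) = box_fun N"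
  by (auto simp: box_fun_def PiE_def)

context cartan
begin

section \<open>The q-binomial theorem for negative powers\<close>

lemma qpow_tpow: "qpow C e = tpow (- dl * e)"
  by (simp add: qpow_def dl_def)

text \<open>The q-binomial coefficient indexed by the number \<open>B = b + 1\<close> of factors of
  its generating function. This admits \<open>B = 0\<close>, the start of the induction in
  \<open>pochhammer\<close>.\<close>

definition hc :: "nat \<Rightarrow> nat \<Rightarrow> scalar" where
  "hc B s = fps_nth (\<Prod>i<B. fps_right_inverse (1 - fps_const (qpow C (of_nat i)) * fps_X) 1) s"

lemma qbinom_hc: assumes "0 \<le> b" shows "qbinom C a b = hc (Suc (nat b)) a"
proof -
  have "(\<Prod>i\<in>{0..b}. fps_right_inverse (1 - fps_const (qpow C (of_int i)) * fps_X) 1) =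
      (\<Prod>i<Suc (nat b). fps_right_inverse (1 - fps_const (qpow C (of_nat i)) * fps_X) 1)"
    by (rule prod.reindex_bij_witness[of _ int nat]) (use assms in \<open>auto simp: of_nat_nat\<close>)
  with assms show ?thesis by (simp add: qbinom_def hc_def)
qed

text \<open>Coefficient comparison after cancelling the last factor of the generating
  function.\<close>

lemma hc_rec: "hc (Suc B) s - qpow C (of_nat B) * (if s = 0 then 0 else hc (Suc B) (s - 1)) = hc B s"
proof -
  let ?d = "1 - fps_const (qpow C (of_nat B)) * fps_X"
  let ?H = "\<lambda>B. \<Prod>i<B. fps_right_inverse (1 - fps_const (qpow C (of_nat i)) * fps_X) 1"
  have "?d * fps_right_inverse ?d 1 = 1"
    by (rule fps_right_inverse) simp
  then have "?d * ?H (Suc B) = ?H B"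
    by (simp add: mult.left_commute)
  then have "fps_nth (?d * ?H (Suc B)) s = hc B s" by (simp only: hc_def)
  moreover have "?d * ?H (Suc B) = ?H (Suc B) - fps_const (qpow C (of_nat B)) * (fps_X * ?H (Suc B))"
    by (simp only: left_diff_distrib mult.assoc mult_1)
  ultimately show ?thesis
    by (simp only: fps_sub_nth fps_mult_left_const_nth fps_X_mult_nth hc_def)
qed

lemma hc_0: "hc 0 s = (if s = 0 then 1 else 0)"
  by (simp add: hc_def)

lemma qcomm_u_X: "qcomm dl (u n \<alpha>) (X (Suc n) \<alpha>)"
  using qcomm_E[of "- axis \<alpha> 1" "- (C *v axis \<alpha> 1)" 0 "2 *s axis \<alpha> 1" n]
  unfolding u_E X_E by (simp add: lf_minus lf_axis_C)

text \<open>Moving the factors \<open>1 - X\<close> past the powers of \<open>u\<close> shows that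
  the limit is the inverse of the product of \<open>1 - q^i X\<close> over
  \<open>1 \<le> i \<le> B\<close>. That the product begins at \<open>i = 1\<close> accounts for the
  factor \<open>qpow C (of_nat s)\<close>. The induction step adds the factor with
  \<open>i = B + 1\<close>, whose power of \<open>t\<close> is \<open>e\<close>.\<close>

lemma pochhammer:
  "flim (\<lambda>N. \<Sum>s<N. sc (hc B s * qpow C (of_nat s)) * X (Suc n) \<alpha> ^ s)
     (rinv (QQ (Suc (Suc n)) \<alpha>) ^ B * u n \<alpha> ^ B)"
proof (induction B)
  case 0
  have "(\<Sum>s<Suc N. sc (hc 0 s * qpow C (of_nat s)) * X (Suc n) \<alpha> ^ s) = 1" for N
  proof -
    have "(\<Sum>s<Suc N. sc (hc 0 s * qpow C (of_nat s)) * X (Suc n) \<alpha> ^ s) =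
        (\<Sum>s\<in>{0}. sc (hc 0 s * qpow C (of_nat s)) * X (Suc n) \<alpha> ^ s)"
      by (rule sum.mono_neutral_right) (auto simp: hc_0)
    then show ?thesis by (simp add: hc_0 qpow_tpow)
  qed
  then have "\<forall>\<^sub>F N in sequentially. (\<Sum>s<N. sc (hc 0 s * qpow C (of_nat s)) * X (Suc n) \<alpha> ^ s) = 1"
    unfolding eventually_sequentially by (metis Suc_le_D)
  then show ?case
    unfolding flim_def by (auto elim: eventually_mono)
next
  case (Suc B)
  let ?X = "X (Suc n) \<alpha>" and ?u = "u n \<alpha>" and ?Q = "QQ (Suc (Suc n)) \<alpha>"
  define e where "e = - (of_nat (Suc B) * dl)"
  define S where "S = (\<lambda>B N. \<Sum>s<N. sc (hc B s * qpow C (of_nat s)) * ?X ^ s)"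
  have inU: "inU (1 - e \<triangleright> ?X)"
    by (intro inU_diff pw_tm pw_X hi_tm hi1_X)
  have "qcomm (- (of_nat (Suc B) * dl)) ?X (?u ^ Suc B)"
    using qcomm_power[OF qcomm_sym[OF qcomm_u_X[of n \<alpha>]], of "Suc B"] by simp
  then have Xu: "?X * ?u ^ Suc B = e \<triangleright> ?u ^ Suc B * ?X"
    by (simp only: qcomm_def e_def)
  have Phi: "rinv ?Q ^ Suc B * ?u ^ Suc B * (1 - e \<triangleright> ?X) = rinv ?Q ^ B * ?u ^ B"
  proof -
    have "?u ^ Suc B * (1 - e \<triangleright> ?X) = (1 - ?X) * ?u ^ Suc B"
      by (simp only: Xu left_diff_distrib right_diff_distrib mult_1 mult_1_right tm_mult_right)
    also have "\<dots> = ?Q * ?u ^ B" by (simp only: QQ_step mult.assoc power_Suc)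
    finally have "rinv ?Q ^ Suc B * ?u ^ Suc B * (1 - e \<triangleright> ?X) = rinv ?Q ^ Suc B * (?Q * ?u ^ B)"
      by (simp only: mult.assoc)
    also have "\<dots> = rinv ?Q ^ B * (rinv ?Q * ?Q) * ?u ^ B"
      by (simp only: power_Suc2 mult.assoc)
    finally show ?thesis by (simp only: rinv_left invble_QQ mult_1_right)
  qed
  \<comment> \<open>The partial sums obey the recursion \<open>hc_rec\<close> up to one boundary
    term, which has order at least \<open>N\<close> and therefore tends to 0.\<close>
  have rec: "S (Suc B) N * (1 - e \<triangleright> ?X) =
      S B N - (if N = 0 then 0 else sc (qpow C (of_nat (B + N)) * hc (Suc B) (N - 1)) * ?X ^ N)" for N
  proof (induction N)
    case (Suc N)
    have q: "sc (hc (Suc B) N * qpow C (of_nat N)) * ?X ^ N * (e \<triangleright> ?X) =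
        sc (qpow C (of_nat (B + Suc N)) * hc (Suc B) N) * ?X ^ Suc N"
    proof -
      have "tpow e * (hc (Suc B) N * qpow C (of_nat N)) = qpow C (of_nat (B + Suc N)) * hc (Suc B) N"
        by (simp add: qpow_tpow e_def algebra_simps flip: tpow_add)
      then show ?thesis by (simp only: tm_mult_right mult.assoc tm_sc power_Suc2)
    qed
    have h: "sc (hc (Suc B) N * qpow C (of_nat N)) =
        sc (hc B N * qpow C (of_nat N)) + (if N = 0 then 0 else sc (qpow C (of_nat (B + N)) * hc (Suc B) (N - 1)))"
    proof -
      have "qpow C (of_nat B) * qpow C (of_nat N) = qpow C (of_nat (B + N))"
        by (simp add: qpow_tpow algebra_simps flip: tpow_add)
      moreover have "(x - p * y) * r = x * r - (p * r) * y" for x y p r :: scalar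
        by (simp add: algebra_simps)
      ultimately have "hc B N * qpow C (of_nat N) = hc (Suc B) N * qpow C (of_nat N) -
          (if N = 0 then 0 else qpow C (of_nat (B + N)) * hc (Suc B) (N - 1))"
        unfolding hc_rec[of B N, symmetric] by (simp only: if_cancel mult_zero_right split: if_split) simp
      then show ?thesis by (simp add: sc_diff)
    qed
    have "S (Suc B) (Suc N) * (1 - e \<triangleright> ?X) = S (Suc B) N * (1 - e \<triangleright> ?X) +
        sc (hc (Suc B) N * qpow C (of_nat N)) * ?X ^ N - sc (hc (Suc B) N * qpow C (of_nat N)) * ?X ^ N * (e \<triangleright> ?X)"
    proof -
      have "(x + y) * (1 - z) = x * (1 - z) + y - y * z" for x y z :: "'r qtorus"
        by (simp add: algebra_simps)
      then show ?thesis by (simp only: S_def sum.lessThan_Suc)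
    qed
    also have "\<dots> = S B N - (if N = 0 then 0 else sc (qpow C (of_nat (B + N)) * hc (Suc B) (N - 1)) * ?X ^ N)
      + sc (hc (Suc B) N * qpow C (of_nat N)) * ?X ^ N - sc (qpow C (of_nat (B + Suc N)) * hc (Suc B) N) * ?X ^ Suc N"
      by (simp only: q Suc)
    also have "\<dots> = S B (Suc N) - sc (qpow C (of_nat (B + Suc N)) * hc (Suc B) N) * ?X ^ Suc N"
      unfolding h by (simp add: S_def distrib_right)
    finally show ?case by simp
  qed (simp add: S_def)
  have "flim (\<lambda>N. if N = 0 then 0 else sc (qpow C (of_nat (B + N)) * hc (Suc B) (N - 1)) * ?X ^ N) 0"
  proof (rule flim_hi[of 0])
    fix N
    have "hi (0 + of_nat N * 1) (sc (qpow C (of_nat (B + N)) * hc (Suc B) (N - 1)) * ?X ^ N)"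
      by (intro hi_mult hi_sc hi_power hi1_X)
    then show "hi (of_nat N + 0) ((if N = 0 then 0 else sc (qpow C (of_nat (B + N)) * hc (Suc B) (N - 1)) * ?X ^ N) - 0)"
      by simp
  qed
  from flim_add[OF Suc flim_mult_left[OF this, of "- 1"]]
  have "flim (\<lambda>N. S (Suc B) N * (1 - e \<triangleright> ?X)) (rinv ?Q ^ B * ?u ^ B)"
    unfolding rec unfolding S_def by (simp)
  from flim_mult_right[OF this, of "rinv (1 - e \<triangleright> ?X)"]
  have "flim (S (Suc B)) (rinv ?Q ^ B * ?u ^ B * rinv (1 - e \<triangleright> ?X))"
    using inU_inverse(1)[OF inU] by (simp add: mult.assoc)
  then show ?case
    unfolding Phi[symmetric] S_def using inU_inverse(1)[OF inU] by (simp only: mult.assoc rinv_right mult_1_right)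
qed

text \<open>After division by \<open>u n \<alpha> ^ B\<close> each term is a single monomial; half
  the pairing of \<open>X ^ s\<close> with the inverse of \<open>u ^ B\<close> gives the exponent
  \<open>dl * s * B / 2\<close>.\<close>

lemma pochhammer_E:
  "flim (\<lambda>N. \<Sum>s<N. sc (hc B s * qpow C (of_nat s)) * ((dl * of_nat s * of_nat B / 2) \<triangleright>
      E n (int B *s axis \<alpha> 1) (- (int (2 * B) *s axis \<alpha> 1) - int s *s (C *v axis \<alpha> 1))))
     (rinv (QQ (Suc (Suc n)) \<alpha>) ^ B)"
proof -
  have XE: "X (Suc n) \<alpha> ^ s * rinv (u n \<alpha> ^ B) = (dl * of_nat s * of_nat B / 2) \<triangleright>
      E n (int B *s axis \<alpha> 1) (- (int (2 * B) *s axis \<alpha> 1) - int s *s (C *v axis \<alpha> 1))" for s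
  proof -
    have "X (Suc n) \<alpha> ^ s = E n 0 (- (int s *s (C *v axis \<alpha> 1)))"
      unfolding X_E E_power by (rule arg_cong2[of _ _ _ _ "E n"]) (simp_all add: vec_eq_iff)
    moreover have "rinv (u n \<alpha> ^ B) = E n (int B *s axis \<alpha> 1) (- (int (2 * B) *s axis \<alpha> 1))"
      unfolding u_E E_power E_rinv by (rule arg_cong2[of _ _ _ _ "E n"]) (simp_all add: vec_eq_iff)
    moreover have "lf (int B *s axis \<alpha> 1) (- (int s *s (C *v axis \<alpha> 1))) = - (dl * of_nat s * of_nat B)"
      by (simp add: lf_scale lf_minus lf_axis_C)
    moreover have "E n 0 x * E n b y = (- lf b x / 2) \<triangleright> E n b (y + x)" for b x y
      by (simp add: E_mult add.commute)
    ultimately show ?thesis by simp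
  qed
  have "flim (\<lambda>N. (\<Sum>s<N. sc (hc B s * qpow C (of_nat s)) * X (Suc n) \<alpha> ^ s) * rinv (u n \<alpha> ^ B))
     (rinv (QQ (Suc (Suc n)) \<alpha>) ^ B * u n \<alpha> ^ B * rinv (u n \<alpha> ^ B))"
    by (intro flim_mult_right pochhammer)
  then show ?thesis
    by (simp only: sum_distrib_right mult.assoc XE rinv_right invble_power invble_u mult_1_right)
qed

definition sv :: "('r \<Rightarrow> nat) \<Rightarrow> 'r ivector" where "sv s = (\<chi> \<alpha>. int (s \<alpha>))"

lemma vec_axis_sum: "(\<Sum>\<alpha>\<in>UNIV. k $ \<alpha> *s axis \<alpha> 1) = (k :: 'r ivector)"
  by (simp add: vec_eq_iff axis_def if_distrib[of "\<lambda>x. _ * x"] cong: if_cong)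

lemma C_axis_sum: "(\<Sum>\<alpha>\<in>UNIV. k $ \<alpha> *s (C *v axis \<alpha> 1)) = C *v k"
  by (simp add: vec_eq_iff C_axis) (simp add: matrix_vector_mult_def mult.commute)

definition coef :: "('r \<Rightarrow> nat) \<Rightarrow> 'r ivector \<Rightarrow> scalar" where
  "coef s B = (\<Prod>\<alpha>\<in>UNIV. hc (nat (B $ \<alpha>)) (s \<alpha>) * qpow C (of_nat (s \<alpha>)))"

text \<open>The expansions for the single indices multiply without further powers of
  \<open>t\<close>: for \<open>\<alpha> \<noteq> \<beta>\<close> the form is symmetric and pairs
  \<open>axis \<alpha> 1\<close> with \<open>C *v axis \<beta> 1\<close> to 0.\<close>

lemma vp_expand:
  assumes "\<And>\<alpha>. 0 \<le> B $ \<alpha>"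
  shows "flim (\<lambda>N. \<Sum>s\<in>box_fun N. sc (coef s B) * ((dl * dot (sv s) B / 2) \<triangleright>
      E n B (- (2 *s B) - C *v sv s))) (vp (QQ (Suc (Suc n))) (- B))"
proof -
  let ?b = "\<lambda>\<alpha>. nat (B $ \<alpha>)"
  let ?c = "\<lambda>\<alpha> s. hc (?b \<alpha>) s * qpow C (of_nat s)"
  let ?e = "\<lambda>\<alpha> s. dl * of_nat s * of_nat (?b \<alpha>) / 2"
  let ?E = "\<lambda>\<alpha> s. E n (int (?b \<alpha>) *s axis \<alpha> 1) (- (int (2 * ?b \<alpha>) *s axis \<alpha> 1) - int s *s (C *v axis \<alpha> 1))"
  have "vp (QQ (Suc (Suc n))) (- B) = prod_list (map (\<lambda>\<alpha>. rinv (QQ (Suc (Suc n)) \<alpha>) ^ ?b \<alpha>) enumr)"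
    unfolding vp_def
  proof (rule arg_cong[of _ _ prod_list], rule map_cong[OF refl])
    fix \<alpha>
    show "ipow (QQ (Suc (Suc n)) \<alpha>) ((- B) $ \<alpha>) = rinv (QQ (Suc (Suc n)) \<alpha>) ^ ?b \<alpha>"
      using assms[of \<alpha>] rinv_power[OF invble_QQ] by (auto simp: ipow_def)
  qed
  moreover have "flim (\<lambda>N. prod_list (map (\<lambda>\<alpha>. \<Sum>s<N. sc (?c \<alpha> s) * (?e \<alpha> s \<triangleright> ?E \<alpha> s)) enumr))
     (prod_list (map (\<lambda>\<alpha>. rinv (QQ (Suc (Suc n)) \<alpha>) ^ ?b \<alpha>) enumr))"
    by (intro flim_prod_list pochhammer_E)
  moreover have "prod_list (map (\<lambda>\<alpha>. \<Sum>s<N. sc (?c \<alpha> s) * (?e \<alpha> s \<triangleright> ?E \<alpha> s)) enumr) =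
      (\<Sum>s\<in>box_fun N. sc (coef s B) * ((dl * dot (sv s) B / 2) \<triangleright>
      E n B (- (2 *s B) - C *v sv s)))" for N
  proof -
    have "prod_list (map (\<lambda>\<alpha>. \<Sum>s<N. sc (?c \<alpha> s) * (?e \<alpha> s \<triangleright> ?E \<alpha> s)) enumr) =
        (\<Sum>s\<in>box_fun N. prod_list (map (\<lambda>\<alpha>. sc (?c \<alpha> (s \<alpha>)) * (?e \<alpha> (s \<alpha>) \<triangleright> ?E \<alpha> (s \<alpha>))) enumr))"
      by (subst prod_list_sum) (simp_all add: box_fun_PiE)
    also have "\<dots> = (\<Sum>s\<in>box_fun N. sc (coef s B) * ((dl * dot (sv s) B / 2) \<triangleright>
      E n B (- (2 *s B) - C *v sv s)))"
    proof (rule sum.cong[OF refl])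
      fix s :: "'r \<Rightarrow> nat"
      have "prod_list (map (\<lambda>\<alpha>. ?E \<alpha> (s \<alpha>)) enumr) =
        E n (sum_list (map (\<lambda>\<alpha>. int (?b \<alpha>) *s axis \<alpha> 1) enumr))
          (sum_list (map (\<lambda>\<alpha>. - (int (2 * ?b \<alpha>) *s axis \<alpha> 1) - int (s \<alpha>) *s (C *v axis \<alpha> 1)) enumr))"
        by (rule E_prod_list) (simp_all add: lf_scale lf_minus lf_diff lf_axis_axis lf_axis_C lm_sym)
      also have "sum_list (map (\<lambda>\<alpha>. int (?b \<alpha>) *s axis \<alpha> 1) enumr) = B"
        using assms vec_axis_sum[of B] by (simp add: sum_list_enumr)
      also have "sum_list (map (\<lambda>\<alpha>. - (int (2 * ?b \<alpha>) *s axis \<alpha> 1) - int (s \<alpha>) *s (C *v axis \<alpha> 1)) enumr) =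
         - (2 *s B) - C *v sv s"
      proof -
        have "(\<Sum>\<alpha>\<in>UNIV. int (2 * ?b \<alpha>) *s axis \<alpha> 1) = 2 *s B"
          using assms vec_axis_sum[of "2 *s B"] by simp
        moreover have "(\<Sum>\<alpha>\<in>UNIV. int (s \<alpha>) *s (C *v axis \<alpha> 1)) = C *v sv s"
          using C_axis_sum[of "sv s"] by (simp add: sv_def)
        ultimately show ?thesis
          unfolding sum_list_enumr by (simp only: sum_subtractf sum_negf)
      qed
      finally have 1: "prod_list (map (\<lambda>\<alpha>. ?E \<alpha> (s \<alpha>)) enumr) = E n B (- (2 *s B) - C *v sv s)" .
      have 2: "sum_list (map (\<lambda>\<alpha>. ?e \<alpha> (s \<alpha>)) enumr) = dl * dot (sv s) B / 2"
        using assms unfolding sum_list_enumr dot_def sum_distrib_left sum_divide_distrib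
        by (simp add: of_nat_nat mult.assoc sv_def)
      show "prod_list (map (\<lambda>\<alpha>. sc (?c \<alpha> (s \<alpha>)) * (?e \<alpha> (s \<alpha>) \<triangleright> ?E \<alpha> (s \<alpha>))) enumr) =
        sc (coef s B) * ((dl * dot (sv s) B / 2) \<triangleright> E n B (- (2 *s B) - C *v sv s))"
        unfolding prod_list_sc_tm 1 2 coef_def prod_list_enumr ..
    qed
    finally show ?thesis .
  qed
  ultimately show ?thesis by simp
qed

section \<open>The constant term and its descent through the levels\<close>

definition pre :: "'r qtorus" where
  "pre = prod_list (map (\<lambda>\<beta>. QQ 1 \<beta> * rinv (QQ 0 \<beta>)) enumr)"

definition PP :: "('r \<Rightarrow> nat \<Rightarrow> nat) \<Rightarrow> nat \<Rightarrow> 'r qtorus" where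
  "PP n j = prod_list (map (\<lambda>i. prod_list (map (\<lambda>\<alpha>. QQ i \<alpha> ^ n \<alpha> i) enumr)) [1..<Suc j])"

definition nv :: "('r \<Rightarrow> nat \<Rightarrow> nat) \<Rightarrow> nat \<Rightarrow> 'r ivector" where "nv n i = (\<chi> \<alpha>. int (n \<alpha> i))"

text \<open>
  The recursion \<open>q\<^sub>j\<^sub>-\<^sub>1 = 2 q\<^sub>j - q\<^sub>j\<^sub>+\<^sub>1 - n\<^sub>j + C m\<^sub>j\<close> for the vectors \<open>q\<^sub>j = p\<^sub>j + q\<^sub>0\<close>, with \<open>s = m\<^sub>j\<close>.
\<close>

definition descend :: "('r \<Rightarrow> nat \<Rightarrow> nat) \<Rightarrow> nat \<Rightarrow> 'r ivector \<Rightarrow> 'r ivector \<Rightarrow> ('r \<Rightarrow> nat) \<Rightarrow> 'r ivector" where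
  "descend n j a B s = 2 *s B - a - nv n j + C *v sv s"

text \<open>The constant term when all levels above \<open>j + 1\<close> are eliminated: besides the
  untouched factors up to level \<open>j\<close>, there remains a normalized monomial with exponents
  \<open>a\<close> at level \<open>j\<close> and \<open>- B\<close> at level
  \<open>j + 1\<close>.\<close>

definition G :: "('r \<Rightarrow> nat \<Rightarrow> nat) \<Rightarrow> nat \<Rightarrow> 'r ivector \<Rightarrow> 'r ivector \<Rightarrow> scalar" where
  "G n j a B = ev (pre * PP n j * E j a (- B)) 0"

lemma PP_0: "PP n 0 = 1" and PP_Suc: "PP n (Suc j) = PP n j * vp (QQ (Suc j)) (nv n (Suc j))"
  by (simp_all add: PP_def vp_def nv_def ipow_of_nat)

text \<open>The product \<open>PP n (Suc j)\<close> ends with level \<open>j + 1\<close>, so its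
  last factor merges with \<open>a\<close>. Expanding the negative power at level
  \<open>j + 2\<close> leaves the exponents \<open>B\<close> at level \<open>j\<close> and minus
  \<open>descend\<close> at level \<open>j + 1\<close>. The sum over \<open>s\<close> is infinite,
  but its evaluation is constant from some truncation on.\<close>

lemma G_rec:
  assumes "\<And>\<alpha>. 0 \<le> B $ \<alpha>"
  shows "\<forall>\<^sub>F N in sequentially. G n (Suc j) a B =
    (\<Sum>s\<in>box_fun N. coef s B * tpow (dl * dot (sv s) B / 2 - lf (nv n (Suc j)) B / 2) *
       G n j B (descend n (Suc j) a B s))"
proof -
  let ?c = "nv n (Suc j) + a"
  let ?h = "\<lambda>s. dl * dot (sv s) B / 2"
  let ?K = "(lf a B / 2) \<triangleright> pre * PP n j * vp (QQ (Suc j)) ?c"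
  have "pre * PP n (Suc j) * E (Suc j) a (- B) = ?K * vp (QQ (Suc (Suc j))) (- B)"
    by (simp add: PP_Suc E_def lf_minus mult.assoc vp_add)
  then have eq: "G n (Suc j) a B = ev (?K * vp (QQ (Suc (Suc j))) (- B)) 0"
    by (simp only: G_def)
  have "flim (\<lambda>N. ?K * (\<Sum>s\<in>box_fun N. sc (coef s B) * (?h s \<triangleright> E j B (- (2 *s B) - C *v sv s)))) (?K * vp (QQ (Suc (Suc j))) (- B))"
    by (intro flim_mult_left vp_expand assms)
  then have "\<forall>\<^sub>F N in sequentially. ev (?K * (\<Sum>s\<in>box_fun N. sc (coef s B) * (?h s \<triangleright> E j B (- (2 *s B) - C *v sv s)))) 0 = G n (Suc j) a B"
    unfolding eq by (rule flim_ev)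
  moreover have "ev (?K * (sc (coef s B) * (?h s \<triangleright> E j B (- (2 *s B) - C *v sv s)))) 0 =
      coef s B * tpow (?h s - lf (nv n (Suc j)) B / 2) * G n j B (descend n (Suc j) a B s)" for s
  proof -
    have "E j 0 ?c * E j B (- (2 *s B) - C *v sv s) = (- (lf B ?c / 2)) \<triangleright> E j B (- (descend n (Suc j) a B s))"
      by (simp add: E_mult descend_def algebra_simps)
    then have "?K * (?h s \<triangleright> E j B (- (2 *s B) - C *v sv s)) =
        (?h s + (lf a B / 2 - lf B ?c / 2)) \<triangleright> pre * PP n j * E j B (- (descend n (Suc j) a B s))"
      unfolding E_0_left[symmetric] by (simp add: mult.assoc)
    then have "?K * (sc (coef s B) * (?h s \<triangleright> E j B (- (2 *s B) - C *v sv s))) =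
        sc (coef s B) * ((?h s + (lf a B / 2 - lf B ?c / 2)) \<triangleright> pre * PP n j * E j B (- (descend n (Suc j) a B s)))"
      by (simp only: sc_left)
    then show ?thesis
      unfolding G_def by (simp add: ev_sc ev_tm lf_add lf_sym[of B] mult.assoc add_divide_distrib)
  qed
  ultimately show ?thesis
    by (simp add: sum_distrib_left ev_sum eq_commute)
qed

lemma pre_E: "pre = ((\<Sum>\<beta>\<in>UNIV. lm \<beta> \<beta>) / 2) \<triangleright> E 0 (- 1) 1"
proof -
  have "QQ 1 \<beta> * rinv (QQ 0 \<beta>) = sc 1 * ((lm \<beta> \<beta> / 2) \<triangleright> E 0 (- axis \<beta> 1) (axis \<beta> 1))" for \<beta>
  proof -
    have "QQ 1 \<beta> * rinv (QQ 0 \<beta>) = E 0 0 (axis \<beta> 1) * E 0 (- axis \<beta> 1) 0"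
      using E_at[of 0 \<beta>] E_rinv[of 0 "axis \<beta> 1" 0] E_Suc[of 0 \<beta>] by (simp)
    then show ?thesis by (simp add: E_mult lf_minus lf_axis_axis)
  qed
  then have "pre = sc (prod_list (map (\<lambda>_. 1) (enumr :: 'r list))) *
    (sum_list (map (\<lambda>\<beta>. lm \<beta> \<beta> / 2) enumr) \<triangleright> prod_list (map (\<lambda>\<beta>. E 0 (- axis \<beta> 1) (axis \<beta> 1)) enumr))"
    unfolding pre_def by (simp only: prod_list_sc_tm)
  also have "prod_list (map (\<lambda>\<beta>. E 0 (- axis \<beta> 1) (axis \<beta> 1)) enumr) =
     E 0 (sum_list (map (\<lambda>\<beta>. - axis \<beta> 1) enumr)) (sum_list (map (\<lambda>\<beta>. axis \<beta> 1) enumr))"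
    by (rule E_prod_list) (simp_all add: lf_minus lf_axis_axis lm_sym)
  also have "sum_list (map (\<lambda>\<beta>. - axis \<beta> 1) enumr) = (- 1 :: 'r ivector)"
    unfolding sum_list_enumr by (simp add: vec_eq_iff axis_def sum_negf)
  also have "sum_list (map (\<lambda>\<beta>. axis \<beta> 1) enumr) = (1 :: 'r ivector)"
    unfolding sum_list_enumr by (simp add: vec_eq_iff axis_def)
  finally show ?thesis by (simp add: prod_list_enumr sum_list_enumr sum_divide_distrib)
qed

lemma E0_qmon: "E 0 a b = (- (lf a b / 2)) \<triangleright> qmon 1 (\<chi> \<beta>. dl * of_int (a $ \<beta>), yb b)"
  unfolding E_def vp_QQ0 vp_QQ1 by (simp add: qmon_mult tw_def)

lemma cq_yb: "cq *v yb b = (\<chi> \<beta>. - of_int (b $ \<beta>))"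
  unfolding vec_eq_iff
proof
  fix \<alpha>
  have "(cq *v yb b) $ \<alpha> = (\<Sum>\<beta>\<in>UNIV. - of_int (b $ \<beta>) * (cq *v civ \<beta>) $ \<alpha>)"
    unfolding matrix_vector_mult_def yb_def
    by (simp add: sum_distrib_left sum_negf mult_ac, subst sum.swap, simp)
  also have "\<dots> = - of_int (b $ \<alpha>)"
    by (simp add: cq_civ sum_negf if_distrib[of "\<lambda>x. _ * x"] cong: if_cong)
  finally show "(cq *v yb b) $ \<alpha> = (\<chi> \<beta>. - of_int (b $ \<beta>)) $ \<alpha>" by simp
qed

lemma yb_inj: "yb b = yb b' \<longleftrightarrow> b = b'"
proof
  assume "yb b = yb b'"
  then have "(\<chi> \<beta>. - of_int (b $ \<beta>)) = ((\<chi> \<beta>. - of_int (b' $ \<beta>)) :: (rat, 'r) vec)"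
    unfolding cq_yb[symmetric] by simp
  then show "b = b'" by (simp add: vec_eq_iff)
qed simp

lemma yb_0 [simp]: "yb 0 = 0"
  by (simp add: yb_def vec_eq_iff)

lemma ev_E0: "ev (E 0 a b) 0 = (if b = 0 then 1 else 0)"
  using yb_inj[of b 0] by (auto simp: E0_qmon ev_tm ev_qmon)

text \<open>The prefactor contributes exponent 1 of each variable of level 1, which
  \<open>- B\<close> has to cancel; level 0 is evaluated and leaves only a power of
  \<open>t\<close>.\<close>

lemma G_0: "G n 0 a B =
  (if B = 1 then tpow ((\<Sum>\<beta>\<in>UNIV. lm \<beta> \<beta>) / 2 + lf 1 1 / 2 - lf 1 a / 2) else 0)"
proof -
  have "pre * E 0 a (- B) = ((\<Sum>\<beta>\<in>UNIV. lm \<beta> \<beta>) / 2 + lf 1 B / 2 - lf 1 a / 2) \<triangleright> E 0 (a - 1) (1 - B)"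
    unfolding pre_E by (simp add: E_mult lf_minus lf_sym[of a] diff_divide_distrib algebra_simps)
  then show ?thesis
    by (auto simp: G_def PP_0 ev_tm ev_E0)
qed

text \<open>The prefactor has exponent 1 of \<open>Q\<^sub>\<alpha>\<^sub>,\<^sub>1\<close>, which
  is positive, and all further factors keep positivity, because the variables with index
  \<open>\<alpha>\<close> occur to nonnegative powers only. The constant term belongs to the
  exponent 0.\<close>

lemma G_vanish:
  assumes "\<And>\<beta>. 0 \<le> a $ \<beta>" "B $ \<alpha> \<le> 0"
  shows "G n j a B = 0"
proof -
  have "psupp \<alpha> (E 0 (- 1) 1)"
    unfolding psupp_def
  proof (intro allI impI)
    fix y assume "ev (E 0 (- 1) 1) y \<noteq> 0"
    then have "y = yb 1"
      by (auto simp: E0_qmon ev_tm ev_qmon split: if_splits)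
    then have "- ((cq *v y) $ \<alpha>) = of_nat (Suc 0)"
      using cq_yb[of 1] by simp
    then show "pos_exp \<alpha> y" unfolding pos_exp_def by blast
  qed
  then have "psupp \<alpha> pre" unfolding pre_E by (rule psupp_tm)
  moreover have "keeps \<alpha> (PP n j)"
    unfolding PP_def
  proof (intro keeps_prod_list keeps_power)
    show "keeps \<alpha> (QQ i \<beta>)" for i \<beta>
      using keeps_lev_all[of \<alpha> i] by (cases "\<beta> = \<alpha>") (auto simp: keeps_lev_def)
  qed
  moreover have "keeps \<alpha> (E j a (- B))"
    unfolding E_def using assms by (intro keeps_tm keeps_mult keeps_vp keeps_lev_all) auto
  ultimately have "psupp \<alpha> (pre * PP n j * E j a (- B))" by (simp add: keeps_def)
  moreover have "\<not> pos_exp \<alpha> 0" by (simp add: pos_exp_def flip: of_nat_Suc)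
  ultimately show ?thesis unfolding G_def psupp_def by blast
qed

end

subsection \<open>Summation over the solutions\<close>

context cartan
begin

text \<open>
  The closed form of \<open>q\<^sub>i\<close> when the recursion is started from \<open>q\<^sub>j\<^sub>+\<^sub>1 = q'\<close> and \<open>q\<^sub>j = q\<close>.
\<close>

definition Qc :: "('r \<Rightarrow> nat \<Rightarrow> nat) \<Rightarrow> nat \<Rightarrow> 'r ivector \<Rightarrow> 'r ivector \<Rightarrow> ('r \<Rightarrow> nat \<Rightarrow> nat) \<Rightarrow> nat \<Rightarrow> 'r ivector" where
  "Qc n j q' q m i = q + (int j - int i) *s (q - q') + (\<Sum>l\<in>{i<..j}. (int l - int i) *s (C *v nv m l - nv n l))"

text \<open>In the descent \<open>B = q + 1\<close>. Nonnegativity says that no step is annihilated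
  by \<open>G_vanish\<close>, and the value 0 at level 0 is the condition \<open>B = 1\<close> of
  \<open>G_0\<close>.\<close>

definition Sol :: "('r \<Rightarrow> nat \<Rightarrow> nat) \<Rightarrow> nat \<Rightarrow> 'r ivector \<Rightarrow> 'r ivector \<Rightarrow> ('r \<Rightarrow> nat \<Rightarrow> nat) set" where
  "Sol n j q' q = {m. (\<forall>\<alpha> i. i \<notin> {1..j} \<longrightarrow> m \<alpha> i = 0) \<and> Qc n j q' q m 0 = 0 \<and>
     (\<forall>i\<in>{1..j}. \<forall>\<alpha>. 0 \<le> Qc n j q' q m i $ \<alpha>)}"

text \<open>The exponent of \<open>t\<close> collected at level \<open>i\<close>: the first term
  comes from the powers of \<open>q\<close> in \<open>coef\<close>, the other two from
  \<open>G_rec\<close>.\<close>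

definition wt1 :: "('r \<Rightarrow> nat \<Rightarrow> nat) \<Rightarrow> ('r \<Rightarrow> nat \<Rightarrow> nat) \<Rightarrow> nat \<Rightarrow> 'r ivector \<Rightarrow> rat" where
  "wt1 n m i Q = - dl * dot (nv m i) 1 + dl * dot (nv m i) (Q + 1) / 2 - lf (nv n i) (Q + 1) / 2"

text \<open>The terms outside the sum are the exponent of \<open>G_0\<close> with \<open>a\<close>
  one more than the vector at level 1. For \<open>j = 0\<close> the closed form yields
  \<open>q'\<close> at level 1, so the start of the recursion is covered as well.\<close>

definition wt :: "('r \<Rightarrow> nat \<Rightarrow> nat) \<Rightarrow> nat \<Rightarrow> 'r ivector \<Rightarrow> 'r ivector \<Rightarrow> ('r \<Rightarrow> nat \<Rightarrow> nat) \<Rightarrow> rat" where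
  "wt n j q' q m = (\<Sum>i\<in>{1..j}. wt1 n m i (Qc n j q' q m i)) + (\<Sum>\<beta>\<in>UNIV. lm \<beta> \<beta>) / 2 - lf 1 (Qc n j q' q m 1) / 2"

definition val :: "('r \<Rightarrow> nat \<Rightarrow> nat) \<Rightarrow> nat \<Rightarrow> 'r ivector \<Rightarrow> 'r ivector \<Rightarrow> ('r \<Rightarrow> nat \<Rightarrow> nat) \<Rightarrow> scalar" where
  "val n j q' q m = tpow (wt n j q' q m) * (\<Prod>i\<in>{1..j}. \<Prod>\<alpha>\<in>UNIV. hc (Suc (nat (Qc n j q' q m i $ \<alpha>))) (m \<alpha> i))"

definition ext :: "nat \<Rightarrow> ('r \<Rightarrow> nat) \<Rightarrow> ('r \<Rightarrow> nat \<Rightarrow> nat) \<Rightarrow> 'r \<Rightarrow> nat \<Rightarrow> nat" where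
  "ext j s m = (\<lambda>\<alpha>. (m \<alpha>)(j := s \<alpha>))"

lemma cq_inj: "C *v a = C *v b \<Longrightarrow> a = (b :: 'r ivector)"
proof -
  assume eq: "C *v a = C *v b"
  have "cq *v (\<chi> \<alpha>. of_int (a $ \<alpha> - b $ \<alpha>)) = 0"
    unfolding vec_eq_iff
  proof
    fix \<alpha>
    have "(cq *v (\<chi> \<alpha>. of_int (a $ \<alpha> - b $ \<alpha>))) $ \<alpha> = of_int ((C *v a) $ \<alpha> - (C *v b) $ \<alpha>)"
      by (simp add: matrix_vector_mult_def right_diff_distrib sum_subtractf)
    then show "(cq *v (\<chi> \<alpha>. of_int (a $ \<alpha> - b $ \<alpha>))) $ \<alpha> = 0 $ \<alpha>" using eq by simp
  qed
  then have "(\<chi> \<alpha>. of_int (a $ \<alpha> - b $ \<alpha>)) = (0 :: (rat, 'r) vec)" by (rule cq_ker)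
  then show "a = b" by (simp add: vec_eq_iff)
qed

lemma C_scale: "C *v (k *s a) = k *s (C *v a)"
  by (simp add: vec_eq_iff matrix_vector_mult_def sum_distrib_left mult_ac)

lemma C_sum: "C *v (\<Sum>i\<in>A. f i) = (\<Sum>i\<in>A. C *v f i)"
  by (induction A rule: infinite_finite_induct) (simp_all add: matrix_vector_right_distrib)

lemma finite_bounded_funs:
  "finite {m :: 'r \<Rightarrow> nat \<Rightarrow> nat. (\<forall>\<alpha> i. i \<notin> {1..j} \<longrightarrow> m \<alpha> i = 0) \<and> (\<forall>\<alpha>. \<forall>i\<in>{1..j}. m \<alpha> i \<le> b)}"
proof -
  let ?B = "{g :: nat \<Rightarrow> nat. \<forall>i. (i \<in> {1..j} \<longrightarrow> g i \<in> {..b}) \<and> (i \<notin> {1..j} \<longrightarrow> g i = 0)}"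
  have "finite ?B" by (rule finite_set_of_finite_funs) auto
  then have "finite {m :: 'r \<Rightarrow> nat \<Rightarrow> nat. \<forall>\<alpha>. (\<alpha> \<in> UNIV \<longrightarrow> m \<alpha> \<in> ?B) \<and> (\<alpha> \<notin> UNIV \<longrightarrow> m \<alpha> = (\<lambda>_. 0))}"
    by (intro finite_set_of_finite_funs) auto
  then show ?thesis by (rule rev_finite_subset) auto
qed

text \<open>The condition at level 0 fixes \<open>C\<close> applied to the weighted sum
  \<open>W m\<close>, and \<open>C\<close> is injective. As the weights are at least 1 and all terms
  are nonnegative, \<open>W m\<close> bounds the entries of \<open>m\<close>.\<close>

lemma finite_Qc0:
  "finite {m. (\<forall>\<alpha> i. i \<notin> {1..j} \<longrightarrow> m \<alpha> i = 0) \<and> Qc n j q' q m 0 = 0}" (is "finite ?S")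
proof (cases "?S = {}")
  case False
  then obtain m0 where m0: "m0 \<in> ?S" by blast
  define W :: "('r \<Rightarrow> nat \<Rightarrow> nat) \<Rightarrow> 'r ivector" where "W m = (\<Sum>l\<in>{1..j}. int l *s nv m l)" for m
  have Q: "Qc n j q' q m 0 = q + int j *s (q - q') - (\<Sum>l\<in>{1..j}. int l *s nv n l) + C *v W m" for m
  proof -
    have "{0<..j} = {1..j}" by auto
    moreover have "int l *s (C *v nv m l - nv n l) = int l *s (C *v nv m l) - int l *s nv n l" for l
      by (simp add: vec_eq_iff algebra_simps)
    ultimately show ?thesis
      by (simp add: Qc_def W_def C_sum C_scale sum_subtractf)
  qed
  define b where "b = nat (Max (range (\<lambda>\<alpha>. W m0 $ \<alpha>)))"
  have "m \<alpha> i \<le> b" if "m \<in> ?S" "i \<in> {1..j}" for m \<alpha> i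
  proof -
    have "C *v W m = C *v W m0" using that m0 unfolding Q mem_Collect_eq by (metis add_left_cancel)
    then have W: "W m = W m0" by (rule cq_inj)
    have "1 * int (m \<alpha> i) \<le> int i * int (m \<alpha> i)"
      by (rule mult_right_mono) (use that in auto)
    then have "int (m \<alpha> i) \<le> int i * int (m \<alpha> i)" by simp
    also have "\<dots> \<le> (\<Sum>l\<in>{1..j}. int l * int (m \<alpha> l))"
      by (rule member_le_sum) (use that in auto)
    also have "\<dots> = W m $ \<alpha>" by (simp add: W_def nv_def)
    also have "\<dots> \<le> Max (range (\<lambda>\<alpha>. W m0 $ \<alpha>))" unfolding W by (rule Max_ge) auto
    finally show ?thesis by (simp add: b_def)
  qed
  then have "?S \<subseteq> {m. (\<forall>\<alpha> i. i \<notin> {1..j} \<longrightarrow> m \<alpha> i = 0) \<and> (\<forall>\<alpha>. \<forall>i\<in>{1..j}. m \<alpha> i \<le> b)}" by blast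
  then show ?thesis using finite_bounded_funs by (rule finite_subset)
next
  case True
  then show ?thesis by (simp only: finite.emptyI)
qed

lemma finite_Sol: "finite (Sol n j q' q)"
  by (rule finite_subset[OF _ finite_Qc0[of j n q' q]]) (auto simp: Sol_def)

lemma Qc_self: "Qc n j q' q m j = q"
  by (simp add: Qc_def)

text \<open>The closed form obeys the recursion: the choice of \<open>s\<close> at level
  \<open>j + 1\<close> moves the starting pair one level down.\<close>

lemma Qc_ext:
  assumes "i \<le> j"
  shows "Qc n (Suc j) q' q (ext (Suc j) s m) i = Qc n j q (descend n (Suc j) q' q s) m i"
proof -
  let ?f = "\<lambda>m l. (int l - int i) *s (C *v nv m l - nv n l)"
  have "{i<..Suc j} = insert (Suc j) {i<..j}" using assms by auto
  then have "sum (?f (ext (Suc j) s m)) {i<..Suc j} = ?f (ext (Suc j) s m) (Suc j) + sum (?f (ext (Suc j) s m)) {i<..j}"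
    by (simp only:) (rule sum.insert; simp)
  moreover have "sum (?f (ext (Suc j) s m)) {i<..j} = sum (?f m) {i<..j}"
    by (rule sum.cong) (auto simp: nv_def ext_def)
  moreover have "nv (ext (Suc j) s m) (Suc j) = sv s" by (simp add: nv_def ext_def sv_def)
  ultimately have "Qc n (Suc j) q' q (ext (Suc j) s m) i =
     q + (int (Suc j) - int i) *s (q - q') + ((int (Suc j) - int i) *s (C *v sv s - nv n (Suc j)) +
       (\<Sum>l\<in>{i<..j}. (int l - int i) *s (C *v nv m l - nv n l)))"
    unfolding Qc_def by (simp only:)
  also have "\<dots> = Qc n j q (descend n (Suc j) q' q s) m i"
    unfolding Qc_def descend_def by (simp add: vec_eq_iff algebra_simps)
  finally show ?thesis .
qed

lemma coef_tpow: "coef s B = (\<Prod>\<alpha>\<in>UNIV. hc (nat (B $ \<alpha>)) (s \<alpha>)) * tpow (- dl * dot (sv s) 1)"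
proof -
  have "(\<Prod>\<alpha>\<in>A. tpow (- dl * of_nat (s \<alpha>))) = tpow (- dl * (\<Sum>\<alpha>\<in>A. of_nat (s \<alpha>)))" for A
    by (induction A rule: infinite_finite_induct) (simp_all add: algebra_simps flip: tpow_add)
  then show ?thesis by (simp add: coef_def prod.distrib qpow_tpow dot_def sv_def)
qed

lemma Sol_Suc:
  assumes "\<And>\<alpha>. 0 \<le> q $ \<alpha>"
  shows "Sol n (Suc j) q' q = {ext (Suc j) s m | s m. m \<in> Sol n j q (descend n (Suc j) q' q s)}"
proof (intro equalityI subsetI)
  fix m assume m: "m \<in> Sol n (Suc j) q' q"
  define s where "s = (\<lambda>\<alpha>. m \<alpha> (Suc j))"
  define m' where "m' = (\<lambda>\<alpha>. (m \<alpha>)(Suc j := 0))"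
  have e: "m = ext (Suc j) s m'" by (auto simp: ext_def s_def m'_def)
  have "m' \<in> Sol n j q (descend n (Suc j) q' q s)"
    unfolding Sol_def
  proof (intro CollectI conjI allI ballI impI)
    have Q: "Qc n j q (descend n (Suc j) q' q s) m' i = Qc n (Suc j) q' q m i" if "i \<le> j" for i
      using Qc_ext[OF that, of n q' q s m'] e by simp
    show "m' \<alpha> i = 0" if "i \<notin> {1..j}" for \<alpha> i
    proof (cases "i = Suc j")
      case False
      with that have "i \<notin> {1..Suc j}" by auto
      then show ?thesis using m by (simp add: m'_def Sol_def)
    qed (simp add: m'_def)
    show "Qc n j q (descend n (Suc j) q' q s) m' 0 = 0"
      using m by (simp add: Q Sol_def)
    show "0 \<le> Qc n j q (descend n (Suc j) q' q s) m' i $ \<alpha>" if "i \<in> {1..j}" for i \<alpha>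
      using m that by (simp add: Q Sol_def)
  qed
  with e show "m \<in> {ext (Suc j) s m | s m. m \<in> Sol n j q (descend n (Suc j) q' q s)}" by blast
next
  fix m assume "m \<in> {ext (Suc j) s m | s m. m \<in> Sol n j q (descend n (Suc j) q' q s)}"
  then obtain s m' where m: "m = ext (Suc j) s m'" "m' \<in> Sol n j q (descend n (Suc j) q' q s)" by blast
  have "0 \<le> Qc n (Suc j) q' q m i $ \<alpha>" if "i \<in> {1..Suc j}" for i \<alpha>
  proof (cases "i = Suc j")
    case True
    then show ?thesis using assms by (simp add: Qc_self)
  next
    case False
    with that m show ?thesis by (simp add: Qc_ext Sol_def)
  qed
  with m show "m \<in> Sol n (Suc j) q' q"
    unfolding Sol_def by (intro CollectI conjI ballI allI impI) (auto simp: Qc_ext, auto simp: ext_def)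
qed

lemma val_ext:
  assumes "m \<in> Sol n j q (descend n (Suc j) q' q s)" "\<And>\<alpha>. 0 \<le> q $ \<alpha>"
  shows "val n (Suc j) q' q (ext (Suc j) s m) =
    coef s (q + 1) * tpow (dl * dot (sv s) (q + 1) / 2 - lf (nv n (Suc j)) (q + 1) / 2) *
    val n j q (descend n (Suc j) q' q s) m"
proof -
  let ?q = "descend n (Suc j) q' q s" and ?m = "ext (Suc j) s m"
  have i: "{1..Suc j} = insert (Suc j) {1..j}" by auto
  have e1: "?m \<alpha> (Suc j) = s \<alpha>" "i \<le> j \<Longrightarrow> ?m \<alpha> i = m \<alpha> i" for \<alpha> i by (auto simp: ext_def)
  have e2: "nv ?m i = nv m i" if "i \<le> j" for i using that by (simp add: nv_def e1)
  have Q1: "Qc n (Suc j) q' q ?m 1 = Qc n j q ?q m 1"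
  \<comment> \<open>For \<open>j = 0\<close> the index 1 lies outside the range of
    \<open>Qc_ext\<close>.\<close>
  proof (cases j)
    case 0
    have "{Suc 0<..Suc 0} = {}" "{Suc 0<..0} = {}" by auto
    with 0 show ?thesis by (simp add: Qc_def vec_eq_iff)
  qed (simp add: Qc_ext)
  have "wt1 n ?m i (Qc n (Suc j) q' q ?m i) = wt1 n m i (Qc n j q ?q m i)" if "i \<in> {1..j}" for i
    using that by (simp add: wt1_def e2 Qc_ext)
  then have "wt n (Suc j) q' q ?m = wt1 n ?m (Suc j) q + wt n j q ?q m"
    unfolding wt_def i Q1 by (simp add: Qc_self)
  also have "wt1 n ?m (Suc j) q = - dl * dot (sv s) 1 +
     (dl * dot (sv s) (q + 1) / 2 - lf (nv n (Suc j)) (q + 1) / 2)"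
    by (simp add: wt1_def e1 nv_def sv_def)
  finally have w: "tpow (wt n (Suc j) q' q ?m) = tpow (- dl * dot (sv s) 1) *
     tpow (dl * dot (sv s) (q + 1) / 2 - lf (nv n (Suc j)) (q + 1) / 2) * tpow (wt n j q ?q m)"
    by (simp only: tpow_add)
  have "(\<Prod>i\<in>{1..Suc j}. \<Prod>\<alpha>\<in>UNIV. hc (Suc (nat (Qc n (Suc j) q' q ?m i $ \<alpha>))) (?m \<alpha> i)) =
      (\<Prod>\<alpha>\<in>UNIV. hc (Suc (nat (q $ \<alpha>))) (s \<alpha>)) *
      (\<Prod>i\<in>{1..j}. \<Prod>\<alpha>\<in>UNIV. hc (Suc (nat (Qc n j q ?q m i $ \<alpha>))) (m \<alpha> i))"
    unfolding i by (simp add: Qc_self e1 Qc_ext)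
  moreover have "Suc (nat (q $ \<alpha>)) = nat ((q + 1) $ \<alpha>)" for \<alpha> using assms(2)[of \<alpha>] by simp
  ultimately show ?thesis
    unfolding val_def coef_tpow w by (simp add: mult_ac)
qed

lemma finite_box_fun: "finite (box_fun N :: ('r \<Rightarrow> nat) set)"
  unfolding box_fun_PiE[symmetric] by (intro finite_PiE) auto

text \<open>Induction on the level with both starting vectors arbitrary. The hypothesis on
  \<open>q'\<close> is inherited because an expansion is made only for nonnegative \<open>q\<close>;
  otherwise \<open>G_vanish\<close> makes the left side 0 and there are no solutions.\<close>

lemma G_Sol:
  assumes "\<And>\<alpha>. 0 \<le> q' $ \<alpha>"
  shows "G n j (q' + 1) (q + 1) = (\<Sum>m\<in>Sol n j q' q. val n j q' q m)"
  using assms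
proof (induction j arbitrary: q' q)
  case 0
  have [simp]: "{i<..0::nat} = {}" for i by auto
  show ?case
  proof (cases "q = 0")
    case True
    have "Sol n 0 q' q = {\<lambda>_ _. 0}" using True by (auto simp: Sol_def Qc_def fun_eq_iff)
    moreover have "val n 0 q' q (\<lambda>_ _. 0) = tpow ((\<Sum>\<beta>\<in>UNIV. lm \<beta> \<beta>) / 2 - lf 1 q' / 2)"
    proof -
      have "Qc n 0 q' q (\<lambda>_ _. 0) 1 = q'" using True by (simp add: Qc_def vec_eq_iff)
      then show ?thesis by (simp add: val_def wt_def)
    qed
    ultimately show ?thesis using True
      by (simp add: G_0 lf_add add_divide_distrib)
  next
    case False
    then have "Sol n 0 q' q = {}" by (auto simp: Sol_def Qc_def)
    with False show ?thesis by (simp add: G_0)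
  qed
next
  case (Suc j)
  show ?case
  proof (cases "\<forall>\<alpha>. 0 \<le> q $ \<alpha>")
    case False
    then obtain \<alpha> where \<alpha>: "\<not> 0 \<le> q $ \<alpha>" by blast
    have "G n (Suc j) (q' + 1) (q + 1) = 0"
      by (rule G_vanish[of _ _ \<alpha>]) (use Suc.prems \<alpha> in \<open>auto intro: add_nonneg_nonneg\<close>)
    moreover have "Sol n (Suc j) q' q = {}"
      using \<alpha> unfolding Sol_def by (auto simp: Qc_self intro!: bexI[of _ "Suc j"])
    ultimately show ?thesis by simp
  next
    case True
    then have q: "\<And>\<alpha>. 0 \<le> q $ \<alpha>" by blast
    define qn where "qn s = descend n (Suc j) q' q s" for s
    define k where "k s = coef s (q + 1) * tpow (dl * dot (sv s) (q + 1) / 2 - lf (nv n (Suc j)) (q + 1) / 2)" for s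
    \<comment> \<open>Large enough for the box to contain the top component of every solution, so
      that the truncated sum misses none.\<close>
    define b where "b = Suc (Max (insert 0 ((\<lambda>(m, \<alpha>). m \<alpha> (Suc j)) ` (Sol n (Suc j) q' q \<times> UNIV))))"
    have e: "descend n (Suc j) (q' + 1) (q + 1) s = qn s + 1" for s
      by (simp add: qn_def descend_def vec_eq_iff)
    have q1: "0 \<le> (q + 1) $ \<alpha>" for \<alpha> using q by (simp add: add_nonneg_nonneg)
    have "\<forall>\<^sub>F N in sequentially. G n (Suc j) (q' + 1) (q + 1) = (\<Sum>s\<in>box_fun N. k s * G n j (q + 1) (qn s + 1))"
      using G_rec[of "q + 1" n j "q' + 1", OF q1] unfolding k_def e .
    then obtain N0 where "\<And>N. N \<ge> N0 \<Longrightarrow> G n (Suc j) (q' + 1) (q + 1) = (\<Sum>s\<in>box_fun N. k s * G n j (q + 1) (qn s + 1))"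
      unfolding eventually_sequentially by blast
    then have "G n (Suc j) (q' + 1) (q + 1) = (\<Sum>s\<in>box_fun (max N0 b). k s * G n j (q + 1) (qn s + 1))"
      by simp
    also have "\<dots> = (\<Sum>s\<in>box_fun (max N0 b). \<Sum>m\<in>Sol n j q (qn s). k s * val n j q (qn s) m)"
      by (simp add: Suc.IH q sum_distrib_left)
    also have "\<dots> = (\<Sum>(s, m)\<in>(SIGMA s:box_fun (max N0 b). Sol n j q (qn s)). k s * val n j q (qn s) m)"
      by (rule sum.Sigma) (auto simp: finite_box_fun finite_Sol)
    also have "\<dots> = (\<Sum>m\<in>Sol n (Suc j) q' q. val n (Suc j) q' q m)"
    proof (rule sum.reindex_bij_witness[of _ "\<lambda>m. (\<lambda>\<alpha>. m \<alpha> (Suc j), \<lambda>\<alpha>. (m \<alpha>)(Suc j := 0))" "\<lambda>(s, m). ext (Suc j) s m"])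
      fix x assume "x \<in> (SIGMA s:box_fun (max N0 b). Sol n j q (qn s))"
      then obtain s m where x: "x = (s, m)" "m \<in> Sol n j q (qn s)" by blast
      have "m \<alpha> (Suc j) = 0" for \<alpha> using x by (simp add: Sol_def)
      then have "(m \<alpha>)(Suc j := 0) = m \<alpha>" for \<alpha> by (metis fun_upd_triv)
      then show "(\<lambda>\<alpha>. (case x of (s, m) \<Rightarrow> ext (Suc j) s m) \<alpha> (Suc j), \<lambda>\<alpha>. ((case x of (s, m) \<Rightarrow> ext (Suc j) s m) \<alpha>)(Suc j := 0)) = x"
        by (simp add: x ext_def)
      show "(case x of (s, m) \<Rightarrow> ext (Suc j) s m) \<in> Sol n (Suc j) q' q"
        using x Sol_Suc[OF q, of n j q'] by (auto simp: qn_def)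
      show "val n (Suc j) q' q (case x of (s, m) \<Rightarrow> ext (Suc j) s m) = (case x of (s, m) \<Rightarrow> k s * val n j q (qn s) m)"
        using x val_ext[OF _ q, of m n j q' s] by (simp add: qn_def k_def)
    next
      fix m assume m: "m \<in> Sol n (Suc j) q' q"
      then obtain s m' where m': "m = ext (Suc j) s m'" "m' \<in> Sol n j q (qn s)"
        using Sol_Suc[OF q, of n j q'] by (auto simp: qn_def)
      have "m' \<alpha> (Suc j) = 0" for \<alpha> using m' by (simp add: Sol_def)
      then have e: "(m' \<alpha>)(Suc j := 0) = m' \<alpha>" for \<alpha> by (metis fun_upd_triv)
      show "(case (\<lambda>\<alpha>. m \<alpha> (Suc j), \<lambda>\<alpha>. (m \<alpha>)(Suc j := 0)) of (s, m) \<Rightarrow> ext (Suc j) s m) = m"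
        by (simp add: ext_def)
      have "s \<alpha> < max N0 b" for \<alpha>
      proof -
        have "m \<alpha> (Suc j) \<le> Max (insert 0 ((\<lambda>(m, \<alpha>). m \<alpha> (Suc j)) ` (Sol n (Suc j) q' q \<times> UNIV)))"
          by (rule Max_ge) (use m in \<open>auto simp: finite_Sol image_iff\<close>)
        then show ?thesis by (simp add: b_def m' ext_def)
      qed
      then show "(\<lambda>\<alpha>. m \<alpha> (Suc j), \<lambda>\<alpha>. (m \<alpha>)(Suc j := 0)) \<in> (SIGMA s:box_fun (max N0 b). Sol n j q (qn s))"
        using m' e by (simp add: ext_def box_fun_def)
    qed
    finally show ?thesis .
  qed
qed

section \<open>Comparison with \<open>pvec\<close>, \<open>Qform\<close> and
  \<open>MK\<close>\<close>

definition amin :: "('r \<Rightarrow> nat \<Rightarrow> nat) \<Rightarrow> nat \<Rightarrow> nat \<Rightarrow> 'r ivector" where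
  "amin n K i = (\<Sum>j\<in>{1..K}. int (min i j) *s nv n j)"

definition pv :: "('r \<Rightarrow> nat \<Rightarrow> nat) \<Rightarrow> nat \<Rightarrow> ('r \<Rightarrow> nat \<Rightarrow> nat) \<Rightarrow> nat \<Rightarrow> 'r ivector" where
  "pv n K m i = (\<Sum>j\<in>{1..K}. int (min i j) *s (nv n j - C *v nv m j))"

lemma pv_nth: "pv n K m i $ \<alpha> = pvec C K m n \<alpha> i"
proof -
  have "pv n K m i $ \<alpha> = (\<Sum>j\<in>{1..K}. int (min i j) * int (n \<alpha> j)) -
      (\<Sum>j\<in>{1..K}. \<Sum>\<beta>\<in>UNIV. C $ \<alpha> $ \<beta> * int (min i j) * int (m \<beta> j))"
    by (simp add: pv_def nv_def matrix_vector_mult_def right_diff_distrib sum_subtractf sum_distrib_left mult_ac)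
  then show ?thesis unfolding pvec_def by (simp only: sum.swap[of _ "{1..K}" UNIV])
qed

text \<open>The difference \<open>j - min i j\<close> is 0 for \<open>j \<le> i\<close> and
  \<open>j - i\<close> otherwise, which turns the kernel \<open>A\<close> into that of
  \<open>Qc\<close>. Equal starting vectors correspond to the opposite exponents
  \<open>l + 1\<close> and \<open>- (l + 1)\<close> at the levels \<open>K\<close> and
  \<open>K + 1\<close>.\<close>

lemma Qc_pv: assumes "i \<le> K" shows "Qc n K l l m i = l - pv n K m K + pv n K m i"
proof -
  have "pv n K m K - pv n K m i = (\<Sum>j\<in>{1..K}. (int j - int (min i j)) *s (nv n j - C *v nv m j))"
    unfolding pv_def sum_subtractf[symmetric]
    by (rule sum.cong) (auto simp: vec_eq_iff algebra_simps)
  also have "\<dots> = (\<Sum>j\<in>{i<..K}. (int j - int (min i j)) *s (nv n j - C *v nv m j))"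
    by (rule sum.mono_neutral_right) (auto simp: vec_eq_iff min_def)
  also have "\<dots> = (\<Sum>j\<in>{i<..K}. - ((int j - int i) *s (C *v nv m j - nv n j)))"
    by (rule sum.cong) (auto simp: vec_eq_iff algebra_simps)
  also have "\<dots> = - (\<Sum>j\<in>{i<..K}. (int j - int i) *s (C *v nv m j - nv n j))"
    by (rule sum_negf)
  finally have "(\<Sum>j\<in>{i<..K}. (int j - int i) *s (C *v nv m j - nv n j)) = - (pv n K m K - pv n K m i)"
    by simp
  then show ?thesis unfolding Qc_def by (simp only:) (simp add: vec_eq_iff)
qed

lemma Sol_Msupp: "Sol n K (sv l) (sv l) = Msupp C K l n"
proof -
  have p0: "pv n K m 0 = 0" for m by (simp add: pv_def vec_eq_iff)
  have "(Qc n K (sv l) (sv l) m 0 = 0) = (\<forall>\<alpha>. int (l \<alpha>) - pvec C K m n \<alpha> K = 0)" for m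
    by (simp add: Qc_pv p0 vec_eq_iff sv_def pv_nth)
  moreover have "Qc n K (sv l) (sv l) m i $ \<alpha> = pvec C K m n \<alpha> i"
    if "\<forall>\<alpha>. int (l \<alpha>) - pvec C K m n \<alpha> K = 0" "i \<in> {1..K}" for m i \<alpha>
    using that by (simp add: Qc_pv sv_def pv_nth)
  ultimately show ?thesis unfolding Sol_def Msupp_def by fastforce
qed

lemma lf_sum: "lf (\<Sum>i\<in>A. f i) b = (\<Sum>i\<in>A. lf (f i) b)" "lf a (\<Sum>i\<in>A. f i) = (\<Sum>i\<in>A. lf a (f i))"
  by (induction A rule: infinite_finite_induct) (simp_all add: lf_add)

lemma Qform_eq: "Qform C K m n = - (\<Sum>i\<in>{1..K}. dot (nv m i) (pv n K m i + amin n K i)) / 2"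
proof -
  have a: "amin n K i $ \<alpha> = (\<Sum>j\<in>{1..K}. int (min i j) * int (n \<alpha> j))" for i \<alpha>
    by (simp add: amin_def nv_def)
  have "(\<Sum>i\<in>{1..K}. dot (nv m i) (pv n K m i + amin n K i)) =
    of_int (\<Sum>\<alpha>\<in>UNIV. \<Sum>i\<in>{1..K}. int (m \<alpha> i) * (pvec C K m n \<alpha> i + (\<Sum>j\<in>{1..K}. int (min i j) * int (n \<alpha> j))))"
    unfolding dot_def by (subst sum.swap) (simp add: nv_def pv_nth a)
  then show ?thesis unfolding Qform_def by simp
qed

text \<open>The terms linear in \<open>m\<close> alone cancel: \<open>wt1\<close> leaves minus half
  of \<open>dl\<close> times the total of \<open>m\<close>, and the term with the vector at level 1
  returns it. The pairing of \<open>n\<close> with \<open>p\<close> supplies the mixed term of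
  \<open>Qform\<close>; the remainder is independent of \<open>m\<close>.\<close>

lemma wt_eq:
  assumes "m \<in> Msupp C K l n" "1 \<le> K"
  shows "wt n K (sv l) (sv l) m = - dl * Qform C K m n + (\<Sum>\<beta>\<in>UNIV. lm \<beta> \<beta>) / 2
    - (\<Sum>i\<in>{1..K}. lf 1 (nv n i)) - (\<Sum>i\<in>{1..K}. \<Sum>j\<in>{1..K}. of_nat (min i j) * lf (nv n i) (nv n j)) / 2"
proof -
  let ?p = "pv n K m"
  have Q: "Qc n K (sv l) (sv l) m i = ?p i" if "i \<in> {1..K}" for i
  proof -
    have "sv l = ?p K" using assms by (simp add: Msupp_def vec_eq_iff pv_nth sv_def)
    then show ?thesis using that by (simp add: Qc_pv)
  qed
  have w: "wt1 n m i (?p i) = - (dl * dot 1 (nv m i) / 2) + dl * dot (nv m i) (?p i) / 2 - lf (nv n i) (?p i) / 2 - lf 1 (nv n i) / 2" for i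
    unfolding wt1_def by (simp add: dot_add lf_add dot_sym[of _ 1] lf_sym[of _ 1] field_simps)
  have p1: "?p 1 = (\<Sum>j\<in>{1..K}. nv n j - C *v nv m j)"
    unfolding pv_def by (rule sum.cong) (auto simp: vec_eq_iff)
  have l1: "lf 1 (?p 1) = (\<Sum>i\<in>{1..K}. lf 1 (nv n i)) - dl * (\<Sum>i\<in>{1..K}. dot 1 (nv m i))"
    unfolding p1 by (simp add: lf_sum lf_diff lf_C sum_subtractf sum_distrib_left)
  have lp: "lf (nv n i) (?p i) = (\<Sum>j\<in>{1..K}. of_nat (min i j) * lf (nv n i) (nv n j)) - dl * (\<Sum>j\<in>{1..K}. of_nat (min i j) * dot (nv n i) (nv m j))" for i
    unfolding pv_def by (simp add: lf_sum lf_scale lf_diff lf_C right_diff_distrib sum_subtractf sum_distrib_left mult_ac)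
  have da: "(\<Sum>i\<in>{1..K}. dot (nv m i) (amin n K i)) = (\<Sum>i\<in>{1..K}. \<Sum>j\<in>{1..K}. of_nat (min i j) * dot (nv n i) (nv m j))"
    unfolding amin_def dot_sum dot_scale
    by (subst sum.swap) (simp add: dot_sym[of "nv m _"] min.commute)
  have "wt n K (sv l) (sv l) m = (\<Sum>i\<in>{1..K}. wt1 n m i (?p i)) + (\<Sum>\<beta>\<in>UNIV. lm \<beta> \<beta>) / 2 - lf 1 (?p 1) / 2"
    unfolding wt_def using assms(2) by (simp add: Q)
  then show ?thesis
    unfolding w l1 Qform_eq dot_add sum.distrib da lp sum_subtractf
    by (simp add: sum.distrib sum_subtractf sum_negf sum_divide_distrib[symmetric] sum_distrib_left[symmetric] field_simps)
qed

lemma MK_G: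
  assumes "1 \<le> K"
  shows "MK C K l n = tpow (- (\<Sum>\<beta>\<in>UNIV. lm \<beta> \<beta>) / 2 + (\<Sum>i\<in>{1..K}. lf 1 (nv n i))
     + (\<Sum>i\<in>{1..K}. \<Sum>j\<in>{1..K}. of_nat (min i j) * lf (nv n i) (nv n j)) / 2) * G n K (sv l + 1) (sv l + 1)"
proof -
  let ?t = "- (\<Sum>\<beta>\<in>UNIV. lm \<beta> \<beta>) / 2 + (\<Sum>i\<in>{1..K}. lf 1 (nv n i))
     + (\<Sum>i\<in>{1..K}. \<Sum>j\<in>{1..K}. of_nat (min i j) * lf (nv n i) (nv n j)) / 2"
  have "G n K (sv l + 1) (sv l + 1) = (\<Sum>m\<in>Msupp C K l n. val n K (sv l) (sv l) m)"
    unfolding Sol_Msupp[symmetric] by (rule G_Sol) (simp add: sv_def)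
  moreover have "tpow ?t * val n K (sv l) (sv l) m =
      qpow C (Qform C K m n) * (\<Prod>\<alpha>\<in>UNIV. \<Prod>i\<in>{1..K}. qbinom C (m \<alpha> i) (pvec C K m n \<alpha> i))"
    if m: "m \<in> Msupp C K l n" for m
  proof -
    have t: "tpow ?t * tpow (wt n K (sv l) (sv l) m) = qpow C (Qform C K m n)"
      unfolding wt_eq[OF m assms] qpow_tpow tpow_mult by (rule arg_cong[of _ _ tpow]) simp
    have "Qc n K (sv l) (sv l) m i $ \<alpha> = pvec C K m n \<alpha> i \<and> 0 \<le> pvec C K m n \<alpha> i" if "i \<in> {1..K}" for i \<alpha>
      using that m by (simp add: Qc_pv sv_def pv_nth Msupp_def)
    then have "hc (Suc (nat (Qc n K (sv l) (sv l) m i $ \<alpha>))) (m \<alpha> i) = qbinom C (m \<alpha> i) (pvec C K m n \<alpha> i)"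
      if "i \<in> {1..K}" for i \<alpha> using that by (simp add: qbinom_hc)
    then have "(\<Prod>i\<in>{1..K}. \<Prod>\<alpha>\<in>UNIV. hc (Suc (nat (Qc n K (sv l) (sv l) m i $ \<alpha>))) (m \<alpha> i)) =
        (\<Prod>\<alpha>\<in>UNIV. \<Prod>i\<in>{1..K}. qbinom C (m \<alpha> i) (pvec C K m n \<alpha> i))"
      by (subst prod.swap) simp
    then show ?thesis unfolding val_def by (simp only: t mult.assoc[symmetric])
  qed
  ultimately show ?thesis
    unfolding MK_def by (simp add: sum_distrib_left)
qed

end

subsection \<open>Transport to the ring of the statement\<close>

text \<open>Completeness: the coefficient of \<open>v\<close> no longer changes from stage
  \<open>M v\<close> on. All terms lie in the one cone required by \<open>pw\<close>, which makes
  the limit tame.\<close>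

lemma flim_exists:
  assumes "\<And>k. pw (F k)" "\<And>k. hi (of_nat (Suc k)) (F (Suc k) - F k)"
  shows "\<exists>f. flim F f"
proof -
  define M where "M v = Suc (nat \<lfloor>deg (snd v)\<rfloor>)" for v :: "'a expo"
  have stable: "cf (F m) v = cf (F k) v" if "k \<le> m" "deg (snd v) < of_nat (Suc k)" for v k m
    using that(1)
  proof (induction m rule: dec_induct)
    case (step m)
    have "cf (F (Suc m) - F m) v = 0"
    proof (rule ccontr)
      assume "cf (F (Suc m) - F m) v \<noteq> 0"
      then have "of_nat (Suc m) \<le> deg (snd v)" using assms(2)[of m] unfolding hi_def by blast
      moreover have "(of_nat (Suc k) :: rat) \<le> of_nat (Suc m)" using step by simp
      ultimately show False using that(2) by linarith
    qed
    with step show ?case by simp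
  qed simp
  let ?f = "\<lambda>v. cf (F (M v)) v"
  have "tame (supp ?f)"
    unfolding tame_def
  proof (intro conjI allI exI[of _ "{0}"] impI)
    fix y
    have "{a. (a, y) \<in> supp ?f} = {a. cf (F (M (0, y))) (a, y) \<noteq> 0}"
      by (auto simp: supp_def M_def)
    then show "finite {a. (a, y) \<in> supp ?f}" by (simp only: finite_slice)
  next
    fix a y assume "(a, y) \<in> supp ?f"
    then have "y \<in> nvec" using assms(1)[of "M (a, y)"] by (auto simp: supp_def pw_def)
    then show "\<exists>d\<in>{0}. y - d \<in> nvec" by simp
  qed simp
  then have cf: "cf (Hs ?f) v = ?f v" for v by (simp add: cf_Hs)
  have "flim F (Hs ?f)"
  proof (rule flim_hi[of 0])
    fix k
    show "hi (of_nat k + 0) (F k - Hs ?f)"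
      unfolding hi_def
    proof (intro allI impI, rule ccontr)
      fix v assume v: "cf (F k - Hs ?f) v \<noteq> 0" "\<not> of_nat k + 0 \<le> deg (snd v)"
      have "deg (snd v) < of_nat (Suc (M v))" unfolding M_def by simp linarith
      moreover have "M v \<le> k \<or> M v = 1 \<and> k = 0 \<or> deg (snd v) < of_nat (Suc k)" using v(2) by auto
      moreover have "deg (snd v) < of_nat (Suc k)" using v(2) by auto
      ultimately have "cf (F (M v)) v = cf (F k) v"
        using stable[of k "M v" v] stable[of "M v" k v] by (metis nat_le_linear)
      with v(1) show False by (simp add: cf)
    qed
  qed
  then show ?thesis ..
qed

context cartan
begin

section \<open>The lattice of exponents and the pullback to \<open>qring C\<close>\<close>

definition psi :: "'r ivector \<Rightarrow> 'r ivector \<Rightarrow> 'r expo" where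
  "psi a b = (\<chi> \<beta>. dl * of_int (a $ \<beta>), yb b)"

lemma yb_add: "yb (b + b') = yb b + yb b'" and yb_diff: "yb (b - b') = yb b - yb b'"
  by (simp_all add: yb_def vec_eq_iff algebra_simps sum.distrib sum_subtractf sum_negf)

lemma QQ_psi: "QQ 0 \<alpha> = qmon 1 (psi (axis \<alpha> 1) 0)" "QQ (Suc 0) \<alpha> = qmon 1 (psi 0 (axis \<alpha> 1))"
  using vp_QQ0[of "axis \<alpha> 1"] vp_QQ1[of "axis \<alpha> 1"]
  by (simp_all add: vp_axis psi_def) (simp add: zero_vec_def)

lemma psi_add: "psi (a + a') (b + b') = psi a b + psi a' b'"
  and psi_diff: "psi (a - a') (b - b') = psi a b - psi a' b'"
  and psi_0 [simp]: "psi 0 0 = 0"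
  by (simp_all add: psi_def yb_add yb_diff vec_eq_iff algebra_simps zero_prod_def)

lemma psi_inj: "psi a b = psi a' b' \<longleftrightarrow> a = a' \<and> b = b'"
proof -
  have "(\<chi> \<beta>. dl * of_int (a $ \<beta>)) = ((\<chi> \<beta>. dl * of_int (a' $ \<beta>)) :: (rat, 'r) vec) \<longleftrightarrow> a = a'"
    by (simp add: vec_eq_iff)
  then show ?thesis by (simp add: psi_def yb_inj)
qed

lemma tw_psi: "tw (psi a b) (psi a' b') = twist C b a'"
proof -
  have "tw (psi a b) (psi a' b') = - (\<Sum>\<gamma>\<in>UNIV. \<Sum>\<beta>\<in>UNIV. of_int (b $ \<beta>) * lm \<gamma> \<beta> * of_int (a' $ \<gamma>))"
    by (simp add: tw_def psi_def yb_def civ_def lm_ci sum_negf sum_distrib_right sum_distrib_left mult_ac)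
  also have "\<dots> = twist C b a'"
    unfolding twist_def by (subst sum.swap) (simp add: lm_def[symmetric] lm_sym[of _ _])
  finally show ?thesis .
qed

definition latt :: "'r expo set" where "latt = range (\<lambda>(a, b). psi a b)"

lemma latt_psi [simp]: "psi a b \<in> latt"
  by (force simp: latt_def)

lemma latt_E: "v \<in> latt \<Longrightarrow> (\<And>a b. v = psi a b \<Longrightarrow> thesis) \<Longrightarrow> thesis"
  by (auto simp: latt_def)

lemma latt_add: "v \<in> latt \<Longrightarrow> w \<in> latt \<Longrightarrow> v + w \<in> latt" and latt_diff: "v \<in> latt \<Longrightarrow> w \<in> latt \<Longrightarrow> v - w \<in> latt"
  and latt_0: "0 \<in> latt"
  by (metis latt_E latt_psi psi_add, metis latt_E latt_psi psi_diff, metis latt_psi psi_0)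

text \<open>The common type admits rational exponents; \<open>pull\<close> is injective on the
  series supported on the lattice.\<close>

definition on_latt :: "'r qtorus \<Rightarrow> bool" where "on_latt h \<longleftrightarrow> (\<forall>v. cf h v \<noteq> 0 \<longrightarrow> v \<in> latt)"

definition pull :: "'r qtorus \<Rightarrow> 'r qseries" where "pull h = (\<lambda>a b. cf h (psi a b))"

lemma pull_inj: "on_latt g \<Longrightarrow> on_latt h \<Longrightarrow> pull g = pull h \<Longrightarrow> g = h"
proof (rule qtorus_eqI)
  fix v assume "on_latt g" "on_latt h" "pull g = pull h"
  then show "cf g v = cf h v"
    by (metis on_latt_def latt_E pull_def)
qed

lemma on_latt_0: "on_latt 0" and on_latt_1: "on_latt 1" and on_latt_sc: "on_latt (sc c)" and on_latt_qmon: "on_latt (qmon c (psi a b))"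
  and on_latt_minus: "on_latt f \<Longrightarrow> on_latt (- f)" and on_latt_tm: "on_latt f \<Longrightarrow> on_latt (e \<triangleright> f)"
  by (auto simp: on_latt_def cf_1 cf_sc cf_qmon latt_0 split: if_splits)

lemma on_latt_add: "on_latt f \<Longrightarrow> on_latt g \<Longrightarrow> on_latt (f + g)" and on_latt_diff: "on_latt f \<Longrightarrow> on_latt g \<Longrightarrow> on_latt (f - g)"
  unfolding on_latt_def by (metis add.right_neutral cf_add) (metis cf_diff diff_zero)

lemma on_latt_mult: "on_latt f \<Longrightarrow> on_latt g \<Longrightarrow> on_latt (f * g)"
  unfolding on_latt_def by (metis cf_mult_nonzeroE latt_add)

lemma on_latt_power: "on_latt f \<Longrightarrow> on_latt (f ^ k)"
  by (induction k) (auto intro: on_latt_1 on_latt_mult)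

lemma on_latt_prod_list: "(\<And>i. i \<in> set xs \<Longrightarrow> on_latt (f i)) \<Longrightarrow> on_latt (prod_list (map f xs))"
  by (induction xs) (auto intro: on_latt_1 on_latt_mult)

lemma on_latt_flim: assumes "flim F f" "\<And>k. on_latt (F k)" shows "on_latt f"
  unfolding on_latt_def
proof (intro allI impI)
  fix v assume "cf f v \<noteq> 0"
  moreover obtain k where "\<forall>a. cf (F k) (a, snd v) = cf f (a, snd v)"
    using flim_eventually[OF assms(1), of "snd v"] eventually_happens by force
  ultimately have "cf (F k) v \<noteq> 0" by (metis prod.collapse)
  then show "v \<in> latt" using assms(2) unfolding on_latt_def by blast
qed

text \<open>Restricting supports to the lattice commutes with left multiplication by
  \<open>f\<close>. Hence the restriction of the inverse is again a right inverse of
  \<open>f\<close>, and the two agree.\<close>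

lemma on_latt_rinv: assumes "on_latt f" "invble f" shows "on_latt (rinv f)"
proof -
  define p where "p h = Hs (\<lambda>v. if v \<in> latt then cf h v else 0)" for h :: "'r qtorus"
  have p: "cf (p h) v = (if v \<in> latt then cf h v else 0)" for h v
    unfolding p_def by (subst cf_Hs) (auto intro!: tame_subset[OF tame_cf, of _ h] simp: supp_def)
  have "f * p h = p (f * h)" for h
  proof (rule qtorus_eqI)
    fix z
    have s: "s \<in> latt" if "s \<in> supp (cf f)" for s using assms(1) that unfolding on_latt_def supp_def by blast
    have zs: "z - s \<in> latt \<longleftrightarrow> z \<in> latt" if "s \<in> latt" for s
      using that latt_add[of "z - s" s] latt_diff[of z s] by auto
    show "cf (f * p h) z = cf (p (f * h)) z"
    proof (cases "z \<in> latt")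
      case True
      have "{s \<in> supp (cf f). z - s \<in> supp (cf (p h))} = {s \<in> supp (cf f). z - s \<in> supp (cf h)}"
        using s zs True by (auto simp: supp_def p)
      then have "conv (cf f) (cf (p h)) z = conv (cf f) (cf h) z"
        unfolding conv_def using s zs True by (auto simp: p intro!: sum.cong)
      with True show ?thesis by (simp add: p cf_mult)
    next
      case False
      have "{s \<in> supp (cf f). z - s \<in> supp (cf (p h))} = {}"
        using s zs False by (auto simp: supp_def p split: if_splits)
      then have "conv (cf f) (cf (p h)) z = 0" unfolding conv_def by (simp only: sum.empty)
      with False show ?thesis by (simp add: p cf_mult)
    qed
  qed
  then have "f * p (rinv f) = p 1" using assms(2) by simp
  also have "p 1 = 1" by (rule qtorus_eqI) (simp add: p cf_1 latt_0)
  also have "1 = f * rinv f" using assms(2) by simp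
  finally have "p (rinv f) = rinv f" by (simp only: invble_cancel assms(2))
  then have "cf (rinv f) v = (if v \<in> latt then cf (rinv f) v else 0)" for v
    using p[of "rinv f" v] by simp
  then show ?thesis unfolding on_latt_def by metis
qed

lemma on_latt_ipow: "on_latt f \<Longrightarrow> invble f \<Longrightarrow> on_latt (ipow f z)"
  unfolding ipow_def by (auto intro: on_latt_rinv on_latt_power)

lemma on_latt_vp: "(\<And>\<beta>. on_latt (Q \<beta>)) \<Longrightarrow> (\<And>\<beta>. invble (Q \<beta>)) \<Longrightarrow> on_latt (vp Q w)"
  unfolding vp_def by (intro on_latt_prod_list on_latt_ipow)

lemma on_latt_QQ: "on_latt (QQ n \<alpha>)"
proof (induction n arbitrary: \<alpha> rule: less_induct)
  case (less n)
  show ?case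
  proof (cases "(n, \<alpha>)" rule: QQ.cases)
    case (1 \<beta>)
    then show ?thesis by (simp add: QQ_psi on_latt_qmon)
  next
    case (2 \<beta>)
    then show ?thesis by (simp add: QQ_psi on_latt_qmon)
  next
    case (3 k \<beta>)
    then have "on_latt (QQ (Suc k) \<beta>)" "on_latt (QQ k \<beta>)" for \<beta> using less by auto
    then show ?thesis
      using 3 by (auto simp: QQ.simps simp del: invble_QQ intro!: on_latt_mult on_latt_diff on_latt_1 on_latt_vp on_latt_tm on_latt_power on_latt_rinv invble_QQ)
  qed
qed

lemma pull_carrier: assumes "on_latt h" shows "pull h \<in> carrier (qring C)"
proof -
  obtain D where D: "finite D" "\<And>a y. cf h (a, y) \<noteq> 0 \<Longrightarrow> \<exists>d\<in>D. y - d \<in> nvec"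
    using tame_cf[of h] unfolding tame_def supp_def by auto
  have "finite {a. pull h a b \<noteq> 0}" for b
  proof -
    have "inj (\<lambda>a. (\<chi> \<beta>. dl * of_int (a $ \<beta>)) :: (rat, 'r) vec)"
      by (auto simp: inj_on_def vec_eq_iff)
    then have "finite ((\<lambda>a. (\<chi> \<beta>. dl * of_int (a $ \<beta>))) -` {a. cf h (a, yb b) \<noteq> 0})"
      by (intro finite_vimageI finite_slice)
    then show ?thesis by (simp add: pull_def psi_def vimage_def)
  qed
  moreover have "\<exists>D. finite D \<and> (\<forall>a b. pull h a b \<noteq> 0 \<longrightarrow> (\<exists>d\<in>D. \<exists>c. (\<forall>\<beta>. 0 \<le> c $ \<beta>) \<and> b = d - C *v c))"
  \<comment> \<open>A rational \<open>d\<close> matters only if \<open>yb b - d\<close> is a vector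
    of naturals for some \<open>b\<close>. Then minus \<open>cq *v d\<close> is integral and the
    floor changes nothing.\<close>
  proof (intro exI[of _ "(\<lambda>d. \<chi> \<beta>. \<lfloor>- ((cq *v d) $ \<beta>)\<rfloor>) ` D"] conjI allI impI)
    fix a b assume "pull h a b \<noteq> 0"
    then obtain d where d: "d \<in> D" "yb b - d \<in> nvec"
      using D by (auto simp: pull_def psi_def)
    define c where "c = (\<chi> \<beta>. \<lfloor>(yb b - d) $ \<beta>\<rfloor>)"
    have c: "of_int (c $ \<beta>) = (yb b - d) $ \<beta>" "0 \<le> c $ \<beta>" for \<beta>
    proof -
      obtain k where "(yb b - d) $ \<beta> = of_nat k" using d(2) by (auto simp: nvec_def elim!: Nats_cases)
      then show "of_int (c $ \<beta>) = (yb b - d) $ \<beta>" "0 \<le> c $ \<beta>" by (simp_all add: c_def)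
    qed
    have "(cq *v yb b) $ \<beta> = (cq *v (d + (yb b - d))) $ \<beta>" for \<beta> by simp
    then have eq: "- of_int (b $ \<beta>) = (cq *v d) $ \<beta> + of_int ((C *v c) $ \<beta>)" for \<beta>
      unfolding matrix_vector_right_distrib cq_yb
      by (simp add: matrix_vector_mult_def c(1)[symmetric] del: vector_minus_component)
    have "- ((cq *v d) $ \<beta>) = of_int (b $ \<beta> + (C *v c) $ \<beta>)" for \<beta>
      unfolding of_int_add using eq[of \<beta>] by linarith
    then have "b = (\<chi> \<beta>. \<lfloor>- ((cq *v d) $ \<beta>)\<rfloor>) - C *v c"
      by (simp only: floor_of_int) (simp add: vec_eq_iff)
    with c d show "\<exists>d\<in>(\<lambda>d. \<chi> \<beta>. \<lfloor>- ((cq *v d) $ \<beta>)\<rfloor>) ` D. \<exists>c. (\<forall>\<beta>. 0 \<le> c $ \<beta>) \<and> b = d - C *v c" by blast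
  qed (use D in simp)
  ultimately show ?thesis by (simp add: qring_def qcarrier_def)
qed

text \<open>Inverses and the variables \<open>Qup\<close> are definite descriptions over the
  carrier. By this surjectivity any candidate can be compared with the known one as a twisted
  series, where invertible factors cancel.\<close>

lemma carrier_pull: assumes "f \<in> carrier (qring C)" obtains h where "on_latt h" "f = pull h"
proof -
  obtain D where f: "\<And>b. finite {a. f a b \<noteq> 0}" and D: "finite D"
    "\<And>a b. f a b \<noteq> 0 \<Longrightarrow> \<exists>d\<in>D. \<exists>c. (\<forall>\<beta>. 0 \<le> c $ \<beta>) \<and> b = d - C *v c"
    using assms by (auto simp: qring_def qcarrier_def)
  define F where "F v = (if v \<in> latt then (case inv_into UNIV (\<lambda>(a, b). psi a b) v of (a, b) \<Rightarrow> f a b) else 0)" for v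
  have "inj (\<lambda>(a, b). psi a b)" by (auto simp: inj_on_def psi_inj)
  then have F: "F (psi a b) = f a b" for a b
    using inv_f_f[of "\<lambda>(a, b). psi a b" "(a, b)"] by (simp add: F_def)
  have "tame (supp F)"
    unfolding tame_def
  proof (intro conjI allI exI[of _ "yb ` D"] impI)
    fix y
    have "{a. (a, y) \<in> supp F} \<subseteq> (\<Union>b\<in>{b. yb b = y}. (\<lambda>a. (\<chi> \<beta>. dl * of_int (a $ \<beta>))) ` {a. f a b \<noteq> 0})"
    proof clarify
      fix a assume a: "(a, y) \<in> supp F"
      then have "(a, y) \<in> latt" by (auto simp: supp_def F_def split: if_splits)
      then obtain a' b where "(a, y) = psi a' b" by (rule latt_E)
      moreover from this have "f a' b \<noteq> 0" using a F by (simp add: supp_def)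
      ultimately show "a \<in> (\<Union>b\<in>{b. yb b = y}. (\<lambda>a. (\<chi> \<beta>. dl * of_int (a $ \<beta>))) ` {a. f a b \<noteq> 0})"
        by (auto simp: psi_def)
    qed
    moreover have "finite {b. yb b = y}"
    proof (cases "\<exists>b. yb b = y")
      case True
      then obtain b0 where "yb b0 = y" by blast
      then have "{b. yb b = y} = {b0}" using yb_inj by auto
      then show ?thesis by simp
    qed simp
    then have "finite (\<Union>b\<in>{b. yb b = y}. (\<lambda>a. (\<chi> \<beta>. dl * of_int (a $ \<beta>)) :: (rat, 'r) vec) ` {a. f a b \<noteq> 0})"
      by (intro finite_UN_I finite_imageI f)
    ultimately show "finite {a. (a, y) \<in> supp F}" by (rule finite_subset)
  next
    fix a y assume a: "(a, y) \<in> supp F"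
    then have "(a, y) \<in> latt" by (auto simp: supp_def F_def split: if_splits)
    then obtain a' b where ab: "(a, y) = psi a' b" by (rule latt_E)
    then have "f a' b \<noteq> 0" using a F by (simp add: supp_def)
    then obtain d c where dc: "d \<in> D" "\<And>\<beta>. 0 \<le> c $ \<beta>" "b = d - C *v c" using D by blast
    have "y - yb d = (\<chi> \<beta>. of_int (c $ \<beta>))"
    proof -
      have "cq *v (y - yb d - (\<chi> \<beta>. of_int (c $ \<beta>))) = 0"
        using ab dc cq_yb[of "d - C *v c"] cq_yb[of d]
        by (simp add: psi_def matrix_vector_mult_diff_distrib) (simp add: vec_eq_iff matrix_vector_mult_def)
      then show ?thesis using cq_ker by fastforce
    qed
    then have "y - yb d \<in> nvec"
    proof -
      have "of_int (c $ \<beta>) = (of_nat (nat (c $ \<beta>)) :: rat)" for \<beta> using dc(2)[of \<beta>] by (simp add: of_nat_nat)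
      then show ?thesis using \<open>y - yb d = _\<close> by (simp add: nvec_def)
    qed
    with dc show "\<exists>d\<in>yb ` D. y - d \<in> nvec" by blast
  qed (use D in simp)
  then have cF: "cf (Hs F) v = F v" for v by (simp add: cf_Hs)
  have "on_latt (Hs F)" unfolding on_latt_def cF by (auto simp: F_def split: if_splits)
  moreover have "f = pull (Hs F)" by (simp add: pull_def cF F)
  ultimately show thesis by (rule that)
qed

section \<open>The operations of \<open>qring C\<close> under the pullback\<close>

lemma pull_mult: assumes "on_latt g" "on_latt h" shows "pull g \<otimes>\<^bsub>qring C\<^esub> pull h = pull (g * h)"
proof (intro ext)
  fix a b
  let ?S = "{(a', b'). pull g a' b' \<noteq> 0 \<and> pull h (a - a') (b - b') \<noteq> 0}"
  have "{s \<in> supp (cf g). psi a b - s \<in> supp (cf h)} = (\<lambda>(a, b). psi a b) ` ?S" (is "?L = ?R")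
  proof (intro equalityI subsetI)
    fix s assume s: "s \<in> ?L"
    then have "s \<in> latt" using assms(1) unfolding on_latt_def supp_def by blast
    then obtain a' b' where "s = psi a' b'" by (rule latt_E)
    with s show "s \<in> ?R" by (auto simp: supp_def pull_def psi_diff intro!: image_eqI[of _ _ "(a', b')"])
  qed (auto simp: supp_def pull_def psi_diff)
  moreover have "inj_on (\<lambda>(a, b). psi a b) ?S" by (auto simp: inj_on_def psi_inj)
  ultimately have "pull (g * h) a b = (\<Sum>(a', b')\<in>?S. cf g (psi a' b') * cf h (psi a b - psi a' b') * tpow (tw (psi a' b') (psi a b - psi a' b')))"
    unfolding pull_def cf_mult conv_def by (simp add: sum.reindex case_prod_unfold)
  then show "(pull g \<otimes>\<^bsub>qring C\<^esub> pull h) a b = pull (g * h) a b"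
    by (simp add: qring_def qmult_def flip: psi_diff) (simp add: tw_psi pull_def)
qed

lemma pull_one: "\<one>\<^bsub>qring C\<^esub> = pull 1"
proof (intro ext)
  fix a b
  have "psi a b = 0 \<longleftrightarrow> a = 0 \<and> b = 0" using psi_inj[of a b 0 0] by simp
  then show "\<one>\<^bsub>qring C\<^esub> a b = pull 1 a b" by (simp add: qring_def pull_def cf_1 qmono_def)
qed

lemma pull_sc: "qmono c 0 0 = pull (sc c)"
proof (intro ext)
  fix a b :: "'r ivector"
  have "psi a b = 0 \<longleftrightarrow> a = 0 \<and> b = 0" using psi_inj[of a b 0 0] by simp
  then show "qmono c 0 0 a b = pull (sc c) a b" by (simp add: pull_def cf_sc qmono_def)
qed

lemma pull_add: "pull g \<oplus>\<^bsub>qring C\<^esub> pull h = pull (g + h)" and pull_zero: "\<zero>\<^bsub>qring C\<^esub> = pull 0"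
  by (simp_all add: qring_def pull_def fun_eq_iff)

lemma pull_inv: assumes "on_latt h" "invble h" shows "inv\<^bsub>qring C\<^esub> (pull h) = pull (rinv h)"
  unfolding m_inv_def
proof (rule the_equality)
  show "pull (rinv h) \<in> carrier (qring C) \<and> pull h \<otimes>\<^bsub>qring C\<^esub> pull (rinv h) = \<one>\<^bsub>qring C\<^esub> \<and> pull (rinv h) \<otimes>\<^bsub>qring C\<^esub> pull h = \<one>\<^bsub>qring C\<^esub>"
    using assms by (simp add: pull_carrier on_latt_rinv pull_mult pull_one)
next
  fix y assume y: "y \<in> carrier (qring C) \<and> pull h \<otimes>\<^bsub>qring C\<^esub> y = \<one>\<^bsub>qring C\<^esub> \<and> y \<otimes>\<^bsub>qring C\<^esub> pull h = \<one>\<^bsub>qring C\<^esub>"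
  then have "y \<in> carrier (qring C)" by blast
  then obtain g where g: "on_latt g" "y = pull g" by (rule carrier_pull)
  then have "pull (h * g) = pull 1" using y assms by (simp add: pull_mult pull_one)
  then have "h * g = 1" using pull_inj g assms by (metis on_latt_mult on_latt_1)
  then have "rinv h * (h * g) = rinv h" by simp
  then show "y = pull (rinv h)" using g assms by simp
qed

lemma pull_minus: assumes "on_latt g" "on_latt h" shows "pull g \<ominus>\<^bsub>qring C\<^esub> pull h = pull (g - h)"
proof -
  have "\<ominus>\<^bsub>qring C\<^esub> pull h = pull (- h)"
    unfolding a_inv_def m_inv_def
  proof (rule the_equality)
    fix y assume y: "y \<in> carrier (add_monoid (qring C)) \<and>
      pull h \<otimes>\<^bsub>add_monoid (qring C)\<^esub> y = \<one>\<^bsub>add_monoid (qring C)\<^esub> \<and> y \<otimes>\<^bsub>add_monoid (qring C)\<^esub> pull h = \<one>\<^bsub>add_monoid (qring C)\<^esub>"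
    then have "y \<in> carrier (qring C)" by simp
    then obtain g where g: "on_latt g" "y = pull g" by (rule carrier_pull)
    then have "pull (h + g) = pull 0" using y by (simp add: pull_add pull_zero)
    then have "h + g = 0" using pull_inj g assms by (metis on_latt_add on_latt_0)
    then have "g = - h" by (simp add: eq_neg_iff_add_eq_0 add.commute)
    then show "y = pull (- h)" using g by simp
  qed (use assms in \<open>simp add: pull_add pull_zero pull_carrier on_latt_minus\<close>)
  then show ?thesis by (simp add: a_minus_def pull_add)
qed

lemma pull_power: "on_latt h \<Longrightarrow> pull h [^]\<^bsub>qring C\<^esub> (k::nat) = pull (h ^ k)"
  by (induction k) (simp_all add: pull_one pull_mult on_latt_power power_commutes)

lemma pull_ipow: "on_latt h \<Longrightarrow> invble h \<Longrightarrow> pull h [^]\<^bsub>qring C\<^esub> (z::int) = pull (ipow h z)"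
  unfolding int_pow_def2 ipow_def
  by (cases "z < 0") (simp_all only: if_True if_False pull_power pull_inv on_latt_power invble_power)

lemma pull_oprod:
  assumes "\<And>i. i \<in> S \<Longrightarrow> on_latt (h i)" "\<And>i. i \<in> S \<Longrightarrow> f i = pull (h i)"
  shows "oprod (qring C) f S = pull (prod_list (map h (sorted_list_of_set S)))"
proof (cases "finite S")
  case True
  have "foldr (\<lambda>i x. f i \<otimes>\<^bsub>qring C\<^esub> x) xs \<one>\<^bsub>qring C\<^esub> = pull (prod_list (map h xs))" if "set xs \<subseteq> S" for xs
    using that by (induction xs) (use assms in \<open>auto simp: pull_one pull_mult on_latt_prod_list subset_iff\<close>)
  with True show ?thesis by (simp add: oprod_def)
qed (simp add: oprod_def pull_one)

lemma pull_oprod_UNIV: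
  assumes "\<And>i. on_latt (h i)" "\<And>i. f i = pull (h i)"
  shows "oprod (qring C) f UNIV = pull (prod_list (map h enumr))"
  unfolding enumr_def by (rule pull_oprod) (use assms in auto)

lemma prod_list_remove:
  assumes "distinct xs"
  shows "prod_list (map f (remove1 x xs)) = prod_list (map (\<lambda>y. if y = x then 1 else f y) xs)"
proof -
  have "remove1 x xs = filter (\<lambda>y. y \<noteq> x) xs"
    using assms by (simp add: distinct_remove1_removeAll removeAll_filter_not_eq) (metis (full_types))
  moreover have "prod_list (map f (filter (\<lambda>y. y \<noteq> x) xs)) = prod_list (map (\<lambda>y. if y = x then 1 else f y) xs)"
    by (induction xs) auto
  ultimately show ?thesis by simp
qed

lemma Qrhs_pull:
  "Qrhs C (\<lambda>\<alpha>. pull (QQ n \<alpha>)) \<alpha> = pull (QQ n \<alpha> ^ 2 - Y n \<alpha>)"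
proof -
  have "oprod (qring C) (\<lambda>\<beta>. pull (QQ n \<beta>) [^]\<^bsub>qring C\<^esub> (- C $ \<alpha> $ \<beta>)) (UNIV - {\<alpha>}) =
     pull (prod_list (map (\<lambda>\<beta>. ipow (QQ n \<beta>) (- C $ \<alpha> $ \<beta>)) (sorted_list_of_set (UNIV - {\<alpha>}))))"
    by (rule pull_oprod) (simp_all add: pull_ipow on_latt_QQ on_latt_ipow)
  also have "sorted_list_of_set (UNIV - {\<alpha>}) = remove1 \<alpha> enumr"
    unfolding enumr_def by (rule sorted_list_of_set_remove) simp
  also have "prod_list (map (\<lambda>\<beta>. ipow (QQ n \<beta>) (- C $ \<alpha> $ \<beta>)) (remove1 \<alpha> enumr)) = Y n \<alpha>"
    unfolding Y_def vp_def prod_list_remove[OF distinct_enumr]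
    by (rule arg_cong[of _ _ prod_list], rule map_cong[OF refl])
      (auto simp: C_axis C_sym[of _ \<alpha>], auto simp: axis_def)
  finally have "oprod (qring C) (\<lambda>\<beta>. pull (QQ n \<beta>) [^]\<^bsub>qring C\<^esub> (- C $ \<alpha> $ \<beta>)) (UNIV - {\<alpha>}) = pull (Y n \<alpha>)" .
  moreover have "on_latt (Y n \<alpha>)" unfolding Y_def by (intro on_latt_vp on_latt_QQ invble_QQ)
  ultimately show ?thesis
    unfolding Qrhs_def by (simp add: pull_power pull_minus on_latt_QQ on_latt_power)
qed

text \<open>The relation determines the new variable because \<open>QQ k \<alpha>\<close> can be
  cancelled on the right.\<close>

lemma Qup_pull: "Qup C n = (\<lambda>\<alpha>. pull (QQ n \<alpha>))"
proof (induction n rule: less_induct)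
  case (less n)
  consider "n = 0" | "n = Suc 0" | k where "n = Suc (Suc k)" by (metis not0_implies_Suc)
  then show ?case
  proof cases
    case 1
    then show ?thesis by (auto simp: fun_eq_iff Qgen0_def qmono_def pull_def QQ_psi cf_qmon psi_inj)
  next
    case 2
    then show ?thesis by (auto simp: fun_eq_iff Qgen1_def qmono_def pull_def QQ_psi cf_qmon psi_inj)
  next
    case (3 k)
    have k: "Qup C k = (\<lambda>\<alpha>. pull (QQ k \<alpha>))" "Qup C (Suc k) = (\<lambda>\<alpha>. pull (QQ (Suc k) \<alpha>))"
      using 3 less by auto
    have m: "qmono (tpow e) 0 0 \<otimes>\<^bsub>qring C\<^esub> (pull h \<otimes>\<^bsub>qring C\<^esub> pull (QQ k \<alpha>)) = pull (e \<triangleright> h * QQ k \<alpha>)" if "on_latt h" for e h \<alpha>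
      using that by (simp add: pull_sc pull_mult on_latt_QQ on_latt_mult on_latt_sc tm_def)
    have "Qup C (Suc (Suc k)) \<alpha> = pull (QQ (Suc (Suc k)) \<alpha>)" for \<alpha>
      unfolding Qup.simps(3) k Qrhs_pull
    proof (rule the_equality)
      have "(lm \<alpha> \<alpha>) \<triangleright> QQ (Suc (Suc k)) \<alpha> * QQ k \<alpha> = QQ (Suc k) \<alpha> ^ 2 - Y (Suc k) \<alpha>"
        by (simp only: QQ_rel tm_tm add.right_inverse tm_0)
      then show "pull (QQ (Suc (Suc k)) \<alpha>) \<in> carrier (qring C) \<and>
        qmono (tpow (lam C $ \<alpha> $ \<alpha>)) 0 0 \<otimes>\<^bsub>qring C\<^esub> (pull (QQ (Suc (Suc k)) \<alpha>) \<otimes>\<^bsub>qring C\<^esub> pull (QQ k \<alpha>)) =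
        pull (QQ (Suc k) \<alpha> ^ 2 - Y (Suc k) \<alpha>)"
        by (simp only: m on_latt_QQ pull_carrier lm_def simp_thms)
    next
      fix x assume x: "x \<in> carrier (qring C) \<and>
        qmono (tpow (lam C $ \<alpha> $ \<alpha>)) 0 0 \<otimes>\<^bsub>qring C\<^esub> (x \<otimes>\<^bsub>qring C\<^esub> pull (QQ k \<alpha>)) = pull (QQ (Suc k) \<alpha> ^ 2 - Y (Suc k) \<alpha>)"
      then have "x \<in> carrier (qring C)" by blast
      then obtain h where h: "on_latt h" "x = pull h" by (rule carrier_pull)
      have "on_latt (Y (Suc k) \<alpha>)" unfolding Y_def by (intro on_latt_vp on_latt_QQ invble_QQ)
      then have "on_latt (QQ (Suc k) \<alpha> ^ 2 - Y (Suc k) \<alpha>)" by (intro on_latt_diff on_latt_power on_latt_QQ)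
      moreover have "pull (lm \<alpha> \<alpha> \<triangleright> h * QQ k \<alpha>) = pull (QQ (Suc k) \<alpha> ^ 2 - Y (Suc k) \<alpha>)"
        using x h m by (simp only: lm_def)
      ultimately have "lm \<alpha> \<alpha> \<triangleright> h * QQ k \<alpha> = QQ (Suc k) \<alpha> ^ 2 - Y (Suc k) \<alpha>"
        using h by (intro pull_inj on_latt_tm on_latt_mult on_latt_QQ)
      then have "(- lm \<alpha> \<alpha>) \<triangleright> lm \<alpha> \<alpha> \<triangleright> h * QQ k \<alpha> = QQ (Suc (Suc k)) \<alpha> * QQ k \<alpha>"
        by (simp only: QQ_rel)
      then have "h * QQ k \<alpha> = QQ (Suc (Suc k)) \<alpha> * QQ k \<alpha>"
        by (simp only: tm_tm add.left_inverse tm_0)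
      then have "h = QQ (Suc (Suc k)) \<alpha>" by (simp only: invble_cancel invble_QQ)
      with h show "x = pull (QQ (Suc (Suc k)) \<alpha>)" by simp
    qed
    with 3 show ?thesis by blast
  qed
qed

lemma Qhat_pull: "Qhat C \<alpha> (int k) = pull (QQ k \<alpha>)"
  by (simp add: Qhat_def Qup_pull)

lemma Qhat_pull': "Qhat C \<alpha> 0 = pull (QQ 0 \<alpha>)" "Qhat C \<alpha> 1 = pull (QQ 1 \<alpha>)" "Qhat C \<alpha> (int k + 1) = pull (QQ (Suc k) \<alpha>)"
  using Qhat_pull[of \<alpha> 0] Qhat_pull[of \<alpha> 1] Qhat_pull[of \<alpha> "Suc k"] by (simp_all add: add.commute)

section \<open>The series \<open>z\<close> as a limit of ratios and as an infinite product\<close>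

definition zr :: "'r \<Rightarrow> nat \<Rightarrow> 'r qtorus" where "zr \<beta> k = QQ k \<beta> * rinv (QQ (Suc k) \<beta>)"

definition zf :: "'r \<Rightarrow> nat \<Rightarrow> 'r qtorus" where "zf \<beta> N = prod_list (map (\<lambda>k. rinv (1 - X k \<beta>)) [1..<Suc N])"

lemma on_latt_zr: "on_latt (zr \<beta> k)"
  unfolding zr_def by (intro on_latt_mult on_latt_rinv on_latt_QQ invble_QQ)

lemma on_latt_X: "on_latt (X k \<beta>)"
  unfolding X_def by (intro on_latt_vp on_latt_QQ invble_QQ)

lemma zratio_pull: "zratio C \<beta> = (\<lambda>k. pull (zr \<beta> k))"
  by (simp add: fun_eq_iff zratio_def Qhat_pull Qhat_pull' pull_inv pull_mult on_latt_QQ on_latt_rinv zr_def)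

lemma zfactor_pull: "zfactor C \<beta> (Suc k) = pull (rinv (1 - X (Suc k) \<beta>))"
proof -
  have "oprod (qring C) (\<lambda>\<alpha>. Qhat C \<alpha> (int (Suc k)) [^]\<^bsub>qring C\<^esub> (- C $ \<alpha> $ \<beta>)) UNIV =
      pull (prod_list (map (\<lambda>\<alpha>. ipow (QQ (Suc k) \<alpha>) (- C $ \<alpha> $ \<beta>)) enumr))"
    by (rule pull_oprod_UNIV) (simp_all only: Qhat_pull pull_ipow on_latt_QQ invble_QQ on_latt_ipow)
  also have "prod_list (map (\<lambda>\<alpha>. ipow (QQ (Suc k) \<alpha>) (- C $ \<alpha> $ \<beta>)) enumr) = X (Suc k) \<beta>"
    by (simp add: X_def vp_def C_axis)
  finally show ?thesis
    unfolding zfactor_def by (simp add: pull_one pull_minus pull_inv on_latt_1 on_latt_X on_latt_diff)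
qed

lemma zf_Suc: "zf \<beta> (Suc N) = zf \<beta> N * rinv (1 - X (Suc N) \<beta>)"
  by (simp add: zf_def)

text \<open>The product telescopes: \<open>zr \<beta> (Suc N)\<close> is \<open>zr \<beta> N\<close>
  times the inverse of \<open>1 - X (Suc N) \<beta>\<close>, because
  \<open>QQ (Suc N) \<beta>\<close> times the inverse of \<open>u N \<beta>\<close> is
  \<open>zr \<beta> N\<close>.\<close>

lemma zr_zf: "zr \<beta> N = zr \<beta> 0 * zf \<beta> N"
proof (induction N)
  case 0
  show ?case by (simp add: zf_def)
next
  case (Suc N)
  let ?a = "QQ N \<beta>" and ?b = "QQ (Suc N) \<beta>"
  have c: "?b * ?a = (- lm \<beta> \<beta>) \<triangleright> ?a * ?b"
    using qcomm_sym[OF qcomm_QQ[of \<beta> \<beta> N]] by (simp only: qcomm_def)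
  have "rinv (u N \<beta>) = lm \<beta> \<beta> \<triangleright> ?a * rinv ?b ^ 2"
    by (simp add: u_def rinv_tm rinv_mult rinv_power)
  then have "?b * rinv (u N \<beta>) = lm \<beta> \<beta> \<triangleright> (?b * ?a) * rinv ?b ^ 2"
    by (simp add: mult.assoc)
  also have "\<dots> = ?a * (?b * (rinv ?b * rinv ?b))"
    unfolding c by (simp add: mult.assoc power2_eq_square)
  also have "\<dots> = zr \<beta> N"
    unfolding zr_def by (simp)
  finally have "?b * rinv (u N \<beta>) = zr \<beta> N" .
  moreover have "zr \<beta> (Suc N) = ?b * rinv (u N \<beta>) * rinv (1 - X (Suc N) \<beta>)"
    unfolding zr_def[of _ "Suc N"] QQ_step by (simp add: rinv_mult mult.assoc)
  ultimately show ?case using Suc by (simp add: zf_Suc mult.assoc)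
qed

lemma inU_zf: "inU (zf \<beta> N)"
proof (induction N)
  case (Suc N)
  then show ?case unfolding zf_Suc by (intro inU_mult inU_inverse inU_X)
qed (simp add: zf_def inU_1)

text \<open>Each increment contains the factor \<open>X (Suc k) \<beta>\<close>, which has order at
  least \<open>k + 1\<close>.\<close>

lemma zf_lim: "\<exists>P. flim (zf \<beta>) P"
proof (rule flim_exists)
  show "pw (zf \<beta> k)" for k using inU_zf by (simp add: inU_def)
  fix k
  let ?R = "rinv (1 - X (Suc k) \<beta>)"
  have "(1 - X (Suc k) \<beta>) * ?R = 1" by simp
  then have "?R - 1 = X (Suc k) \<beta> * ?R" by (simp add: algebra_simps)
  then have "zf \<beta> k * (X (Suc k) \<beta> * ?R) = zf \<beta> k * (?R - 1)" by (simp only:)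
  then have "zf \<beta> (Suc k) - zf \<beta> k = zf \<beta> k * (X (Suc k) \<beta> * ?R)"
    by (simp add: zf_Suc right_diff_distrib)
  moreover have "hi (0 + (of_nat (Suc k) + 0)) (zf \<beta> k * (X (Suc k) \<beta> * ?R))"
    using inU_zf[of \<beta> k] inU_inverse(2)[OF inU_X[of k \<beta>]]
    by (intro hi_mult hi_X pw_hi) (simp_all add: inU_def)
  ultimately show "hi (of_nat (Suc k)) (zf \<beta> (Suc k) - zf \<beta> k)" by (simp only: add_0 add_0_right)
qed

definition zp :: "'r \<Rightarrow> 'r qtorus" where "zp \<beta> = (SOME P. flim (zf \<beta>) P)"

lemma flim_zp: "flim (zf \<beta>) (zp \<beta>)"
  unfolding zp_def using zf_lim by (rule someI_ex)

definition zs :: "'r \<Rightarrow> 'r qtorus" where "zs \<beta> = zr \<beta> 0 * zp \<beta>"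

lemma flim_zs: "flim (zr \<beta>) (zs \<beta>)"
proof -
  have "flim (\<lambda>N. zr \<beta> 0 * zf \<beta> N) (zs \<beta>)" unfolding zs_def by (intro flim_mult_left flim_zp)
  then show ?thesis by (simp only: zr_zf[symmetric])
qed

lemma on_latt_zf: "on_latt (zf \<beta> N)"
  unfolding zf_def
proof (rule on_latt_prod_list)
  fix k assume "k \<in> set [1..<Suc N]"
  then have "1 \<le> k" by auto
  then obtain j where "k = Suc j" by (cases k) auto
  then show "on_latt (rinv (1 - X k \<beta>))" by (simp add: on_latt_rinv on_latt_diff on_latt_1 on_latt_X)
qed

lemma on_latt_zs: "on_latt (zs \<beta>)" and on_latt_zp: "on_latt (zp \<beta>)"
  using on_latt_flim[OF flim_zs] on_latt_flim[OF flim_zp] on_latt_zr on_latt_zf by auto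

lemma qlim_pull: assumes "flim F f" "on_latt f" shows "has_qlim C (\<lambda>k. pull (F k)) (pull f)"
  unfolding has_qlim_def
proof (intro conjI allI)
  fix b
  show "\<forall>\<^sub>F k in sequentially. \<forall>a. pull (F k) a b = pull f a b"
    using flim_eventually[OF assms(1), of "yb b"] by eventually_elim (simp add: pull_def psi_def)
qed (rule pull_carrier[OF assms(2)])

lemma qlim_unique: assumes "has_qlim C F f" "has_qlim C F g" shows "f = g"
proof (intro ext)
  fix a b
  have "\<forall>\<^sub>F k in sequentially. \<forall>a. F k a b = f a b" "\<forall>\<^sub>F k in sequentially. \<forall>a. F k a b = g a b"
    using assms by (auto simp: has_qlim_def)
  then have "\<forall>\<^sub>F k in sequentially. f a b = g a b" by eventually_elim simp
  then show "f a b = g a b" by simp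
qed

lemma zser_pull: "zser C \<beta> = pull (zs \<beta>)" and zser_lim: "has_qlim C (zratio C \<beta>) (zser C \<beta>)"
proof -
  have *: "has_qlim C (zratio C \<beta>) (pull (zs \<beta>))"
    unfolding zratio_pull by (rule qlim_pull[OF flim_zs on_latt_zs])
  then show "zser C \<beta> = pull (zs \<beta>)" unfolding zser_def by (blast intro: qlim_unique)
  with * show "has_qlim C (zratio C \<beta>) (zser C \<beta>)" by simp
qed

lemma zser_prod: "\<exists>P. has_qprod C (zfactor C \<beta>) P \<and>
  zser C \<beta> = Qhat C \<beta> 0 \<otimes>\<^bsub>qring C\<^esub> inv\<^bsub>qring C\<^esub> (Qhat C \<beta> 1) \<otimes>\<^bsub>qring C\<^esub> P"
proof (intro exI conjI)
  have "oprod (qring C) (zfactor C \<beta>) {1..N} = pull (zf \<beta> N)" for N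
  proof -
    have "oprod (qring C) (zfactor C \<beta>) {1..N} = pull (prod_list (map (\<lambda>k. rinv (1 - X k \<beta>)) (sorted_list_of_set {1..N})))"
    proof (rule pull_oprod)
      fix k assume "k \<in> {1..N}"
      then obtain j where "k = Suc j" by (cases k) auto
      then show "on_latt (rinv (1 - X k \<beta>))" "zfactor C \<beta> k = pull (rinv (1 - X k \<beta>))"
        by (simp_all add: zfactor_pull on_latt_rinv on_latt_diff on_latt_1 on_latt_X)
    qed
    moreover have "sorted_list_of_set {1..N} = [1..<Suc N]"
      using sorted_list_of_set_range[of 1 "Suc N"] by (simp add: atLeastLessThanSuc_atLeastAtMost)
    ultimately show ?thesis by (simp only: zf_def)
  qed
  then show "has_qprod C (zfactor C \<beta>) (pull (zp \<beta>))"
    unfolding has_qprod_def by (simp only: qlim_pull[OF flim_zp on_latt_zp])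
  show "zser C \<beta> = Qhat C \<beta> 0 \<otimes>\<^bsub>qring C\<^esub> inv\<^bsub>qring C\<^esub> (Qhat C \<beta> 1) \<otimes>\<^bsub>qring C\<^esub> pull (zp \<beta>)"
    by (simp add: zser_pull Qhat_pull' pull_inv pull_mult on_latt_QQ on_latt_rinv on_latt_mult on_latt_zp zs_def zr_def)
qed

section \<open>Constant terms and the final identity\<close>

lemma CT_eval0: assumes "on_latt h" shows "CT (eval0 (pull h)) = ev h 0"
proof -
  let ?d = "\<lambda>a. (\<chi> \<beta>. dl * of_int (a $ \<beta>)) :: (rat, 'r) vec"
  have "{a. cf h (a, 0) \<noteq> 0} = ?d ` {a. pull h a 0 \<noteq> 0}" (is "?L = ?R")
  proof (intro equalityI subsetI)
    fix a assume a: "a \<in> ?L"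
    then have "(a, 0) \<in> latt" using assms by (simp add: on_latt_def)
    then obtain a' b where ab: "(a, 0) = psi a' b" by (rule latt_E)
    then have "yb b = yb 0" by (simp add: psi_def)
    then have "b = 0" by (simp only: yb_inj)
    with ab a show "a \<in> ?R" by (auto simp: pull_def psi_def)
  qed (auto simp: pull_def psi_def)
  moreover have "inj_on ?d {a. pull h a 0 \<noteq> 0}" by (auto simp: inj_on_def vec_eq_iff)
  ultimately show ?thesis
    unfolding CT_def eval0_def ev_def by (simp add: sum.reindex pull_def psi_def)
qed

text \<open>Normalizing one ratio costs half of \<open>lm \<beta> \<beta>\<close>, while different
  indices cost nothing. Together with the corresponding sum from the prefactor this is the origin of
  the summand with \<open>l\<close> in the final exponent.\<close>

lemma ratio_product:
  "prod_list (map (\<lambda>\<beta>. zr \<beta> K ^ (l \<beta> + 1)) enumr) =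
   (- (\<Sum>\<beta>\<in>UNIV. (of_nat (l \<beta>) + 1) * lm \<beta> \<beta>) / 2) \<triangleright> E K (sv l + 1) (- (sv l + 1))"
proof -
  have 1: "zr \<beta> K ^ (l \<beta> + 1) = sc 1 * ((- ((of_nat (l \<beta>) + 1) * lm \<beta> \<beta> / 2)) \<triangleright>
      E K ((sv l + 1) $ \<beta> *s axis \<beta> 1) ((sv l + 1) $ \<beta> *s - axis \<beta> 1))" for \<beta>
  proof -
    have "zr \<beta> K = E K (axis \<beta> 1) 0 * E K 0 (- axis \<beta> 1)"
    proof -
      have "rinv (QQ (Suc K) \<beta>) = E K 0 (- axis \<beta> 1)"
        using E_rinv[of K 0 "axis \<beta> 1"] by (simp only: E_Suc minus_zero)
      then show ?thesis by (simp only: zr_def E_at)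
    qed
    then have z: "zr \<beta> K = (- (lm \<beta> \<beta> / 2)) \<triangleright> E K (axis \<beta> 1) (- axis \<beta> 1)"
      by (simp add: E_mult lf_minus lf_axis_axis)
    show ?thesis
      unfolding z tm_power E_power by (simp add: sv_def add.commute)
  qed
  have "prod_list (map (\<lambda>\<beta>. E K ((sv l + 1) $ \<beta> *s axis \<beta> 1) ((sv l + 1) $ \<beta> *s - axis \<beta> 1)) enumr) =
    E K (sum_list (map (\<lambda>\<beta>. (sv l + 1) $ \<beta> *s axis \<beta> 1) enumr)) (sum_list (map (\<lambda>\<beta>. (sv l + 1) $ \<beta> *s - axis \<beta> 1) enumr))"
    by (rule E_prod_list) (simp_all add: lf_scale lf_minus lf_axis_axis lm_sym)
  also have "sum_list (map (\<lambda>\<beta>. (sv l + 1) $ \<beta> *s axis \<beta> 1) enumr) = sv l + 1"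
    unfolding sum_list_enumr by (rule vec_axis_sum)
  also have "sum_list (map (\<lambda>\<beta>. (sv l + 1) $ \<beta> *s - axis \<beta> 1) enumr) = - (sv l + 1)"
  proof -
    have "(sv l + 1) $ \<beta> *s - axis \<beta> 1 = - ((sv l + 1) $ \<beta> *s axis \<beta> 1)" for \<beta> :: 'r
      by (simp add: vec_eq_iff)
    then show ?thesis unfolding sum_list_enumr by (simp only: sum_negf vec_axis_sum)
  qed
  finally have 2: "prod_list (map (\<lambda>\<beta>. E K ((sv l + 1) $ \<beta> *s axis \<beta> 1) ((sv l + 1) $ \<beta> *s - axis \<beta> 1)) enumr) =
     E K (sv l + 1) (- (sv l + 1))" .
  have 3: "sum_list (map (\<lambda>\<beta>. - ((of_nat (l \<beta>) + 1) * lm \<beta> \<beta> / 2)) enumr) = - (\<Sum>\<beta>\<in>UNIV. (of_nat (l \<beta>) + 1) * lm \<beta> \<beta>) / 2"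
    unfolding sum_list_enumr by (simp add: sum_negf sum_divide_distrib)
  show ?thesis
    unfolding 1 prod_list_sc_tm 2 3 by (simp add: prod_list_enumr)
qed

lemma PP_const: assumes "\<And>\<alpha> i. i > k \<Longrightarrow> n \<alpha> i = 0" "k \<le> K" shows "PP n K = PP n k"
  using assms(2)
proof (induction K rule: dec_induct)
  case (step K)
  have "nv n (Suc K) = 0" using assms(1) step by (simp add: nv_def vec_eq_iff)
  with step show ?case by (simp add: PP_Suc)
qed simp

text \<open>For large \<open>K\<close> the constant term does not distinguish \<open>z\<close> from
  the ratio at level \<open>K\<close>, nor \<open>PP n k\<close> from \<open>PP n K\<close>, and
  \<open>MK_G\<close> applies. As the result is free of \<open>K\<close>, this also shows that the
  multiplicities stabilize, so that the definite description in \<open>Mmult\<close> is met.\<close>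

lemma multiplicity:
  assumes n: "\<And>\<alpha> i. i > k \<Longrightarrow> n \<alpha> i = 0"
  shows "Mmult C l n = tpow ((\<Sum>i\<in>{1..k}. lf 1 (nv n i))
     + ((\<Sum>\<beta>\<in>UNIV. of_nat (l \<beta>) * lm \<beta> \<beta>) + (\<Sum>i\<in>{1..k}. \<Sum>j\<in>{1..k}. of_nat (min i j) * lf (nv n i) (nv n j))) / 2) *
     ev (pre * (PP n k * prod_list (map (\<lambda>\<beta>. zs \<beta> ^ (l \<beta> + 1)) enumr))) 0" (is "_ = ?V")
proof -
  let ?P = "prod_list (map (\<lambda>\<beta>. zs \<beta> ^ (l \<beta> + 1)) enumr)"
  let ?PK = "\<lambda>K. prod_list (map (\<lambda>\<beta>. zr \<beta> K ^ (l \<beta> + 1)) enumr)"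
  have "flim (\<lambda>K. zr \<beta> K ^ j) (zs \<beta> ^ j)" for \<beta> j
    by (induction j) (auto intro: flim_mult flim_zs)
  then have "flim (\<lambda>K. pre * (PP n k * ?PK K)) (pre * (PP n k * ?P))"
    by (intro flim_mult_left flim_prod_list)
  then have "\<forall>\<^sub>F K in sequentially. ev (pre * (PP n k * ?PK K)) 0 = ev (pre * (PP n k * ?P)) 0"
    by (rule flim_ev)
  moreover have "\<forall>\<^sub>F K in sequentially. max 1 k \<le> K" by (rule eventually_ge_at_top)
  ultimately have "\<forall>\<^sub>F K in sequentially. MK C K l n = ?V"
  proof eventually_elim
    case (elim K)
    let ?e = "- (\<Sum>\<beta>\<in>UNIV. (of_nat (l \<beta>) + 1) * lm \<beta> \<beta>) / 2"
    have 1: "(\<Sum>i\<in>{1..K}. lf 1 (nv n i)) = (\<Sum>i\<in>{1..k}. lf 1 (nv n i))"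
    proof (rule sum.mono_neutral_right)
      have "nv n i = 0" if "i > k" for i using n[OF that] by (simp add: nv_def vec_eq_iff)
      then show "\<forall>i\<in>{1..K} - {1..k}. lf 1 (nv n i) = 0" by auto
    qed (use elim in auto)
    have 2: "(\<Sum>i\<in>{1..K}. \<Sum>j\<in>{1..K}. of_nat (min i j) * lf (nv n i) (nv n j)) =
        (\<Sum>i\<in>{1..k}. \<Sum>j\<in>{1..k}. of_nat (min i j) * lf (nv n i) (nv n j))"
    proof -
      have z: "nv n i = 0" if "i > k" for i using n[OF that] by (simp add: nv_def vec_eq_iff)
      have "(\<Sum>i\<in>{1..K}. \<Sum>j\<in>{1..K}. of_nat (min i j) * lf (nv n i) (nv n j)) =
          (\<Sum>i\<in>{1..k}. \<Sum>j\<in>{1..K}. of_nat (min i j) * lf (nv n i) (nv n j))"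
        by (rule sum.mono_neutral_right) (use elim z in auto)
      also have "\<dots> = (\<Sum>i\<in>{1..k}. \<Sum>j\<in>{1..k}. of_nat (min i j) * lf (nv n i) (nv n j))"
        by (intro sum.cong refl sum.mono_neutral_right) (use elim z in auto)
      finally show ?thesis .
    qed
    have PK: "PP n K = PP n k"
      by (rule PP_const) (use n elim(2) in auto)
    have "ev (pre * (PP n k * ?P)) 0 = ev (pre * (PP n K * ?PK K)) 0"
      unfolding PK by (rule elim(1)[symmetric])
    also have "\<dots> = tpow ?e * G n K (sv l + 1) (sv l + 1)"
      unfolding ratio_product G_def by (simp add: ev_tm mult.assoc)
    finally have 3: "ev (pre * (PP n k * ?P)) 0 = tpow ?e * G n K (sv l + 1) (sv l + 1)" .
    have "MK C K l n = tpow (- (\<Sum>\<beta>\<in>UNIV. lm \<beta> \<beta>) / 2 + (\<Sum>i\<in>{1..k}. lf 1 (nv n i))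
     + (\<Sum>i\<in>{1..k}. \<Sum>j\<in>{1..k}. of_nat (min i j) * lf (nv n i) (nv n j)) / 2) * G n K (sv l + 1) (sv l + 1)"
      using MK_G[of K l n] elim unfolding 1 2 by simp
    also have "\<dots> = ?V"
      unfolding 3 unfolding mult.assoc[symmetric] tpow_mult
      by (rule arg_cong[of _ _ "\<lambda>x. tpow x * _"])
        (simp add: distrib_right sum.distrib add_divide_distrib diff_divide_distrib)
    finally show ?case .
  qed
  then have ev: "\<forall>\<^sub>F K in sequentially. MK C K l n = ?V" .
  show ?thesis
    unfolding Mmult_def
  proof (rule the_equality[where P = "\<lambda>v. \<forall>\<^sub>F K in sequentially. MK C K l n = v"])
    fix v assume "\<forall>\<^sub>F K in sequentially. MK C K l n = v"
    with ev have "\<forall>\<^sub>F K in sequentially. v = ?V" by eventually_elim simp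
    then show "v = ?V" by simp
  qed (rule ev)
qed

lemma CT_rho:
  "CT (rho C
     (oprod (qring C)
        (\<lambda>i. oprod (qring C) (\<lambda>\<alpha>. Qhat C \<alpha> (int i) [^]\<^bsub>qring C\<^esub> n \<alpha> i) UNIV) {1..k}
      \<otimes>\<^bsub>qring C\<^esub> oprod (qring C) (\<lambda>\<beta>. zser C \<beta> [^]\<^bsub>qring C\<^esub> (l \<beta> + 1)) UNIV)) =
   ev (pre * (PP n k * prod_list (map (\<lambda>\<beta>. zs \<beta> ^ (l \<beta> + 1)) enumr))) 0"
proof -
  let ?p = "\<lambda>i. prod_list (map (\<lambda>\<alpha>. QQ i \<alpha> ^ n \<alpha> i) enumr)"
  let ?z = "prod_list (map (\<lambda>\<beta>. zs \<beta> ^ (l \<beta> + 1)) enumr)"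
  have "oprod (qring C) (\<lambda>\<alpha>. Qhat C \<alpha> (int i) [^]\<^bsub>qring C\<^esub> n \<alpha> i) UNIV = pull (?p i)" for i
    by (rule pull_oprod_UNIV) (simp_all only: Qhat_pull pull_power on_latt_power on_latt_QQ)
  moreover have ICp: "on_latt (?p i)" for i by (intro on_latt_prod_list on_latt_power on_latt_QQ)
  ultimately have "oprod (qring C) (\<lambda>i. oprod (qring C) (\<lambda>\<alpha>. Qhat C \<alpha> (int i) [^]\<^bsub>qring C\<^esub> n \<alpha> i) UNIV) {1..k} =
      pull (prod_list (map ?p (sorted_list_of_set {1..k})))"
    by (intro pull_oprod)
  also have "sorted_list_of_set {1..k} = [1..<Suc k]"
    using sorted_list_of_set_range[of 1 "Suc k"] by (simp add: atLeastLessThanSuc_atLeastAtMost)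
  finally have 1: "oprod (qring C) (\<lambda>i. oprod (qring C) (\<lambda>\<alpha>. Qhat C \<alpha> (int i) [^]\<^bsub>qring C\<^esub> n \<alpha> i) UNIV) {1..k} = pull (PP n k)"
    by (simp only: PP_def)
  have 2: "oprod (qring C) (\<lambda>\<beta>. zser C \<beta> [^]\<^bsub>qring C\<^esub> (l \<beta> + 1)) UNIV = pull ?z"
    by (rule pull_oprod_UNIV) (simp_all only: zser_pull pull_power on_latt_power on_latt_zs)
  have 3: "oprod (qring C) (\<lambda>\<beta>. Qhat C \<beta> 1 \<otimes>\<^bsub>qring C\<^esub> inv\<^bsub>qring C\<^esub> (Qhat C \<beta> 0)) UNIV = pull pre"
    unfolding pre_def
    by (rule pull_oprod_UNIV) (simp_all only: Qhat_pull' pull_inv on_latt_rinv on_latt_QQ invble_QQ pull_mult on_latt_mult)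
  have on_latt: "on_latt pre" "on_latt (PP n k)" "on_latt ?z"
    unfolding pre_def PP_def by (intro on_latt_prod_list on_latt_mult on_latt_rinv on_latt_QQ invble_QQ on_latt_power on_latt_zs)+
  show ?thesis
    unfolding rho_def 1 2 3 using on_latt by (simp only: pull_mult on_latt_mult CT_eval0)
qed

end

theorem theorem5p17:
  fixes C :: "('r::{finite,linorder}) imatrix"
    and l :: "'r \<Rightarrow> nat"
    and n :: "'r \<Rightarrow> nat \<Rightarrow> nat"
    and k :: nat
  assumes C: "simple_simply_laced_cartan_matrix C"
    and n: "\<And>\<alpha> i. i > k \<Longrightarrow> n \<alpha> i = 0"
  shows "(\<forall>\<beta>. has_qlim C (zratio C \<beta>) (zser C \<beta>) \<and>
            (\<exists>P. has_qprod C (zfactor C \<beta>) P \<and>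
               zser C \<beta> =
                 Qhat C \<beta> 0 \<otimes>\<^bsub>qring C\<^esub> inv\<^bsub>qring C\<^esub> (Qhat C \<beta> 1) \<otimes>\<^bsub>qring C\<^esub> P)) \<and>
         Mmult C l n =
           tpow ((\<Sum>\<alpha>\<in>UNIV. \<Sum>\<beta>\<in>UNIV. \<Sum>i\<in>{1..k}. of_nat (n \<alpha> i) * lam C $ \<alpha> $ \<beta>)
             + 1 / 2 * ((\<Sum>\<alpha>\<in>UNIV. of_nat (l \<alpha>) * lam C $ \<alpha> $ \<alpha>)
                 + (\<Sum>\<alpha>\<in>UNIV. \<Sum>\<beta>\<in>UNIV. \<Sum>i\<in>{1..k}. \<Sum>j\<in>{1..k}.
                      of_nat (n \<alpha> i) * lam C $ \<alpha> $ \<beta> * of_nat (min i j) * of_nat (n \<beta> j))))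
           * CT (rho C
               (oprod (qring C)
                  (\<lambda>i. oprod (qring C) (\<lambda>\<alpha>. Qhat C \<alpha> (int i) [^]\<^bsub>qring C\<^esub> n \<alpha> i) UNIV) {1..k}
                \<otimes>\<^bsub>qring C\<^esub> oprod (qring C) (\<lambda>\<beta>. zser C \<beta> [^]\<^bsub>qring C\<^esub> (l \<beta> + 1)) UNIV))"
proof -
  interpret cartan C by unfold_locales (rule C)
  have 1: "(\<Sum>i\<in>{1..k}. lf 1 (nv n i)) = (\<Sum>\<alpha>\<in>UNIV. \<Sum>\<beta>\<in>UNIV. \<Sum>i\<in>{1..k}. of_nat (n \<alpha> i) * lam C $ \<alpha> $ \<beta>)"
  proof -
    have "lf 1 (nv n i) = (\<Sum>\<alpha>\<in>UNIV. \<Sum>\<beta>\<in>UNIV. of_nat (n \<alpha> i) * lam C $ \<alpha> $ \<beta>)" for i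
      unfolding lf_sym[of 1] by (simp add: lf_def nv_def lm_def)
    then have "(\<Sum>i\<in>{1..k}. lf 1 (nv n i)) = (\<Sum>i\<in>{1..k}. \<Sum>\<alpha>\<in>UNIV. \<Sum>\<beta>\<in>UNIV. of_nat (n \<alpha> i) * lam C $ \<alpha> $ \<beta>)"
      by simp
    then show ?thesis by (simp only: sum.swap[of _ UNIV "{1..k}"])
  qed
  have 2: "(\<Sum>i\<in>{1..k}. \<Sum>j\<in>{1..k}. of_nat (min i j) * lf (nv n i) (nv n j)) =
     (\<Sum>\<alpha>\<in>UNIV. \<Sum>\<beta>\<in>UNIV. \<Sum>i\<in>{1..k}. \<Sum>j\<in>{1..k}. of_nat (n \<alpha> i) * lam C $ \<alpha> $ \<beta> * of_nat (min i j) * of_nat (n \<beta> j))"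
  proof -
    have "of_nat (min i j) * lf (nv n i) (nv n j) = (\<Sum>\<alpha>\<in>UNIV. \<Sum>\<beta>\<in>UNIV. of_nat (n \<alpha> i) * lam C $ \<alpha> $ \<beta> * of_nat (min i j) * of_nat (n \<beta> j))" for i j
      by (simp add: lf_def nv_def lm_def sum_distrib_left mult_ac)
    then show ?thesis by (simp only: sum.swap[of _ UNIV "{1..k}"])
  qed
  have "Mmult C l n =
           tpow ((\<Sum>\<alpha>\<in>UNIV. \<Sum>\<beta>\<in>UNIV. \<Sum>i\<in>{1..k}. of_nat (n \<alpha> i) * lam C $ \<alpha> $ \<beta>)
             + 1 / 2 * ((\<Sum>\<alpha>\<in>UNIV. of_nat (l \<alpha>) * lam C $ \<alpha> $ \<alpha>)
                 + (\<Sum>\<alpha>\<in>UNIV. \<Sum>\<beta>\<in>UNIV. \<Sum>i\<in>{1..k}. \<Sum>j\<in>{1..k}.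
                      of_nat (n \<alpha> i) * lam C $ \<alpha> $ \<beta> * of_nat (min i j) * of_nat (n \<beta> j))))
           * ev (pre * (PP n k * prod_list (map (\<lambda>\<beta>. zs \<beta> ^ (l \<beta> + 1)) enumr))) 0"
    using multiplicity[of k n l] n unfolding 1 2 by (simp add: lm_def)
  then show ?thesis
    unfolding CT_rho using zser_lim zser_prod by blast
qed

end
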